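(* Let $r$ be a positive integer, let $Z=(z_{i,j})$ be a generic skew-symmetric $r\times r$ matrix, $K$ an $F$-finite field of characteristic $p>0$, and $R=K[Z]$. For every integer $t\ge1$ with $2t\le r$, the ideal $P_{2t}(Z)$ generated by the $2t$-Pfaffians of $Z$ is symbolic $F$-split.
   Context: Generic skew-symmetric means $z_{i,j}=-z_{j,i}$, $z_{i,i}=0$, and the $z_{i,j}$ with $i<j$ are distinct indeterminates; $K[Z]$ is the polynomial ring in them. For $i_1<\dots<i_{2t}$, the principal minor of $Z$ with rows and columns $i_1,\dots,i_{2t}$ is the square of a polynomial, called a $2t$-Pfaffian of $Z$. For an ideal $I$ of $R$ and $n\ge0$, $I^{(n)}=I^nR_S\cap R$, where $S$ is the complement of the union of the minimal primes of $I$. The ideal $I$ is called symbolic $F$-split if there is an $R$-linear map $\phi:R^{1/p}\to R$ with $\phi|_R=\mathrm{id}_R$ (a splitting of the inclusion $R\subseteq R^{1/p}$) such that $\phi\big((I^{(np+1)})^{1/p}\big)\subseteq I^{(n+1)}$ for every $n\ge0$, where $R^{1/p}$ is the ring of $p$-th roots of elements of $R$ and $J^{1/p}=\{f^{1/p}\mid f\in J\}$. A field $K$ of characteristic $p$ is $F$-finite if $[K:K^p]<\infty$. *)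

theory Defs
  imports
    "HOL-Library.Poly_Mapping"
    "HOL-Library.Product_Lexorder"
    "HOL-Algebra.Embedded_Algebras"
    "HOL-Algebra.Ideal_Product"
    "HOL-Algebra.Algebraic_Closure_Type"
    "Jordan_Normal_Form.Determinant"
    "Jordan_Normal_Form.DL_Submatrix"
begin

section \<open>Localisation and symbolic powers\<close>

definition loc_rel :: "('a, 'b) ring_scheme \<Rightarrow> 'a set \<Rightarrow> (('a \<times> 'a) \<times> ('a \<times> 'a)) set" where
  "loc_rel R S = {((a, s), (b, t)). a \<in> carrier R \<and> s \<in> S \<and> b \<in> carrier R \<and> t \<in> S \<and>
     (\<exists>u\<in>S. u \<otimes>\<^bsub>R\<^esub> (a \<otimes>\<^bsub>R\<^esub> t \<ominus>\<^bsub>R\<^esub> b \<otimes>\<^bsub>R\<^esub> s) = \<zero>\<^bsub>R\<^esub>)}"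

definition loc_frac :: "('a, 'b) ring_scheme \<Rightarrow> 'a set \<Rightarrow> 'a \<Rightarrow> 'a \<Rightarrow> ('a \<times> 'a) set" where
  "loc_frac R S a s = loc_rel R S `` {(a, s)}"

definition localization :: "('a, 'b) ring_scheme \<Rightarrow> 'a set \<Rightarrow> ('a \<times> 'a) set ring" where
  "localization R S =
     \<lparr> carrier = (carrier R \<times> S) // loc_rel R S,
       monoid.mult = (\<lambda>C D. \<Union>x\<in>C. \<Union>y\<in>D.
         loc_frac R S (fst x \<otimes>\<^bsub>R\<^esub> fst y) (snd x \<otimes>\<^bsub>R\<^esub> snd y)),
       one = loc_frac R S \<one>\<^bsub>R\<^esub> \<one>\<^bsub>R\<^esub>,
       ring.zero = loc_frac R S \<zero>\<^bsub>R\<^esub> \<one>\<^bsub>R\<^esub>,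
       add = (\<lambda>C D. \<Union>x\<in>C. \<Union>y\<in>D.
         loc_frac R S ((fst x \<otimes>\<^bsub>R\<^esub> snd y) \<oplus>\<^bsub>R\<^esub> (fst y \<otimes>\<^bsub>R\<^esub> snd x)) (snd x \<otimes>\<^bsub>R\<^esub> snd y)) \<rparr>"

text \<open>The operations are well defined on classes, and the result is a commutative ring.\<close>

context cring
begin

context
  fixes S :: "'a set"
  assumes S_sub: "S \<subseteq> carrier R" and S_one: "\<one> \<in> S"
    and S_mult: "\<And>s t. s \<in> S \<Longrightarrow> t \<in> S \<Longrightarrow> s \<otimes> t \<in> S"
begin

lemma loc_rel_iff:
  "((a, s), (b, t)) \<in> loc_rel R S \<longleftrightarrow> a \<in> carrier R \<and> s \<in> S \<and> b \<in> carrier R \<and> t \<in> S \<and>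
     (\<exists>u\<in>S. u \<otimes> (a \<otimes> t) = u \<otimes> (b \<otimes> s))"
proof -
  have "u \<otimes> (a \<otimes> t \<ominus> b \<otimes> s) = \<zero> \<longleftrightarrow> u \<otimes> (a \<otimes> t) = u \<otimes> (b \<otimes> s)"
    if "u \<in> carrier R" "a \<in> carrier R" "s \<in> carrier R" "b \<in> carrier R" "t \<in> carrier R" for u
  proof -
    have "u \<otimes> (a \<otimes> t \<ominus> b \<otimes> s) = u \<otimes> (a \<otimes> t) \<ominus> u \<otimes> (b \<otimes> s)"
      using that by algebra
    thus ?thesis using that by simp
  qed
  thus ?thesis using S_sub unfolding loc_rel_def by auto
qed

lemma loc_rel_equiv: "equiv (carrier R \<times> S) (loc_rel R S)"
proof (rule equivI)
  show "loc_rel R S \<subseteq> (carrier R \<times> S) \<times> (carrier R \<times> S)"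
    by (auto simp: loc_rel_def)
  show "refl_on (carrier R \<times> S) (loc_rel R S)"
    using S_one by (auto simp: refl_on_def loc_rel_iff)
  show "sym (loc_rel R S)"
    by (auto simp: sym_def loc_rel_iff) metis
  show "trans (loc_rel R S)"
  proof (rule transI, clarify)
    fix a s b t c w
    assume 1: "((a, s), (b, t)) \<in> loc_rel R S" and 2: "((b, t), (c, w)) \<in> loc_rel R S"
    from 1 obtain u where u: "u \<in> S" "u \<otimes> (a \<otimes> t) = u \<otimes> (b \<otimes> s)" by (auto simp: loc_rel_iff)
    from 2 obtain v where v: "v \<in> S" "v \<otimes> (b \<otimes> w) = v \<otimes> (c \<otimes> t)" by (auto simp: loc_rel_iff)
    have S: "s \<in> S" "t \<in> S" "w \<in> S" and ac: "a \<in> carrier R" "b \<in> carrier R" "c \<in> carrier R"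
      using 1 2 by (auto simp: loc_rel_iff)
    have c: "s \<in> carrier R" "t \<in> carrier R" "w \<in> carrier R" "u \<in> carrier R" "v \<in> carrier R"
      using S u v S_sub by auto
    have "(u \<otimes> v \<otimes> t) \<otimes> (a \<otimes> w) = (v \<otimes> w) \<otimes> (u \<otimes> (a \<otimes> t))" using c ac by algebra
    also have "\<dots> = (u \<otimes> s) \<otimes> (v \<otimes> (b \<otimes> w))" unfolding u using c ac by algebra
    also have "\<dots> = (u \<otimes> v \<otimes> t) \<otimes> (c \<otimes> s)" unfolding v using c ac by algebra
    finally show "((a, s), (c, w)) \<in> loc_rel R S"
      using S ac S_mult u v by (auto simp: loc_rel_iff)
  qed
qed

lemma loc_frac_eq_iff:
  assumes "a \<in> carrier R" "b \<in> carrier R" "s \<in> S" "t \<in> S"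
  shows "loc_frac R S a s = loc_frac R S b t \<longleftrightarrow> (\<exists>u\<in>S. u \<otimes> (a \<otimes> t) = u \<otimes> (b \<otimes> s))"
  unfolding loc_frac_def
  using assms eq_equiv_class_iff[OF loc_rel_equiv, of "(a, s)" "(b, t)"] by (auto simp: loc_rel_iff)

lemma loc_fracI: "a \<in> carrier R \<Longrightarrow> s \<in> S \<Longrightarrow> (a, s) \<in> loc_frac R S a s"
  unfolding loc_frac_def using S_one by (auto simp: loc_rel_iff)

lemma loc_fracD: "(b, t) \<in> loc_frac R S a s \<Longrightarrow> b \<in> carrier R \<and> t \<in> S \<and> (\<exists>u\<in>S. u \<otimes> (a \<otimes> t) = u \<otimes> (b \<otimes> s))"
  unfolding loc_frac_def by (auto simp: loc_rel_iff)

lemma loc_carrier: "carrier (localization R S) = {loc_frac R S a s |a s. a \<in> carrier R \<and> s \<in> S}"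
  unfolding localization_def loc_frac_def quotient_def by auto

lemma UN_const: "x \<in> C \<Longrightarrow> y \<in> D \<Longrightarrow> (\<And>x y. x \<in> C \<Longrightarrow> y \<in> D \<Longrightarrow> F x y = Z) \<Longrightarrow> (\<Union>x\<in>C. \<Union>y\<in>D. F x y) = Z"
  by blast

lemma loc_mult:
  assumes "a \<in> carrier R" "b \<in> carrier R" "s \<in> S" "t \<in> S"
  shows "loc_frac R S a s \<otimes>\<^bsub>localization R S\<^esub> loc_frac R S b t = loc_frac R S (a \<otimes> b) (s \<otimes> t)"
proof -
  have "(\<Union>x\<in>loc_frac R S a s. \<Union>y\<in>loc_frac R S b t.
      loc_frac R S (fst x \<otimes> fst y) (snd x \<otimes> snd y)) = loc_frac R S (a \<otimes> b) (s \<otimes> t)"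
  proof (rule UN_const[OF loc_fracI loc_fracI])
    fix x y assume "x \<in> loc_frac R S a s" "y \<in> loc_frac R S b t"
    then obtain a' s' b' t' where xy: "x = (a', s')" "y = (b', t')"
      and "(a', s') \<in> loc_frac R S a s" "(b', t') \<in> loc_frac R S b t" by (metis surj_pair)
    then obtain u v where *: "a' \<in> carrier R" "b' \<in> carrier R" "s' \<in> S" "t' \<in> S"
       "u \<in> S" "v \<in> S" and u: "u \<otimes> (a \<otimes> s') = u \<otimes> (a' \<otimes> s)" and v: "v \<otimes> (b \<otimes> t') = v \<otimes> (b' \<otimes> t)"
      by (auto dest!: loc_fracD)
    have c: "s \<in> carrier R" "t \<in> carrier R" "s' \<in> carrier R" "t' \<in> carrier R" "u \<in> carrier R" "v \<in> carrier R"
      using * assms S_sub by auto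
    have "(u \<otimes> v) \<otimes> ((a \<otimes> b) \<otimes> (s' \<otimes> t')) = (u \<otimes> (a \<otimes> s')) \<otimes> (v \<otimes> (b \<otimes> t'))"
      using c * assms by algebra
    also have "\<dots> = (u \<otimes> v) \<otimes> ((a' \<otimes> b') \<otimes> (s \<otimes> t))" unfolding u v using c * assms by algebra
    finally have "\<exists>w\<in>S. w \<otimes> ((a' \<otimes> b') \<otimes> (s \<otimes> t)) = w \<otimes> ((a \<otimes> b) \<otimes> (s' \<otimes> t'))"
      using * S_mult by metis
    thus "loc_frac R S (fst x \<otimes> fst y) (snd x \<otimes> snd y) = loc_frac R S (a \<otimes> b) (s \<otimes> t)"
      unfolding xy using * assms S_mult by (subst loc_frac_eq_iff) auto
  qed (use assms in auto)
  thus ?thesis by (simp add: localization_def)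
qed

lemma loc_add:
  assumes "a \<in> carrier R" "b \<in> carrier R" "s \<in> S" "t \<in> S"
  shows "loc_frac R S a s \<oplus>\<^bsub>localization R S\<^esub> loc_frac R S b t =
    loc_frac R S (a \<otimes> t \<oplus> b \<otimes> s) (s \<otimes> t)"
proof -
  have "(\<Union>x\<in>loc_frac R S a s. \<Union>y\<in>loc_frac R S b t.
      loc_frac R S (fst x \<otimes> snd y \<oplus> fst y \<otimes> snd x) (snd x \<otimes> snd y)) =
      loc_frac R S (a \<otimes> t \<oplus> b \<otimes> s) (s \<otimes> t)"
  proof (rule UN_const[OF loc_fracI loc_fracI])
    fix x y assume "x \<in> loc_frac R S a s" "y \<in> loc_frac R S b t"
    then obtain a' s' b' t' where xy: "x = (a', s')" "y = (b', t')"
      and "(a', s') \<in> loc_frac R S a s" "(b', t') \<in> loc_frac R S b t" by (metis surj_pair)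
    then obtain u v where *: "a' \<in> carrier R" "b' \<in> carrier R" "s' \<in> S" "t' \<in> S"
       "u \<in> S" "v \<in> S" and u: "u \<otimes> (a \<otimes> s') = u \<otimes> (a' \<otimes> s)" and v: "v \<otimes> (b \<otimes> t') = v \<otimes> (b' \<otimes> t)"
      by (auto dest!: loc_fracD)
    have c: "s \<in> carrier R" "t \<in> carrier R" "s' \<in> carrier R" "t' \<in> carrier R" "u \<in> carrier R" "v \<in> carrier R"
      using * assms S_sub by auto
    have "(u \<otimes> v) \<otimes> ((a \<otimes> t \<oplus> b \<otimes> s) \<otimes> (s' \<otimes> t')) =
        (v \<otimes> t \<otimes> t') \<otimes> (u \<otimes> (a \<otimes> s')) \<oplus> (u \<otimes> s \<otimes> s') \<otimes> (v \<otimes> (b \<otimes> t'))"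
      using c * assms by algebra
    also have "\<dots> = (u \<otimes> v) \<otimes> ((a' \<otimes> t' \<oplus> b' \<otimes> s') \<otimes> (s \<otimes> t))"
      unfolding u v using c * assms by algebra
    finally have "\<exists>w\<in>S. w \<otimes> ((a' \<otimes> t' \<oplus> b' \<otimes> s') \<otimes> (s \<otimes> t)) = w \<otimes> ((a \<otimes> t \<oplus> b \<otimes> s) \<otimes> (s' \<otimes> t'))"
      using * S_mult by metis
    thus "loc_frac R S (fst x \<otimes> snd y \<oplus> fst y \<otimes> snd x) (snd x \<otimes> snd y) =
        loc_frac R S (a \<otimes> t \<oplus> b \<otimes> s) (s \<otimes> t)"
      unfolding xy using * c assms S_mult by (subst loc_frac_eq_iff) auto
  qed (use assms in auto)
  thus ?thesis by (simp add: localization_def)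
qed

lemma loc_one: "\<one>\<^bsub>localization R S\<^esub> = loc_frac R S \<one> \<one>"
  and loc_zero: "\<zero>\<^bsub>localization R S\<^esub> = loc_frac R S \<zero> \<one>"
  by (simp_all add: localization_def)

lemma loc_eqI:
  assumes "a \<in> carrier R" "b \<in> carrier R" "s \<in> S" "t \<in> S" "a \<otimes> t = b \<otimes> s"
  shows "loc_frac R S a s = loc_frac R S b t"
  using assms S_one by (subst loc_frac_eq_iff) auto

lemma localization_cring: "cring (localization R S)"
proof -
  note [simp] = loc_mult loc_add loc_one loc_zero S_mult S_one
  have S_c [simp]: "s \<in> S \<Longrightarrow> s \<in> carrier R" for s using S_sub by auto
  have fr: "\<exists>a s. x = loc_frac R S a s \<and> a \<in> carrier R \<and> s \<in> S" if "x \<in> carrier (localization R S)" for x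
    using that by (auto simp: loc_carrier)
  have mem [simp]: "loc_frac R S a s \<in> carrier (localization R S)" if "a \<in> carrier R" "s \<in> S" for a s
    using that by (auto simp: loc_carrier)
  show ?thesis
  proof (rule cringI)
    show "abelian_group (localization R S)"
    proof (rule abelian_groupI)
      fix x y z assume "x \<in> carrier (localization R S)" "y \<in> carrier (localization R S)"
        "z \<in> carrier (localization R S)"
      then obtain a s b t c w where [simp]: "x = loc_frac R S a s" "y = loc_frac R S b t" "z = loc_frac R S c w"
        "a \<in> carrier R" "s \<in> S" "b \<in> carrier R" "t \<in> S" "c \<in> carrier R" "w \<in> S"
        using fr by metis
      have c: "s \<in> carrier R" "t \<in> carrier R" "w \<in> carrier R" "a \<in> carrier R" "b \<in> carrier R" "c \<in> carrier R" by auto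
      show "x \<oplus>\<^bsub>localization R S\<^esub> y \<oplus>\<^bsub>localization R S\<^esub> z =
            x \<oplus>\<^bsub>localization R S\<^esub> (y \<oplus>\<^bsub>localization R S\<^esub> z)"
        by (simp, rule loc_eqI) (simp, simp, simp, simp, use c in algebra)
    next
      fix x y assume "x \<in> carrier (localization R S)" "y \<in> carrier (localization R S)"
      then obtain a s b t where [simp]: "x = loc_frac R S a s" "y = loc_frac R S b t"
        "a \<in> carrier R" "s \<in> S" "b \<in> carrier R" "t \<in> S"
        using fr by metis
      have c: "s \<in> carrier R" "t \<in> carrier R" "a \<in> carrier R" "b \<in> carrier R" by auto
      show "x \<oplus>\<^bsub>localization R S\<^esub> y \<in> carrier (localization R S)" by simp
      show "x \<oplus>\<^bsub>localization R S\<^esub> y = y \<oplus>\<^bsub>localization R S\<^esub> x"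
        by (simp, rule loc_eqI) (simp, simp, simp, simp, use c in algebra)
    next
      fix x assume "x \<in> carrier (localization R S)"
      then obtain a s where [simp]: "x = loc_frac R S a s" "a \<in> carrier R" "s \<in> S"
        using fr by metis
      have c: "s \<in> carrier R" "a \<in> carrier R" by auto
      show "\<zero>\<^bsub>localization R S\<^esub> \<oplus>\<^bsub>localization R S\<^esub> x = x" by simp
      have "loc_frac R S (\<ominus> a) s \<oplus>\<^bsub>localization R S\<^esub> x = \<zero>\<^bsub>localization R S\<^esub>"
        by (simp, rule loc_eqI) (simp, simp, simp, simp, use c in algebra)
      thus "\<exists>y\<in>carrier (localization R S). y \<oplus>\<^bsub>localization R S\<^esub> x = \<zero>\<^bsub>localization R S\<^esub>"
        using mem[of "\<ominus> a" s] by (metis \<open>a \<in> carrier R\<close> \<open>s \<in> S\<close> a_inv_closed)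
    qed simp
    show "comm_monoid (localization R S)"
    proof (rule comm_monoidI)
      fix x y z assume "x \<in> carrier (localization R S)" "y \<in> carrier (localization R S)"
        "z \<in> carrier (localization R S)"
      then obtain a s b t c w where [simp]: "x = loc_frac R S a s" "y = loc_frac R S b t" "z = loc_frac R S c w"
        "a \<in> carrier R" "s \<in> S" "b \<in> carrier R" "t \<in> S" "c \<in> carrier R" "w \<in> S"
        using fr by metis
      show "x \<otimes>\<^bsub>localization R S\<^esub> y \<otimes>\<^bsub>localization R S\<^esub> z =
            x \<otimes>\<^bsub>localization R S\<^esub> (y \<otimes>\<^bsub>localization R S\<^esub> z)"
        by (simp add: m_assoc)
    next
      fix x y assume "x \<in> carrier (localization R S)" "y \<in> carrier (localization R S)"
      then obtain a s b t where [simp]: "x = loc_frac R S a s" "y = loc_frac R S b t"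
        "a \<in> carrier R" "s \<in> S" "b \<in> carrier R" "t \<in> S"
        using fr by metis
      show "x \<otimes>\<^bsub>localization R S\<^esub> y \<in> carrier (localization R S)" by simp
      show "x \<otimes>\<^bsub>localization R S\<^esub> y = y \<otimes>\<^bsub>localization R S\<^esub> x" by (simp add: m_comm)
    next
      fix x assume "x \<in> carrier (localization R S)"
      then obtain a s where [simp]: "x = loc_frac R S a s" "a \<in> carrier R" "s \<in> S"
        using fr by metis
      show "\<one>\<^bsub>localization R S\<^esub> \<otimes>\<^bsub>localization R S\<^esub> x = x" by simp
    qed simp
    fix x y z assume "x \<in> carrier (localization R S)" "y \<in> carrier (localization R S)"
      "z \<in> carrier (localization R S)"
    then obtain a s b t c w where [simp]: "x = loc_frac R S a s" "y = loc_frac R S b t" "z = loc_frac R S c w"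
      "a \<in> carrier R" "s \<in> S" "b \<in> carrier R" "t \<in> S" "c \<in> carrier R" "w \<in> S"
      using fr by metis
    have c: "s \<in> carrier R" "t \<in> carrier R" "w \<in> carrier R" "a \<in> carrier R" "b \<in> carrier R" "c \<in> carrier R" by auto
    show "(x \<oplus>\<^bsub>localization R S\<^esub> y) \<otimes>\<^bsub>localization R S\<^esub> z =
       x \<otimes>\<^bsub>localization R S\<^esub> z \<oplus>\<^bsub>localization R S\<^esub> y \<otimes>\<^bsub>localization R S\<^esub> z"
      by (simp, rule loc_eqI) (simp, simp, simp, simp, use c in algebra)
  qed
qed

end
end

definition minimal_primes :: "('a, 'b) ring_scheme \<Rightarrow> 'a set \<Rightarrow> 'a set set" where
  "minimal_primes R I = {P. primeideal P R \<and> I \<subseteq> P \<and>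
     (\<forall>Q. primeideal Q R \<and> I \<subseteq> Q \<and> Q \<subseteq> P \<longrightarrow> Q = P)}"

text \<open>The intersection of \<open>I\<^sup>n R\<^sub>S\<close> with \<open>R\<close> is the preimage of the extended
  ideal under the canonical map \<open>a \<mapsto> a / 1\<close>. The power \<open>I\<^sup>n\<close> is taken in the monoid of
  ideals under the ideal product, so \<open>I\<^sup>0 = R\<close>.\<close>

definition symbolic_power :: "('a, 'b) ring_scheme \<Rightarrow> 'a set \<Rightarrow> nat \<Rightarrow> 'a set" where
  "symbolic_power R I n =
     (let S = carrier R - \<Union>(minimal_primes R I);
          \<iota> = (\<lambda>a. loc_frac R S a \<one>\<^bsub>R\<^esub>)
      in {f \<in> carrier R. \<iota> f \<in> Idl\<^bsub>localization R S\<^esub> (\<iota> ` (I [^]\<^bsub>ideals_set R\<^esub> n))})"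


section \<open>Symbolic F-splitting\<close>

definition subring_of :: "'a::comm_ring_1 set \<Rightarrow> 'a ring" where
  "subring_of A = ring_of_type_algebra \<lparr>carrier := A\<rparr>"

lemma subring_of_cring:
  assumes "1 \<in> A" "\<And>x y. x \<in> A \<Longrightarrow> y \<in> A \<Longrightarrow> x - y \<in> A" "\<And>x y. x \<in> A \<Longrightarrow> y \<in> A \<Longrightarrow> x * y \<in> A"
  shows "cring (subring_of A)"
proof -
  have z: "0 \<in> A" using assms(1,2) by force
  have m: "- x \<in> A" if "x \<in> A" for x using assms(2)[OF z that] by simp
  have a: "x + y \<in> A" if "x \<in> A" "y \<in> A" for x y using assms(2)[OF that(1) m[OF that(2)]] by simp
  show ?thesis
    unfolding subring_of_def ring_of_type_algebra_def
    by (rule cringI; (rule abelian_groupI comm_monoidI)?)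
       (use assms z m a in \<open>auto simp: algebra_simps intro!: bexI[of _ "- x" for x]\<close>)
qed

definition ac_embed :: "'a::idom \<Rightarrow> 'a fract alg_closure" where
  "ac_embed a = to_ac (to_fract a)"

text \<open>\<open>J\<^bsup>1/p\<^esup>\<close>, taken inside an algebraic closure of the fraction field. In characteristic
  \<open>p\<close> every element has exactly one \<open>p\<close>-th root there.\<close>

definition pth_roots :: "nat \<Rightarrow> 'a::idom set \<Rightarrow> 'a fract alg_closure set" where
  "pth_roots p J = {x. x ^ p \<in> ac_embed ` J}"

text \<open>\<open>A\<close> is (the underlying set of) a subring of an integral domain of characteristic \<open>p\<close>,
  and \<open>I\<close> is an ideal of \<open>A\<close>.\<close>

definition symbolic_F_split :: "nat \<Rightarrow> 'a::idom set \<Rightarrow> 'a set \<Rightarrow> bool" where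
  "symbolic_F_split p A I \<longleftrightarrow>
     (\<exists>\<phi> :: 'a fract alg_closure \<Rightarrow> 'a.
        \<phi> \<in> pth_roots p A \<rightarrow> A \<and>
        (\<forall>x\<in>pth_roots p A. \<forall>y\<in>pth_roots p A. \<phi> (x + y) = \<phi> x + \<phi> y) \<and>
        (\<forall>a\<in>A. \<forall>x\<in>pth_roots p A. \<phi> (ac_embed a * x) = a * \<phi> x) \<and>
        (\<forall>a\<in>A. \<phi> (ac_embed a) = a) \<and>
        (\<forall>n. \<phi> ` pth_roots p (symbolic_power (subring_of A) I (n * p + 1))
              \<subseteq> symbolic_power (subring_of A) I (n + 1)))"

definition F_finite :: "'k::field itself \<Rightarrow> bool" where
  "F_finite _ \<longleftrightarrow> ring.finite_dimension (ring_of_type_algebra :: 'k ring)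
     (range (\<lambda>x::'k. x ^ CHAR('k))) UNIV"


section \<open>Generic skew-symmetric matrices and Pfaffians\<close>

text \<open>Polynomials in indeterminates indexed by pairs of natural numbers: a monomial is a finitely
  supported exponent function. Rows and columns are numbered from \<open>0\<close>.\<close>

type_synonym 'k pair_poly = "((nat \<times> nat) \<Rightarrow>\<^sub>0 nat) \<Rightarrow>\<^sub>0 'k"

definition indet :: "nat \<Rightarrow> nat \<Rightarrow> 'k::field pair_poly" where
  "indet i j = Poly_Mapping.single (Poly_Mapping.single (i, j) 1) 1"

definition skew_poly_ring :: "nat \<Rightarrow> 'k::field pair_poly set" where
  "skew_poly_ring r = {f. \<forall>m\<in>Poly_Mapping.keys f. Poly_Mapping.keys m \<subseteq> {(i, j). i < j \<and> j < r}}"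

lemma skew_poly_ring_cring: "cring (subring_of (skew_poly_ring r :: 'k::field pair_poly set))"
proof (rule subring_of_cring)
  show "(1 :: 'k pair_poly) \<in> skew_poly_ring r"
    by (simp add: skew_poly_ring_def)
  fix f g :: "'k pair_poly" assume fg: "f \<in> skew_poly_ring r" "g \<in> skew_poly_ring r"
  show "f - g \<in> skew_poly_ring r"
    using fg keys_diff[of f g] by (fastforce simp: skew_poly_ring_def)
  show "f * g \<in> skew_poly_ring r"
    unfolding skew_poly_ring_def
  proof safe
    fix m v w assume "m \<in> Poly_Mapping.keys (f * g)" "(v, w) \<in> Poly_Mapping.keys m"
    then obtain a b where ab: "m = a + b" "a \<in> Poly_Mapping.keys f" "b \<in> Poly_Mapping.keys g"
      using keys_mult[of f g] by blast
    hence "Poly_Mapping.keys m \<subseteq> Poly_Mapping.keys a \<union> Poly_Mapping.keys b"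
      using Poly_Mapping.keys_add[of a b] by simp
    hence "Poly_Mapping.keys m \<subseteq> {(i, j). i < j \<and> j < r}"
      using fg ab unfolding skew_poly_ring_def by blast
    thus "v < w" "w < r" using \<open>(v, w) \<in> Poly_Mapping.keys m\<close> by auto
  qed
qed

definition generic_skew :: "nat \<Rightarrow> 'k::field pair_poly mat" where
  "generic_skew r = mat r r (\<lambda>(i, j).
     if i < j then indet i j else if j < i then - indet j i else 0)"

text \<open>A Pfaffian is only determined up to sign; both square roots are included.\<close>

definition pfaffians :: "nat \<Rightarrow> nat \<Rightarrow> 'k::field pair_poly set" where
  "pfaffians r k = {f \<in> skew_poly_ring r. \<exists>J \<subseteq> {0..<r}. card J = k \<and>
     f ^ 2 = det (submatrix (generic_skew r) J J)}"

definition pfaffian_ideal :: "nat \<Rightarrow> nat \<Rightarrow> 'k::field pair_poly set" where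
  "pfaffian_ideal r k = Idl\<^bsub>subring_of (skew_poly_ring r)\<^esub> (pfaffians r k)"

end

theory Submission
  imports Defs
begin

text \<open>
  Let \<open>s = t - 1\<close> and let \<open>\<delta>\<close> be the Pfaffian of the upper left block of size \<open>2 s\<close>. After inverting
  \<open>\<delta>\<close>, the ideal \<open>P\<^sub>2\<^sub>t\<close> is generated by the \<open>h = (r - 2 s choose 2)\<close> Pfaffians on the
  indices \<open>z < x\<close> together with the block, and a Pfaffian of size \<open>2 k\<close> lies in the power of exponent
  \<open>k - s\<close> of the ideal of these generators: project all basis vectors to the orthogonal complement of
  the block. Hence the product \<open>F\<close> of the Pfaffians whose leading terms are the antidiagonals of the
  matrix lies in the \<open>h\<close>-th power up to a power of \<open>\<delta>\<close>. The leading term of \<open>F\<close> is the product of all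
  variables, so the \<open>p\<close>-th root of \<open>a\<close> is sent to \<open>Tr (F\<^sup>p\<^sup>-\<^sup>1 a)\<close> by a splitting, where \<open>Tr\<close> is the
  trace of Frobenius. It is compatible with symbolic powers by the pigeonhole principle:
  \<open>(y\<^sub>1, \<dots>, y\<^sub>h)\<close> raised to the exponent \<open>h (p - 1) + n p + 1\<close> is contained in the
  Frobenius power of its power of exponent \<open>n + 1\<close>. It remains to see that \<open>\<delta>\<close> avoids the minimal
  primes of \<open>P\<^sub>2\<^sub>t\<close>. Modulo any prime containing \<open>P\<^sub>2\<^sub>t\<close>, the matrix has a
  normal form of rank at most \<open>2 s\<close> over the fraction field, so such a prime contains the kernel of the
  map to the generic alternating matrix of rank \<open>2 s\<close>. This kernel is prime, contains
  \<open>P\<^sub>2\<^sub>t\<close> and does not contain \<open>\<delta>\<close>.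
\<close>


section \<open>Pfaffians by expansion\<close>

text \<open>The antidiagonals reconcile two demands on \<open>F\<close>. The trace must return 1 on
  \<open>F ^ (p - 1)\<close>, which asks for a squarefree leading monomial containing every
  variable: each \<open>z_ij\<close> lies on exactly one antidiagonal \<open>i + j = c\<close>. And
  the exponents \<open>k - s\<close> of the factors, truncated at 0, must add up to at least the
  number \<open>h\<close> of generators: the pigeonhole bound leaves no slack, since
  \<open>h (p - 1)\<close> factors can escape being collected into \<open>p\<close>-th powers.
  Moving a pair \<open>2 s \<le> z < x < r\<close> up by \<open>2 s\<close> rows shows that the
  total suffices.

  Outside the square formula, quotients and fraction fields are replaced by multiplication with
  elements outside a prime: statements carry an explicit power of \<open>\<delta>\<close>, of a
  pivot or of some \<open>c\<close>. Such factors cost nothing in a symbolic power as long as they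
  avoid the minimal primes, and \<open>w ^ p\<close> leaves the trace as \<open>w\<close>.

  Since \<open>p = 2\<close> is allowed, \<open>a x x = 0\<close> is demanded separately from
  skew-symmetry, and no argument divides by 2.\<close>

definition contract :: "('v \<Rightarrow> 'v \<Rightarrow> 'a::comm_ring_1) \<Rightarrow> 'v \<Rightarrow> ('v list \<Rightarrow> 'a) \<Rightarrow> 'v list \<Rightarrow> 'a" where
  "contract a x \<phi> L = (\<Sum>j<length L. (-1) ^ j * a x (L ! j) * \<phi> (take j L @ drop (Suc j) L))"

lemma contract_Nil [simp]: "contract a x \<phi> [] = 0"
  by (simp add: contract_def)

lemma contract_Cons:
  "contract a x \<phi> (z # L) = a x z * \<phi> L - contract a x (\<lambda>M. \<phi> (z # M)) L"
  unfolding contract_def by (simp add: sum.lessThan_Suc_shift sum_negf del: sum.lessThan_Suc)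

lemma contract_cong:
  assumes "\<And>L1 z L2. L = L1 @ z # L2 \<Longrightarrow> a x z * \<phi> (L1 @ L2) = b y z * \<psi> (L1 @ L2)"
  shows "contract a x \<phi> L = contract b y \<psi> L"
  unfolding contract_def
proof (rule sum.cong[OF refl])
  fix j assume "j \<in> {..<length L}"
  then have "L = take j L @ L ! j # drop (Suc j) L" by (simp add: id_take_nth_drop)
  from assms[OF this]
  show "(-1) ^ j * a x (L ! j) * \<phi> (take j L @ drop (Suc j) L) =
      (-1) ^ j * b y (L ! j) * \<psi> (take j L @ drop (Suc j) L)" by (simp add: mult.assoc)
qed

lemma contract_zero:
  assumes "\<And>L1 z L2. L = L1 @ z # L2 \<Longrightarrow> a x z * \<phi> (L1 @ L2) = 0"
  shows "contract a x \<phi> L = 0"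
proof -
  have "contract a x \<phi> L = contract a x (\<lambda>_. 0) L" using assms by (intro contract_cong) simp
  then show ?thesis by (simp add: contract_def)
qed

lemma contract_add: "contract a x (\<lambda>M. \<phi> M + \<psi> M) L = contract a x \<phi> L + contract a x \<psi> L"
  by (simp add: contract_def distrib_left sum.distrib)

lemma contract_mult: "contract a x (\<lambda>M. c * \<phi> M) L = c * contract a x \<phi> L"
  by (simp add: contract_def sum_distrib_left mult_ac)

lemma contract_minus: "contract a x (\<lambda>M. - \<phi> M) L = - contract a x \<phi> L"
  using contract_mult[of a x "-1" \<phi> L] by simp

lemma contract_diff: "contract a x (\<lambda>M. \<phi> M - \<psi> M) L = contract a x \<phi> L - contract a x \<psi> L"
  using contract_add[of a x \<phi> "\<lambda>M. - \<psi> M" L] by (simp add: contract_minus)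

text \<open>The recursion on the list produces the alternating signs as iterated differences, so
  closure under subtraction suffices. This covers ideals, subrings and sets of polynomials cut out
  by a condition on their monomials.\<close>

lemma contract_closed:
  assumes "0 \<in> H" "\<And>f g. f \<in> H \<Longrightarrow> g \<in> H \<Longrightarrow> f - g \<in> H"
    and "\<And>L1 z L2. L = L1 @ z # L2 \<Longrightarrow> a x z * \<phi> (L1 @ L2) \<in> H"
  shows "contract a x \<phi> L \<in> H"
  using assms(3)
proof (induction L arbitrary: \<phi>)
  case (Cons z L)
  have "contract a x (\<lambda>M. \<phi> (z # M)) L \<in> H"
    by (rule Cons.IH) (use Cons.prems[of "z # _"] in simp)
  with Cons.prems[of "[]" z L] show ?case by (simp add: contract_Cons assms(2))
qed (simp add: assms(1))

text \<open>Contractions behave like interior products on an exterior algebra: they square to zero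
  and anticommute, whatever \<open>a\<close> and \<open>\<phi>\<close> are. The square needs its own
  proof because in characteristic 2 it does not follow from anticommutativity.\<close>

lemma contract_contract_self: "contract a x (contract a x \<phi>) L = 0"
proof (induction L arbitrary: \<phi>)
  case (Cons z L)
  then show ?case by (simp add: contract_Cons contract_diff contract_mult)
qed simp

lemma contract_anticommute:
  "contract a x (contract a y \<phi>) L = - contract a y (contract a x \<phi>) L"
proof (induction L arbitrary: \<phi>)
  case (Cons z L)
  then show ?case
    by (simp add: contract_Cons contract_diff contract_mult Cons[of "\<lambda>M. \<phi> (z # M)"])
qed simp

text \<open>Antisymmetry of \<open>\<phi>\<close> is asked only for lists one element shorter than
  the contracted one; this is what an induction on length supplies when \<open>\<phi>\<close> is the
  Pfaffian itself.\<close>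

lemma contract_swap:
  assumes "\<And>M1 M2. Suc (length (M1 @ M2)) = length (L1 @ L2) \<Longrightarrow>
      \<phi> (M1 @ x # y # M2) = - \<phi> (M1 @ y # x # M2)"
  shows "contract a u \<phi> (L1 @ x # y # L2) = - contract a u \<phi> (L1 @ y # x # L2)"
  using assms
proof (induction L1 arbitrary: \<phi>)
  case Nil
  have "contract a u (\<lambda>M. \<phi> (x # y # M)) L2 = contract a u (\<lambda>M. - \<phi> (y # x # M)) L2"
    using Nil[of "[]"] by (intro contract_cong) auto
  then show ?case by (simp add: contract_Cons contract_minus)
next
  case (Cons z L1)
  have "contract a u (\<lambda>M. \<phi> (z # M)) (L1 @ x # y # L2) = - contract a u (\<lambda>M. \<phi> (z # M)) (L1 @ y # x # L2)"
    by (rule Cons.IH) (use Cons.prems[of "z # _"] in simp)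
  then show ?case using Cons.prems[of L1 L2] by (simp add: contract_Cons)
qed

text \<open>Expansion along the first row; a list of odd length has Pfaffian \<open>0\<close>.\<close>

function pf :: "('v \<Rightarrow> 'v \<Rightarrow> 'a::comm_ring_1) \<Rightarrow> 'v list \<Rightarrow> 'a" where
  "pf a [] = 1"
| "pf a (x # L) = (\<Sum>j<length L. (-1) ^ j * a x (L ! j) * pf a (take j L @ drop (Suc j) L))"
  by pat_completeness auto
termination by (relation "measure (\<lambda>(a, L). length L)") auto

declare pf.simps(2) [simp del]

lemma pf_Cons: "pf a (x # L) = contract a x (pf a) L"
  by (simp add: pf.simps(2) contract_def)

lemma pf_pair [simp]: "pf a [x, y] = a x y"
  by (simp add: pf_Cons contract_Cons)

lemma pf_Cons_Cons: "pf a (x # y # L) = a x y * pf a L - contract a x (contract a y (pf a)) L"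
  by (simp add: pf_Cons contract_Cons[of a x "pf a"])

lemma pf_map: "pf a (map h L) = pf (\<lambda>x y. a (h x) (h y)) L"
proof (induction L rule: length_induct)
  case (1 L)
  show ?case
  proof (cases L)
    case (Cons x M)
    have "pf a (map h L) = (\<Sum>j<length M. (-1) ^ j * a (h x) (h (M ! j)) * pf a (map h (take j M @ drop (Suc j) M)))"
      by (simp add: Cons pf.simps(2) take_map drop_map)
    also have "\<dots> = (\<Sum>j<length M. (-1) ^ j * a (h x) (h (M ! j)) * pf (\<lambda>x y. a (h x) (h y)) (take j M @ drop (Suc j) M))"
      by (intro sum.cong refl arg_cong2[where f = "(*)"] 1[rule_format]) (auto simp: Cons)
    finally show ?thesis by (simp add: Cons pf.simps(2))
  qed simp
qed

lemma pf_cong: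
  assumes "\<And>x y. x \<in> set L \<Longrightarrow> y \<in> set L \<Longrightarrow> a x y = b x y"
  shows "pf a L = pf b L"
  using assms
proof (induction L rule: length_induct)
  case (1 L)
  show ?case
  proof (cases L)
    case (Cons x M)
    show ?thesis unfolding Cons pf_Cons
    proof (rule contract_cong)
      fix L1 z L2 assume M: "M = L1 @ z # L2"
      have "pf a (L1 @ L2) = pf b (L1 @ L2)"
        by (rule 1(1)[rule_format]) (use 1(2) in \<open>auto simp: Cons M\<close>)
      then show "a x z * pf a (L1 @ L2) = b x z * pf b (L1 @ L2)" using 1(2) by (simp add: Cons M)
    qed
  qed simp
qed

lemma pf_scale: "length L = 2 * k \<Longrightarrow> pf (\<lambda>x y. c * a x y) L = c ^ k * pf a L"
proof (induction k arbitrary: L)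
  case (Suc k)
  then obtain x M where L: "L = x # M" by (cases L) auto
  have "pf (\<lambda>x y. c * a x y) L = contract a x (\<lambda>M. c ^ Suc k * pf a M) M"
    unfolding L pf_Cons
  proof (rule contract_cong)
    fix L1 z L2 assume "M = L1 @ z # L2"
    with Suc.prems have "length (L1 @ L2) = 2 * k" by (simp add: L)
    from Suc.IH[OF this] show "c * a x z * pf (\<lambda>x y. c * a x y) (L1 @ L2) = a x z * (c ^ Suc k * pf a (L1 @ L2))"
      by (simp add: mult_ac)
  qed
  then show ?case by (simp add: L pf_Cons contract_mult)
qed simp

lemma pf_hom:
  assumes "h 0 = 0" "h 1 = 1" "\<And>x y. h (x + y) = h x + h y" "\<And>x y. h (x * y) = h x * h y"
  shows "h (pf a L) = pf (\<lambda>x y. h (a x y)) L"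
proof (induction L rule: length_induct)
  case (1 L)
  have m: "h (- x) = - h x" for x using assms(3)[of x "- x"] assms(1) by (simp add: minus_unique)
  have s: "h (sum f {..<n}) = (\<Sum>i<n. h (f i))" for f and n :: nat
    by (induction n) (auto simp: assms)
  have p: "h ((-1) ^ n) = (-1) ^ n" for n :: nat by (induction n) (auto simp: assms m)
  show ?case
  proof (cases L)
    case (Cons x M)
    then show ?thesis using 1 by (simp add: pf.simps(2) s assms(4) p)
  qed (simp add: assms)
qed

section \<open>Sign rules and multilinearity of Pfaffians\<close>

locale alternating =
  fixes a :: "'v \<Rightarrow> 'v \<Rightarrow> 'a::comm_ring_1"
  assumes self: "a x x = 0" and skew: "a x y = - a y x"
begin

lemma pf_swap: "pf a (L1 @ x # y # L2) = - pf a (L1 @ y # x # L2)"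
proof (induction "length (L1 @ L2)" arbitrary: L1 L2 rule: less_induct)
  case less
  show ?case
  proof (cases L1)
    case Nil
    have "pf a (x # y # L2) = - pf a (y # x # L2)"
      using contract_anticommute[of a x y "pf a" L2] skew[of x y] by (simp add: pf_Cons_Cons)
    then show ?thesis by (simp add: Nil)
  next
    case (Cons u K)
    show ?thesis unfolding Cons append_Cons pf_Cons
      by (rule contract_swap, rule less) (simp add: Cons)
  qed
qed

lemma pf_move: "pf a (U @ L1 @ x # L2) = (-1) ^ length L1 * pf a (U @ x # L1 @ L2)"
proof (induction L1 arbitrary: L2 rule: rev_induct)
  case (snoc y L1)
  then show ?case using pf_swap[of "U @ L1" y x L2] by simp
qed simp

lemma pf_perm:
  assumes "mset L = mset L'"
  shows "pf a (U @ L') = pf a (U @ L) \<or> pf a (U @ L') = - pf a (U @ L)"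
  using assms
proof (induction L arbitrary: U L')
  case (Cons x K)
  then have "x \<in> set L'" by (metis list.set_intros(1) mset_eq_setD)
  then obtain L1 L2 where L': "L' = L1 @ x # L2" by (meson split_list)
  with Cons.prems have "mset K = mset (L1 @ L2)" by simp
  from Cons.IH[OF this, of "U @ [x]"] pf_move[of U L1 x L2] show ?case
    unfolding L' by (cases "even (length L1)") auto
qed simp

text \<open>Two equal entries can be moved to the front. There \<open>a x x = 0\<close> removes one
  term, and contracting twice by \<open>x\<close> removes the other.\<close>

lemma pf_repeat:
  assumes "\<not> distinct L"
  shows "pf a L = 0"
proof -
  obtain L1 L2 L3 x where L: "L = L1 @ [x] @ L2 @ [x] @ L3"
    using not_distinct_decomp[OF assms] by blast
  have "pf a (x # x # L1 @ L2 @ L3) = 0"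
    by (simp add: pf_Cons_Cons self contract_contract_self)
  with pf_perm[of "x # x # L1 @ L2 @ L3" L "[]"] show ?thesis by (simp add: L)
qed

text \<open>The entry can be moved to the front, where the expansion is visibly linear in it; the
  sign of the move is the same on both sides.\<close>

lemma pf_linear:
  assumes "\<And>z. a w z = (\<Sum>i\<in>S. c i * a (v i) z)"
  shows "pf a (L1 @ w # L2) = (\<Sum>i\<in>S. c i * pf a (L1 @ v i # L2))"
proof -
  have "pf a (w # L1 @ L2) = (\<Sum>i\<in>S. c i * pf a (v i # L1 @ L2))"
    unfolding pf_Cons contract_def assms sum_distrib_left sum_distrib_right
    by (subst sum.swap) (simp add: mult_ac)
  then show ?thesis using pf_move[of "[]" L1 _ L2] by (simp add: sum_distrib_left mult_ac)
qed

lemma pf_linear2: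
  assumes "\<And>z. a w z = c * a u z + d * a v z"
  shows "pf a (L1 @ w # L2) = c * pf a (L1 @ u # L2) + d * pf a (L1 @ v # L2)"
proof -
  have "pf a (L1 @ w # L2) = (\<Sum>i\<in>(UNIV::bool set). (if i then c else d) * pf a (L1 @ (if i then u else v) # L2))"
    by (rule pf_linear) (simp add: assms UNIV_bool)
  then show ?thesis by (simp add: UNIV_bool)
qed

end

section \<open>The square of the Pfaffian\<close>

text \<open>Allows lists of vectors in place of lists of indices: row operations and projections
  replace entries by linear combinations, which indices cannot express.\<close>

definition bil :: "(nat \<Rightarrow> nat \<Rightarrow> 'a::comm_ring_1) \<Rightarrow> nat \<Rightarrow> (nat \<Rightarrow> 'a) \<Rightarrow> (nat \<Rightarrow> 'a) \<Rightarrow> 'a" where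
  "bil M r v w = (\<Sum>i<r. \<Sum>j<r. v i * w j * M i j)"

definition unit_fun :: "nat \<Rightarrow> nat \<Rightarrow> 'a::zero_neq_one" where
  "unit_fun x = (\<lambda>i. if i = x then 1 else 0)"

lemma bil_unit:
  assumes "x < r" "y < r"
  shows "bil M r (unit_fun x) (unit_fun y) = M x y"
proof -
  have "bil M r (unit_fun x) (unit_fun y) =
      (\<Sum>i<r. \<Sum>j<r. if j = y then if i = x then M x y else 0 else 0)"
    unfolding bil_def unit_fun_def by (intro sum.cong refl) auto
  then show ?thesis using assms by simp
qed

lemma bil_sum_left: "bil M r (\<lambda>i. \<Sum>s\<in>S. c s * v s i) z = (\<Sum>s\<in>S. c s * bil M r (v s) z)"
proof -
  have "(\<Sum>s\<in>S. c s * bil M r (v s) z) = (\<Sum>s\<in>S. \<Sum>i<r. \<Sum>j<r. c s * v s i * z j * M i j)"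
    by (simp add: bil_def sum_distrib_left mult_ac)
  also have "\<dots> = (\<Sum>i<r. \<Sum>s\<in>S. \<Sum>j<r. c s * v s i * z j * M i j)"
    by (rule sum.swap)
  also have "\<dots> = (\<Sum>i<r. \<Sum>j<r. \<Sum>s\<in>S. c s * v s i * z j * M i j)"
    by (intro sum.cong refl sum.swap)
  finally show ?thesis by (simp add: bil_def sum_distrib_right)
qed

lemma bil_add_left: "bil M r (\<lambda>i. c * u i + d * v i) z = c * bil M r u z + d * bil M r v z"
  by (simp add: bil_def sum_distrib_left algebra_simps sum.distrib)

lemma bil_add_right: "bil M r z (\<lambda>i. c * u i + d * v i) = c * bil M r z u + d * bil M r z v"
  by (simp add: bil_def sum_distrib_left algebra_simps sum.distrib)

lemma alternating_bil:
  assumes "alternating M"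
  shows "alternating (bil M r)"
proof
  interpret alternating M by fact
  fix v w :: "nat \<Rightarrow> 'a"
  show "bil M r v w = - bil M r w v"
  proof -
    have "bil M r v w = (\<Sum>j<r. \<Sum>i<r. v i * w j * M i j)" unfolding bil_def by (rule sum.swap)
    also have "\<dots> = (\<Sum>j<r. \<Sum>i<r. - (w j * v i * M j i))"
      by (intro sum.cong refl) (subst skew, simp add: mult_ac)
    finally show ?thesis by (simp add: bil_def sum_negf)
  qed
  \<comment> \<open>Skew-symmetry gives only that twice this value vanishes. Peeling off the last
    row and column cancels the off-diagonal terms in pairs and leaves diagonal entries of
    \<open>M\<close>.\<close>
  show "bil M r v v = 0"
  proof (induction r)
    case (Suc r)
    have "bil M (Suc r) v v = bil M r v v + (\<Sum>i<r. v i * v r * M i r + v r * v i * M r i) + v r * v r * M r r"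
      by (simp add: bil_def sum.distrib)
    also have "(\<Sum>i<r. v i * v r * M i r + v r * v i * M r i) = 0"
      by (intro sum.neutral ballI) (subst skew, simp add: mult_ac)
    finally show ?case using Suc by (simp add: self)
  qed (simp add: bil_def)
qed

section \<open>Gram determinants\<close>

definition gram :: "('v \<Rightarrow> 'v \<Rightarrow> 'a) \<Rightarrow> 'v list \<Rightarrow> 'a mat" where
  "gram a L = mat (length L) (length L) (\<lambda>(i, j). a (L ! i) (L ! j))"

lemma gram_carrier [simp]: "gram a L \<in> carrier_mat (length L) (length L)"
  by (simp add: gram_def)

lemma det_2:
  fixes A :: "'a::comm_ring_1 mat"
  assumes "A \<in> carrier_mat 2 2"
  shows "det A = A $$ (0, 0) * A $$ (1, 1) - A $$ (0, 1) * A $$ (1, 0)"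
proof -
  have c: "mat_delete A 0 0 \<in> carrier_mat 1 1" "mat_delete A 0 1 \<in> carrier_mat 1 1"
    using assms by (auto simp: mat_delete_def)
  have "det A = (\<Sum>j<2. A $$ (0,j) * cofactor A 0 j)"
    by (rule laplace_expansion_row) (use assms in auto)
  also have "\<dots> = A $$ (0, 0) * mat_delete A 0 0 $$ (0, 0) - A $$ (0, 1) * mat_delete A 0 1 $$ (0, 0)"
    using det_single[OF c(1)] det_single[OF c(2)] by (simp add: numeral_2_eq_2 cofactor_def)
  also have "mat_delete A 0 0 $$ (0, 0) = A $$ (1, 1)" using assms by (simp add: mat_delete_def)
  also have "mat_delete A 0 1 $$ (0, 0) = A $$ (1, 0)" using assms by (simp add: mat_delete_def)
  finally show ?thesis .
qed

text \<open>Changing one vector affects a row and a column of the Gram matrix: a row operation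
  followed by the corresponding column operation, neither of which changes the determinant.\<close>

lemma det_gram_addrow:
  fixes a :: "'v \<Rightarrow> 'v \<Rightarrow> 'a::comm_ring_1"
  assumes ij: "i < length L" "j < length L" "i \<noteq> j"
    and l: "\<And>z. a w z = a (L ! i) z + c * a (L ! j) z"
    and r: "\<And>z. a z w = a z (L ! i) + c * a z (L ! j)"
  shows "det (gram a (L[i := w])) = det (gram a L)"
proof -
  have "gram a (L[i := w]) = addcol c i j (addrow c i j (gram a L))"
    using ij by (intro eq_matI) (auto simp: gram_def mat_addcol_def nth_list_update l r algebra_simps)
  then show ?thesis using ij by (simp add: det_addcol[where n = "length L"] det_addrow[where n = "length L"])
qed

lemma det_gram_first_zero:
  fixes a :: "'v \<Rightarrow> 'v \<Rightarrow> 'a::comm_ring_1"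
  assumes "\<And>z. z \<in> set (x # L) \<Longrightarrow> a x z = 0"
  shows "det (gram a (x # L)) = 0"
proof -
  have "det (gram a (x # L)) = (\<Sum>j<length (x # L). gram a (x # L) $$ (0, j) * cofactor (gram a (x # L)) 0 j)"
    by (rule laplace_expansion_row[OF gram_carrier]) simp
  also have "\<dots> = 0"
  proof (intro sum.neutral ballI)
    fix j assume j: "j \<in> {..<length (x # L)}"
    then have "gram a (x # L) $$ (0, j) = a x ((x # L) ! j)" by (simp add: gram_def)
    also have "\<dots> = 0" using j by (intro assms nth_mem) simp
    finally show "gram a (x # L) $$ (0, j) * cofactor (gram a (x # L)) 0 j = 0" by simp
  qed
  finally show ?thesis .
qed

lemma det_gram_orthogonal:
  fixes a :: "'v \<Rightarrow> 'v \<Rightarrow> 'a::idom"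
  assumes "alternating a" "\<And>z. z \<in> set L \<Longrightarrow> a x z = 0" "\<And>z. z \<in> set L \<Longrightarrow> a y z = 0"
  shows "det (gram a (x # y # L)) = (a x y)\<^sup>2 * det (gram a L)"
proof -
  interpret alternating a by fact
  have z: "a z x = 0" "a z y = 0" if "z \<in> set L" for z
    using assms(2,3)[OF that] skew[of z] by auto
  have "gram a (x # y # L) = four_block_mat (gram a [x, y]) (0\<^sub>m 2 (length L)) (0\<^sub>m (length L) 2) (gram a L)"
    by (rule eq_matI)
      (auto simp: gram_def four_block_mat_def Let_def nth_Cons' self z assms(2,3) numeral_2_eq_2 less_Suc_eq)
  also have "det \<dots> = det (gram a [x, y]) * det (gram a L)"
    by (rule det_four_block_mat_lower_left_zero[where n = 2 and m = "length L"]) (auto simp: gram_def)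
  also have "det (gram a [x, y]) = (a x y)\<^sup>2"
    by (subst det_2) (auto simp: gram_def self skew[of y x] power2_eq_square)
  finally show ?thesis .
qed

lemma (in alternating) pf_orthogonal:
  assumes "\<And>z. z \<in> set L \<Longrightarrow> a x z = 0"
  shows "pf a (x # y # L) = a x y * pf a L"
proof -
  have "contract a x (\<lambda>M. pf a (y # M)) L = 0" using assms by (intro contract_zero) auto
  then show ?thesis by (simp add: pf_Cons[of _ x] contract_Cons)
qed

context
  fixes M :: "nat \<Rightarrow> nat \<Rightarrow> 'a::field" and r :: nat
  assumes alt: "alternating M"
begin

interpretation B: alternating "bil M r" by (rule alternating_bil[OF alt])

definition elem_equiv :: "(nat \<Rightarrow> 'a) list \<Rightarrow> (nat \<Rightarrow> 'a) list \<Rightarrow> bool" where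
  "elem_equiv L L' \<longleftrightarrow> length L' = length L \<and> pf (bil M r) L' = pf (bil M r) L \<and>
     det (gram (bil M r) L') = det (gram (bil M r) L)"

lemma elem_equiv_add:
  assumes "i < length L" "j < length L" "i \<noteq> j"
  shows "elem_equiv L (L[i := (\<lambda>k. 1 * (L ! i) k + c * (L ! j) k)])"
proof -
  let ?w = "\<lambda>k. 1 * (L ! i) k + c * (L ! j) k"
  have L: "L[i := v] = take i L @ v # drop (Suc i) L" for v
    using assms(1) by (rule upd_conv_take_nth_drop)
  have "pf (bil M r) (L[i := ?w]) = 1 * pf (bil M r) (L[i := L ! i]) + c * pf (bil M r) (L[i := L ! j])"
    unfolding L by (rule B.pf_linear2) (rule bil_add_left)
  also have "\<not> distinct (L[i := L ! j])"
    using assms by (metis distinct_conv_nth length_list_update nth_list_update_eq nth_list_update_neq)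
  then have "pf (bil M r) (L[i := L ! j]) = 0" by (rule B.pf_repeat)
  finally have p: "pf (bil M r) (L[i := ?w]) = pf (bil M r) L" by simp
  have "det (gram (bil M r) (L[i := ?w])) = det (gram (bil M r) L)"
    by (rule det_gram_addrow[OF assms, of _ _ c]) (subst bil_add_left bil_add_right, simp)+
  with p show ?thesis by (simp add: elem_equiv_def)
qed

lemma elem_equiv_trans: "elem_equiv L L' \<Longrightarrow> elem_equiv L' L'' \<Longrightarrow> elem_equiv L L''"
  by (simp add: elem_equiv_def)

text \<open>A symplectic Gram-Schmidt step: adding a multiple of \<open>y\<close> and then one of
  \<open>x\<close> makes each vector of \<open>N\<close> orthogonal to both. The prefix
  \<open>N1\<close> takes up the vectors already treated in the induction.\<close>

lemma elem_equiv_clear: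
  assumes c: "bil M r x y \<noteq> 0"
  shows "\<exists>N'. elem_equiv (x # y # N1 @ N) (x # y # N1 @ N') \<and>
    (\<forall>z\<in>set N'. bil M r x z = 0 \<and> bil M r y z = 0)"
proof (induction N arbitrary: N1)
  case (Cons m N)
  let ?L = "x # y # N1 @ m # N"
  define m1 where "m1 = (\<lambda>k. 1 * m k + (- bil M r x m / bil M r x y) * y k)"
  define m2 where "m2 = (\<lambda>k. 1 * m1 k + (bil M r y m / bil M r x y) * x k)"
  have "elem_equiv ?L (?L[length N1 + 2 := m1])"
    using elem_equiv_add[of "length N1 + 2" ?L 1 "- bil M r x m / bil M r x y"]
    by (simp add: m1_def nth_append)
  then have 1: "elem_equiv ?L (x # y # N1 @ m1 # N)" by simp
  have "elem_equiv (x # y # N1 @ m1 # N) ((x # y # N1 @ m1 # N)[length N1 + 2 := m2])"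
    using elem_equiv_add[of "length N1 + 2" "x # y # N1 @ m1 # N" 0 "bil M r y m / bil M r x y"]
    by (simp add: m2_def nth_append)
  then have 2: "elem_equiv (x # y # N1 @ m1 # N) (x # y # (N1 @ [m2]) @ N)" by simp
  obtain N' where N': "elem_equiv (x # y # (N1 @ [m2]) @ N) (x # y # (N1 @ [m2]) @ N')"
    "\<forall>z\<in>set N'. bil M r x z = 0 \<and> bil M r y z = 0" using Cons.IH by blast
  have "bil M r x m2 = 0" "bil M r y m2 = 0"
    using c unfolding m2_def m1_def bil_add_right by (simp_all add: B.self B.skew[of y x])
  with N' elem_equiv_trans[OF 1 elem_equiv_trans[OF 2 N'(1)]] show ?case
    by (intro exI[of _ "m2 # N'"]) auto
qed (auto simp: elem_equiv_def)

text \<open>Both sides are invariant under adding a multiple of one vector to another. If the first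
  vector is orthogonal to the others, both vanish; otherwise a pair with nonzero product splits off
  and contributes the same square to both.\<close>

lemma pf_square_field: "(pf (bil M r) L)\<^sup>2 = det (gram (bil M r) L)"
proof (induction "length L" arbitrary: L rule: less_induct)
  case less
  have key: "(pf (bil M r) L')\<^sup>2 = det (gram (bil M r) L')"
    if L': "L' = x # y # N" and len: "length L' = length L" and c: "bil M r x y \<noteq> 0" for L' x y N
  proof -
    obtain N' where e: "elem_equiv L' (x # y # N')"
      and o: "\<And>z. z \<in> set N' \<Longrightarrow> bil M r x z = 0" "\<And>z. z \<in> set N' \<Longrightarrow> bil M r y z = 0"
      using elem_equiv_clear[OF c, of "[]" N] by (auto simp: L')
    have "length N' = length N" using e by (simp add: elem_equiv_def L')
    then have "(pf (bil M r) N')\<^sup>2 = det (gram (bil M r) N')" using len by (intro less) (simp add: L')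
    then have "(pf (bil M r) (x # y # N'))\<^sup>2 = det (gram (bil M r) (x # y # N'))"
      by (simp add: B.pf_orthogonal o det_gram_orthogonal[OF B.alternating_axioms] power_mult_distrib)
    with e show ?thesis by (simp add: elem_equiv_def)
  qed
  show ?case
  proof (cases L)
    case (Cons x K)
    show ?thesis
    proof (cases "\<forall>z\<in>set K. bil M r x z = 0")
      case True
      then have "pf (bil M r) L = 0" unfolding Cons pf_Cons by (intro contract_zero) auto
      moreover have "det (gram (bil M r) L) = 0"
        unfolding Cons by (rule det_gram_first_zero) (use True B.self in auto)
      ultimately show ?thesis by simp
    next
      case False
      then obtain i where i: "i < length K" "bil M r x (K ! i) \<noteq> 0" by (metis in_set_conv_nth)
      then obtain y N where K: "K = y # N" by (cases K) auto
      show ?thesis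
      proof (cases "bil M r x y = 0")
        case True
        with i K have "Suc i \<noteq> 1" by (cases i) auto
        \<comment> \<open>Only the first two vectors are split off, so a vector that pairs
          nontrivially with \<open>x\<close> is added to the second one.\<close>
        let ?y = "\<lambda>k. 1 * y k + 1 * (K ! i) k"
        have e: "elem_equiv L (x # ?y # N)"
          using elem_equiv_add[of 1 L "Suc i" 1] i \<open>Suc i \<noteq> 1\<close> by (simp add: Cons K)
        have "bil M r x ?y \<noteq> 0" using i True unfolding bil_add_right by simp
        from key[OF refl _ this, of N] e show ?thesis by (simp add: elem_equiv_def)
      qed (use key[of L x y N] in \<open>simp add: Cons K\<close>)
    qed
  qed (simp add: gram_def)
qed

end

lemma to_fract_hom: "comm_ring_hom (to_fract :: 'a::idom \<Rightarrow> 'a fract)"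
  by unfold_locales (auto simp: to_fract_def One_fract_def Zero_fract_def)

text \<open>The field case is applied over the fraction field to unit vectors, whose Gram matrix is
  that of the indices; injectivity of the embedding brings the identity back.\<close>

theorem pf_square:
  fixes M :: "nat \<Rightarrow> nat \<Rightarrow> 'a::idom"
  assumes "alternating M" "set L \<subseteq> {..<r}"
  shows "(pf M L)\<^sup>2 = det (gram M L)"
proof -
  interpret h: comm_ring_hom "to_fract :: 'a \<Rightarrow> 'a fract" by (rule to_fract_hom)
  interpret alternating M by fact
  define M' where "M' = (\<lambda>i j. to_fract (M i j))"
  interpret M': alternating M'
  proof
    fix x y
    show "M' x x = 0" by (simp add: M'_def self)
    show "M' x y = - M' y x" unfolding M'_def by (subst skew) (simp add: h.hom_uminus)
  qed
  let ?L = "map unit_fun L :: (nat \<Rightarrow> 'a fract) list"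
  have u: "bil M' r (unit_fun x) (unit_fun y) = M' x y" if "x \<in> set L" "y \<in> set L" for x y
    using that assms(2) by (intro bil_unit) auto
  have "pf (bil M' r) ?L = pf M' L" unfolding pf_map by (rule pf_cong) (rule u)
  moreover have "gram (bil M' r) ?L = map_mat to_fract (gram M L)"
    by (rule eq_matI) (auto simp: gram_def u[unfolded M'_def] M'_def)
  moreover have "to_fract (pf M L) = pf M' L" unfolding M'_def by (rule pf_hom) (simp_all add: h.hom_add h.hom_mult)
  ultimately have "to_fract ((pf M L)\<^sup>2) = to_fract (det (gram M L))"
    using pf_square_field[OF M'.alternating_axioms, of r ?L] by (simp add: h.hom_power h.hom_det)
  then show ?thesis by (simp add: to_fract_def eq_fract)
qed

section \<open>Powers of ideals and normal forms\<close>

interpretation ring_module: Modules.module "(*) :: 'a::comm_ring_1 \<Rightarrow> 'a \<Rightarrow> 'a"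
  by unfold_locales (auto simp: algebra_simps)

declare ring_module.scale_scale [simp del]

text \<open>The power of exponent \<open>m\<close> of the ideal generated by \<open>G\<close> in the
  whole type. This avoids carrier conditions; for polynomials a retraction brings memberships back
  to K[Z].\<close>

definition gen_power :: "'a::comm_ring_1 set \<Rightarrow> nat \<Rightarrow> 'a set" where
  "gen_power G m = ring_module.span {prod_list l |l. length l = m \<and> set l \<subseteq> G}"

lemma gen_power_zero [simp]: "0 \<in> gen_power G m"
  by (simp add: gen_power_def ring_module.span_zero)

lemma gen_power_add: "x \<in> gen_power G m \<Longrightarrow> y \<in> gen_power G m \<Longrightarrow> x + y \<in> gen_power G m"
  by (simp add: gen_power_def ring_module.span_add)

lemma gen_power_minus: "x \<in> gen_power G m \<Longrightarrow> - x \<in> gen_power G m"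
  by (simp add: gen_power_def ring_module.span_neg)

lemma gen_power_diff: "x \<in> gen_power G m \<Longrightarrow> y \<in> gen_power G m \<Longrightarrow> x - y \<in> gen_power G m"
  by (simp add: gen_power_def ring_module.span_diff)

lemma gen_power_mult_left: "x \<in> gen_power G m \<Longrightarrow> c * x \<in> gen_power G m"
  by (simp add: gen_power_def ring_module.span_scale)

lemma gen_power_sum: "(\<And>i. i \<in> S \<Longrightarrow> f i \<in> gen_power G m) \<Longrightarrow> sum f S \<in> gen_power G m"
  by (simp add: gen_power_def ring_module.span_sum)

lemma gen_power_base: "set l \<subseteq> G \<Longrightarrow> prod_list l \<in> gen_power G (length l)"
  by (auto simp: gen_power_def intro: ring_module.span_base)

lemma gen_power_induct [consumes 1, case_names zero step]:
  assumes "x \<in> gen_power G m" "P 0"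
    and "\<And>c l y. length l = m \<Longrightarrow> set l \<subseteq> G \<Longrightarrow> P y \<Longrightarrow> P (c * prod_list l + y)"
  shows "P x"
  using assms(1) unfolding gen_power_def
proof (induction rule: ring_module.span_induct_alt)
  case (step c z y)
  then show ?case using assms(3) by blast
qed (rule assms(2))

lemma gen_power_0: "x \<in> gen_power G 0"
  using gen_power_mult_left[OF gen_power_base[of "[]" G], of x] by simp

lemma gen_power_1: "g \<in> G \<Longrightarrow> g \<in> gen_power G 1"
  using gen_power_base[of "[g]" G] by simp

lemma gen_power_mult:
  assumes "x \<in> gen_power G m" "y \<in> gen_power G n"
  shows "x * y \<in> gen_power G (m + n)"
  using assms(1)
proof (induction rule: gen_power_induct)
  case (step c l z)
  have "prod_list l * y \<in> gen_power G (m + n)"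
    using assms(2)
  proof (induction rule: gen_power_induct)
    case (step d k w)
    have "prod_list (l @ k) \<in> gen_power G (length (l @ k))"
      using \<open>set l \<subseteq> G\<close> \<open>set k \<subseteq> G\<close> by (intro gen_power_base) simp
    then have "prod_list l * prod_list k \<in> gen_power G (m + n)"
      using \<open>length l = m\<close> \<open>length k = n\<close> by simp
    then have "d * (prod_list l * prod_list k) + prod_list l * w \<in> gen_power G (m + n)"
      using step(3) gen_power_add gen_power_mult_left by blast
    then show ?case by (simp only: distrib_left mult.left_commute)
  qed simp
  then have "c * (prod_list l * y) + z * y \<in> gen_power G (m + n)"
    using step(3) gen_power_add gen_power_mult_left by blast
  then show ?case by (simp only: distrib_right mult.assoc)
qed simp

lemma gen_power_antimono:
  assumes "x \<in> gen_power G m" "n \<le> m"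
  shows "x \<in> gen_power G n"
  using assms(1)
proof (induction rule: gen_power_induct)
  case (step c l y)
  have "prod_list (take n l) \<in> gen_power G n"
    using gen_power_base[of "take n l" G] step assms(2) by (auto dest: in_set_takeD)
  from gen_power_mult_left[OF this, of "prod_list (drop n l)"]
  have "prod_list l \<in> gen_power G n"
    by (metis append_take_drop_id mult.commute prod_list.append)
  then show ?case using step(3) gen_power_add gen_power_mult_left by blast
qed simp

lemma gen_power_power: "x \<in> gen_power G m \<Longrightarrow> x ^ k \<in> gen_power G (m * k)"
proof (induction k)
  case (Suc k)
  then show ?case using gen_power_mult[of x G m "x ^ k" "m * k"] by simp
qed (simp add: gen_power_0)

lemma gen_power_prod:
  assumes "finite S" "\<And>i. i \<in> S \<Longrightarrow> f i \<in> gen_power G (m i)"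
  shows "prod f S \<in> gen_power G (sum m S)"
  using assms by (induction rule: finite_induct) (auto simp: gen_power_0 gen_power_mult)

text \<open>Clearing denominators: each of the \<open>m\<close> factors of a product takes one
  \<open>d\<close>.\<close>

lemma gen_power_scale:
  assumes "\<And>g. g \<in> G \<Longrightarrow> d * g \<in> gen_power Y k" and "x \<in> gen_power G m"
  shows "d ^ m * x \<in> gen_power Y (k * m)"
proof -
  have base: "d ^ length l * prod_list l \<in> gen_power Y (k * length l)" if "set l \<subseteq> G" for l
    using that
  proof (induction l)
    case (Cons g l)
    then have "d ^ length l * prod_list l \<in> gen_power Y (k * length l)" "d * g \<in> gen_power Y k"
      by (auto intro: assms(1))
    from gen_power_mult[OF this(2,1)]
    have "(d * g) * (d ^ length l * prod_list l) \<in> gen_power Y (k * length (g # l))" by simp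
    also have "(d * g) * (d ^ length l * prod_list l) = d ^ length (g # l) * prod_list (g # l)"
      by (simp add: mult_ac)
    finally show ?case .
  qed (simp add: gen_power_0)
  show ?thesis
    using assms(2)
  proof (induction rule: gen_power_induct)
    case (step c l y)
    from base[OF step(2)] have "c * (d ^ m * prod_list l) + d ^ m * y \<in> gen_power Y (k * m)"
      unfolding step(1) using step(3) gen_power_add gen_power_mult_left by blast
    then show ?case by (simp only: distrib_left mult.left_commute)
  qed simp
qed

lemma contract_mem:
  assumes "\<And>L1 z L2. L = L1 @ z # L2 \<Longrightarrow> a x z * \<phi> (L1 @ L2) \<in> gen_power G m"
  shows "contract a x \<phi> L \<in> gen_power G m"
  using assms by (intro contract_closed) (auto intro: gen_power_diff)

text \<open>If \<open>D\<close> and \<open>W\<close> are orthogonal, a perfect matching contributing to the Pfaffian pairs the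
  elements of \<open>W\<close> among themselves.\<close>

lemma pf_orthogonal_mem:
  assumes "set U \<subseteq> D \<union> W"
    and "\<And>d w. d \<in> D \<Longrightarrow> w \<in> W \<Longrightarrow> a d w = 0" "\<And>d w. d \<in> D \<Longrightarrow> w \<in> W \<Longrightarrow> a w d = 0"
    and "\<And>v w. v \<in> W \<Longrightarrow> w \<in> W \<Longrightarrow> a v w \<in> gen_power Y 1"
    and "2 * m \<le> length (filter (\<lambda>u. u \<notin> D) U)"
  shows "pf a U \<in> gen_power Y m"
  using assms(1,5)
proof (induction "length U" arbitrary: U m rule: less_induct)
  case less
  show ?case
  proof (cases m)
    case (Suc m')
    with less.prems obtain u V where U: "U = u # V" by (cases U) auto
    show ?thesis unfolding U pf_Cons
    proof (rule contract_mem)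
      fix L1 z L2 assume V: "V = L1 @ z # L2"
      have IH: "pf a (L1 @ L2) \<in> gen_power Y k" if "2 * k \<le> length (filter (\<lambda>u. u \<notin> D) (L1 @ L2))" for k
        by (rule less.hyps) (use less.prems that in \<open>auto simp: U V\<close>)
      show "a u z * pf a (L1 @ L2) \<in> gen_power Y m"
      proof (cases "u \<in> D \<longleftrightarrow> z \<in> D")
        case False
        then have "a u z = 0" using assms(2,3) less.prems(1) by (auto simp: U V)
        then show ?thesis by simp
      next
        case True
        show ?thesis
        proof (cases "u \<in> D")
          case True
          with \<open>u \<in> D \<longleftrightarrow> z \<in> D\<close> show ?thesis using less.prems(2)
            by (intro gen_power_mult_left IH) (auto simp: U V)
        next
          case False
          with \<open>u \<in> D \<longleftrightarrow> z \<in> D\<close> have "a u z * pf a (L1 @ L2) \<in> gen_power Y (1 + m')"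
            using less.prems by (intro gen_power_mult IH assms(4)) (auto simp: U V Suc)
          then show ?thesis by (simp add: Suc)
        qed
      qed
    qed
  qed (simp add: gen_power_0)
qed

text \<open>A list without repetition has at most \<open>2 * s\<close> entries in \<open>D\<close>,
  so at least \<open>2 * (k - s)\<close> entries must be paired among themselves; a list with a
  repetition has Pfaffian 0. For \<open>k < s\<close> the truncated exponent is 0 and nothing is
  claimed.\<close>

lemma (in alternating) pf_orthogonal_mem':
  assumes "set U \<subseteq> D \<union> W"
    and "\<And>d w. d \<in> D \<Longrightarrow> w \<in> W \<Longrightarrow> a d w = 0"
    and "\<And>v w. v \<in> W \<Longrightarrow> w \<in> W \<Longrightarrow> a v w \<in> gen_power Y 1"
    and "length U = 2 * k" "finite D" "card D \<le> 2 * s"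
  shows "pf a U \<in> gen_power Y (k - s)"
proof (cases "distinct U")
  case True
  have "length (filter (\<lambda>u. u \<in> D) U) = card (set (filter (\<lambda>u. u \<in> D) U))"
    using True by (simp only: distinct_card distinct_filter)
  also have "\<dots> \<le> card D" using assms(5) by (intro card_mono) auto
  finally have "length (filter (\<lambda>u. u \<in> D) U) \<le> 2 * s" using assms(6) by simp
  then have "2 * (k - s) \<le> length (filter (\<lambda>u. u \<notin> D) U)"
    using sum_length_filter_compl[of "\<lambda>u. u \<in> D" U] assms(4) by simp
  moreover have "a w d = 0" if "d \<in> D" "w \<in> W" for d w
    using assms(2)[OF that] skew[of w d] by simp
  ultimately show ?thesis using assms(1,2,3) by (intro pf_orthogonal_mem) auto
qed (simp add: pf_repeat)

context
  fixes M :: "nat \<Rightarrow> nat \<Rightarrow> 'a::comm_ring_1" and r s :: nat and D :: "(nat \<Rightarrow> 'a) list"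
  assumes alt: "alternating M" and len: "length D = 2 * s"
begin

interpretation B: alternating "bil M r" by (rule alternating_bil[OF alt])

text \<open>The projection of \<open>x\<close> to the orthogonal complement of \<open>D\<close>, multiplied by \<open>pf D\<close>.\<close>

definition ortho_coeff :: "(nat \<Rightarrow> 'a) \<Rightarrow> nat \<Rightarrow> 'a" where
  "ortho_coeff x j = (-1) ^ j * pf (bil M r) (x # take j D @ drop (Suc j) D)"

definition ortho :: "(nat \<Rightarrow> 'a) \<Rightarrow> nat \<Rightarrow> 'a" where
  "ortho x = (\<lambda>i. pf (bil M r) D * x i + (-1) * (\<Sum>j<length D. ortho_coeff x j * (D ! j) i))"

text \<open>The coefficients are a Cramer's rule for Pfaffians, chosen so that pairing with
  \<open>ortho x\<close> is an expansion along \<open>z\<close>. Orthogonality to \<open>D\<close>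
  becomes the vanishing of a Pfaffian with a repeated entry, without any division.\<close>

lemma bil_ortho: "bil M r z (ortho x) = pf (bil M r) (z # x # D)"
proof -
  have "bil M r z (\<lambda>i. \<Sum>j<length D. ortho_coeff x j * (D ! j) i) =
      (\<Sum>j<length D. ortho_coeff x j * bil M r z (D ! j))"
    by (subst B.skew, subst bil_sum_left, subst B.skew) (simp add: sum_negf)
  also have "\<dots> = contract (bil M r) z (\<lambda>K. pf (bil M r) (x # K)) D"
    by (simp add: contract_def ortho_coeff_def mult_ac)
  finally show ?thesis unfolding ortho_def bil_add_right by (simp add: pf_Cons[of _ z] contract_Cons)
qed

lemma bil_mem_ortho: "d \<in> set D \<Longrightarrow> bil M r d (ortho x) = 0"
  unfolding bil_ortho by (rule B.pf_repeat) simp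

lemma bil_ortho_ortho: "bil M r (ortho z) (ortho x) = pf (bil M r) D * pf (bil M r) (z # x # D)"
proof -
  have "bil M r (\<lambda>i. \<Sum>j<length D. ortho_coeff z j * (D ! j) i) (ortho x) = 0"
    by (subst bil_sum_left) (simp add: bil_mem_ortho)
  then show ?thesis unfolding ortho_def[of z] bil_add_left by (simp add: bil_ortho)
qed

text \<open>A vector \<open>x\<close> scaled by \<open>pf (bil M r) D\<close> is
  \<open>ortho x\<close> plus a combination of \<open>D\<close>. Multilinearity replaces the scaled
  vectors one after the other until all entries lie in \<open>D\<close> or in its orthogonal
  complement; \<open>U\<close> collects the entries already replaced.\<close>

lemma pf_scaled_mem:
  assumes Y: "\<And>z x. z \<in> V \<Longrightarrow> x \<in> V \<Longrightarrow> pf (bil M r) (z # x # D) \<in> gen_power Y 1"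
    and "set U \<subseteq> set D \<union> ortho ` V" "set L \<subseteq> V" "length U + length L = 2 * k"
  shows "pf (bil M r) (U @ map (\<lambda>x i. pf (bil M r) D * x i) L) \<in> gen_power Y (k - s)"
  using assms(2-)
proof (induction L arbitrary: U)
  case Nil
  have "card (set D) \<le> 2 * s" using card_length[of D] len by simp
  with Nil show ?case
    by (intro B.pf_orthogonal_mem'[where D = "set D" and W = "ortho ` V"])
      (auto simp: bil_mem_ortho bil_ortho_ortho intro!: gen_power_mult_left Y[unfolded One_nat_def])
next
  case (Cons x L)
  let ?L = "map (\<lambda>x i. pf (bil M r) D * x i) L"
  let ?c = "\<lambda>i. \<Sum>j<length D. ortho_coeff x j * (D ! j) i"
  have "pf (bil M r) (U @ (\<lambda>i. pf (bil M r) D * x i) # ?L) =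
      1 * pf (bil M r) (U @ ortho x # ?L) + 1 * pf (bil M r) (U @ ?c # ?L)"
    by (rule B.pf_linear2, subst bil_add_left[symmetric]) (simp add: ortho_def)
  also have "pf (bil M r) (U @ ?c # ?L) = (\<Sum>j<length D. ortho_coeff x j * pf (bil M r) (U @ D ! j # ?L))"
    by (rule B.pf_linear) (rule bil_sum_left)
  also have "1 * pf (bil M r) (U @ ortho x # ?L) + 1 * \<dots> \<in> gen_power Y (k - s)"
    unfolding mult_1
    using Cons.IH[of "U @ [ortho x]"] Cons.IH[of "U @ [D ! j]" for j] Cons.prems
    by (intro gen_power_add gen_power_sum gen_power_mult_left) auto
  finally show ?case by simp
qed

end

theorem pf_mem_gen_power:
  fixes M :: "nat \<Rightarrow> nat \<Rightarrow> 'a::comm_ring_1"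
  assumes alt: "alternating M" and D: "length D = 2 * s" "set D \<subseteq> {..<r}"
    and L: "length L = 2 * k" "set L \<subseteq> {..<r}"
    and Y: "\<And>z x. z < r \<Longrightarrow> x < r \<Longrightarrow> pf M (z # x # D) \<in> gen_power Y 1"
  shows "pf M D ^ (2 * k) * pf M L \<in> gen_power Y (k - s)"
proof -
  have pf: "pf (bil M r) (map unit_fun K) = pf M K" if "set K \<subseteq> {..<r}" for K
    unfolding pf_map by (rule pf_cong) (use that in \<open>auto intro!: bil_unit\<close>)
  let ?D = "map unit_fun D" and ?L = "map unit_fun L"
  have "pf (bil M r) ([] @ map (\<lambda>x i. pf (bil M r) ?D * x i) ?L) \<in> gen_power Y (k - s)"
  proof (rule pf_scaled_mem[OF alt, where V = "unit_fun ` {..<r}"])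
    fix z x :: "nat \<Rightarrow> 'a" assume "z \<in> unit_fun ` {..<r}" "x \<in> unit_fun ` {..<r}"
    then obtain i j where ij: "z = unit_fun i" "x = unit_fun j" "i < r" "j < r" by auto
    then show "pf (bil M r) (z # x # ?D) \<in> gen_power Y 1"
      using pf[of "i # j # D"] Y[of i j] D(2) by simp
  qed (use D L in auto)
  \<comment> \<open>Scaling every vector by \<open>pf M D\<close> multiplies the form by the square
    of this factor, which then comes out once for each of the \<open>k\<close> pairs.\<close>
  also have "pf (bil M r) ([] @ map (\<lambda>x i. pf (bil M r) ?D * x i) ?L) = pf (\<lambda>x y. (pf M D)\<^sup>2 * bil M r x y) ?L"
    unfolding pf[OF D(2)] append_Nil pf_map[of "bil M r" "\<lambda>x i. pf M D * x i"]
    by (intro pf_cong) (use bil_add_left[of M r "pf M D" _ 0 "\<lambda>_. 0"] bil_add_right[of M r _ "pf M D" _ 0 "\<lambda>_. 0"]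
      in \<open>simp add: power2_eq_square mult_ac\<close>)
  also have "\<dots> = pf M D ^ (2 * k) * pf M L"
    by (subst pf_scale[where k = k]) (simp_all add: L pf flip: power_mult)
  finally show ?thesis .
qed

text \<open>A Schur complement without division. Both sides are the Pfaffian of the unit vectors at
  \<open>i\<close>, \<open>j\<close> and the vectors \<open>h x\<close>, the projections scaled by
  the pivot: orthogonality yields one side, multilinearity the other. Powers of the pivot remain on
  both sides because it may be a zero divisor.\<close>

lemma pf_pivot:
  fixes M :: "nat \<Rightarrow> nat \<Rightarrow> 'a::comm_ring_1"
  assumes alt: "alternating M" and ij: "i < r" "j < r" and L: "set L \<subseteq> {..<r}" "length L = 2 * m"
  shows "M i j ^ Suc m * pf (\<lambda>x y. M i j * M x y - (M i x * M j y - M j x * M i y)) L =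
    M i j ^ (2 * m) * pf M (i # j # L)"
proof -
  interpret M: alternating M by fact
  interpret B: alternating "bil M r" by (rule alternating_bil[OF alt])
  let ?c = "M i j" and ?i = "unit_fun i" and ?j = "unit_fun j"
  define h where "h x = (\<lambda>k. ?c * unit_fun x k + 1 * (- M i x * ?j k + M j x * ?i k))" for x
  have scaled: "pf (bil M r) (?i # ?j # map unit_fun N @ map h K) = ?c ^ length K * pf (bil M r) (?i # ?j # map unit_fun (N @ K))" for N K
  proof (induction K arbitrary: N)
    case (Cons x K)
    let ?P = "?i # ?j # map unit_fun N"
    \<comment> \<open>Both summands of the correction repeat one of the first two vectors.\<close>
    have z: "pf (bil M r) (?P @ (\<lambda>k. - M i x * ?j k + M j x * ?i k) # map h K) = 0"
      by (subst B.pf_linear2[OF bil_add_left], subst (1 2) B.pf_repeat) auto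
    have "pf (bil M r) (?P @ h x # map h K) = ?c * pf (bil M r) (?P @ unit_fun x # map h K)"
      unfolding h_def[of x] by (subst B.pf_linear2[OF bil_add_left], subst z) simp
    also have "\<dots> = ?c ^ length (x # K) * pf (bil M r) (?i # ?j # map unit_fun (N @ x # K))"
      using Cons.IH[of "N @ [x]"] by (simp add: mult_ac)
    finally show ?case by simp
  qed simp
  have bh: "bil M r z (h x) = ?c * bil M r z (unit_fun x) + (- M i x * bil M r z ?j + M j x * bil M r z ?i)" for z x
    unfolding h_def bil_add_right by simp
  have bij: "bil M r ?i ?j = ?c" "bil M r ?j ?i = - ?c" using ij M.skew[of j i] by (simp_all add: bil_unit)
  have o: "bil M r ?i (h x) = 0" "bil M r ?j (h x) = 0" if "x < r" for x
    using that ij unfolding bh bij by (simp_all add: bil_unit B.self M.self)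
  have "pf (bil M r) (?i # ?j # map h L) = ?c * pf (bil M r) (map h L)"
    using o(1) L(1) by (subst B.pf_orthogonal) (auto simp: bij)
  also have "pf (bil M r) (map h L) = pf (\<lambda>x y. ?c * (?c * M x y - (M i x * M j y - M j x * M i y))) L"
    unfolding pf_map
  proof (rule pf_cong)
    fix x y assume "x \<in> set L" "y \<in> set L"
    then have xy: "x < r" "y < r" using L(1) by auto
    have "bil M r (h x) ?i = 0" "bil M r (h x) ?j = 0"
      using o[OF xy(1)] B.skew[of "h x" ?i] B.skew[of "h x" ?j] by simp_all
    then have "bil M r (h x) (h y) = ?c * bil M r (h x) (unit_fun y)"
      by (simp add: bh[of "h x" y])
    also have "bil M r (h x) (unit_fun y) = ?c * M x y - (M i x * M j y - M j x * M i y)"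
      unfolding h_def bil_add_left using xy ij by (simp add: bil_unit)
    finally show "bil M r (h x) (h y) = ?c * (?c * M x y - (M i x * M j y - M j x * M i y))" .
  qed
  also have "\<dots> = ?c ^ m * pf (\<lambda>x y. ?c * M x y - (M i x * M j y - M j x * M i y)) L"
    by (rule pf_scale) (rule L)
  finally have "?c ^ Suc m * pf (\<lambda>x y. ?c * M x y - (M i x * M j y - M j x * M i y)) L =
      pf (bil M r) (?i # ?j # map unit_fun [] @ map h L)" by (simp add: mult_ac)
  also have "\<dots> = ?c ^ (2 * m) * pf (bil M r) (map unit_fun (i # j # L))"
    unfolding scaled by (simp add: L)
  also have "pf (bil M r) (map unit_fun (i # j # L)) = pf M (i # j # L)"
    unfolding pf_map by (rule pf_cong) (use ij L(1) in \<open>auto intro!: bil_unit\<close>)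
  finally show ?thesis .
qed

section \<open>Alternating matrices modulo a prime ideal\<close>

locale prime_set =
  fixes Q :: "'a::comm_ring_1 set"
  assumes zero: "0 \<in> Q" and add: "x \<in> Q \<Longrightarrow> y \<in> Q \<Longrightarrow> x + y \<in> Q"
    and mult_left: "x \<in> Q \<Longrightarrow> c * x \<in> Q" and one: "1 \<notin> Q"
    and prime: "x * y \<in> Q \<Longrightarrow> x \<in> Q \<or> y \<in> Q"
begin

lemma power: "x ^ n \<in> Q \<Longrightarrow> x \<in> Q"
  by (induction n) (use one prime in auto)

lemma sum: "(\<And>i. i \<in> S \<Longrightarrow> f i \<in> Q) \<Longrightarrow> sum f S \<in> Q"
  by (induction S rule: infinite_finite_induct) (auto simp: zero add)

text \<open>Over the fraction field of the quotient by \<open>Q\<close> this says that an alternating matrix all of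
  whose Pfaffians of size \<open>2 s + 2\<close> vanish is a sum of \<open>s\<close> alternating matrices of rank two.\<close>

theorem alternating_normal_form:
  fixes M :: "nat \<Rightarrow> nat \<Rightarrow> 'a"
  assumes "alternating M" "\<And>L. set L \<subseteq> {..<r} \<Longrightarrow> length L = 2 * Suc s \<Longrightarrow> pf M L \<in> Q"
  shows "\<exists>c u v. c \<notin> Q \<and>
    (\<forall>x<r. \<forall>y<r. c * M x y - (\<Sum>l<s. u l x * v l y - v l x * u l y) \<in> Q)"
  using assms
proof (induction s arbitrary: M)
  case 0
  have "M x y \<in> Q" if "x < r" "y < r" for x y
    using 0(2)[of "[x, y]"] that by simp
  then show ?case using one by (intro exI[of _ 1]) auto
next
  case (Suc s)
  interpret M: alternating M by fact
  show ?case
  proof (cases "\<forall>x<r. \<forall>y<r. M x y \<in> Q")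
    case True
    then show ?thesis using one by (intro exI[of _ 1] exI[of _ "\<lambda>_ _. 0"]) auto
  next
    case False
    then obtain i j where ij: "i < r" "j < r" "M i j \<notin> Q" by auto
    define M' where "M' = (\<lambda>x y. M i j * M x y - (M i x * M j y - M j x * M i y))"
    have "alternating M'"
    proof
      fix x y
      show "M' x x = 0" by (simp add: M'_def M.self)
      show "M' x y = - M' y x" unfolding M'_def using M.skew[of x y] by (simp add: algebra_simps)
    qed
    moreover have "pf M' L \<in> Q" if L: "set L \<subseteq> {..<r}" "length L = 2 * Suc s" for L
    proof -
      have "pf M (i # j # L) \<in> Q" by (rule Suc.prems(2)) (use ij L in auto)
      then have "M i j ^ Suc (Suc s) * pf M' L \<in> Q"
        unfolding M'_def pf_pivot[OF Suc.prems(1) ij(1,2) L] by (rule mult_left)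
      with prime power ij(3) show ?thesis by blast
    qed
    ultimately obtain c u v where c: "c \<notin> Q" and
      uv: "\<And>x y. x < r \<Longrightarrow> y < r \<Longrightarrow> c * M' x y - (\<Sum>l<s. u l x * v l y - v l x * u l y) \<in> Q"
      using Suc.IH[of M'] by blast
    \<comment> \<open>By definition of \<open>M'\<close>, the matrices
      \<open>c * M i j * M x y\<close> and \<open>c * M' x y\<close> differ by
      \<open>c * (M i x * M j y - M j x * M i y)\<close>, which becomes the new summand with index
      \<open>s\<close>.\<close>
    define u' where "u' = (\<lambda>l x. if l = s then c * M i x else u l x)"
    define v' where "v' = (\<lambda>l x. if l = s then M j x else v l x)"
    have eq: "(c * M i j) * M x y - (\<Sum>l<Suc s. u' l x * v' l y - v' l x * u' l y) =
        c * M' x y - (\<Sum>l<s. u l x * v l y - v l x * u l y)" for x y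
      by (simp add: u'_def v'_def M'_def algebra_simps)
    have "c * M i j \<notin> Q" using c ij(3) prime by blast
    with uv show ?thesis
      by (intro exI[of _ "c * M i j"] exI[of _ u'] exI[of _ v']) (simp only: eq, simp)
  qed
qed

end

section \<open>Substitution homomorphisms\<close>

text \<open>\<open>F m\<close> is meant to be additive, not linear, in the coefficient: besides
  substitutions this has to cover the trace, which is only semilinear over the field.\<close>

definition lin_ext :: "('m \<Rightarrow> 'k \<Rightarrow> 'b::comm_monoid_add) \<Rightarrow> ('m \<Rightarrow>\<^sub>0 'k::comm_monoid_add) \<Rightarrow> 'b" where
  "lin_ext F f = (\<Sum>m\<in>Poly_Mapping.keys f. F m (Poly_Mapping.lookup f m))"

lemma lin_ext_zero [simp]: "lin_ext F 0 = 0"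
  by (simp add: lin_ext_def)

lemma lin_ext_single: "F m 0 = 0 \<Longrightarrow> lin_ext F (Poly_Mapping.single m c) = F m c"
  by (simp add: lin_ext_def)

lemma lin_ext_add:
  assumes "\<And>m. F m 0 = 0" "\<And>m c d. F m (c + d) = F m c + F m d"
  shows "lin_ext F (f + g) = lin_ext F f + lin_ext F g"
  unfolding lin_ext_def by (rule setsum_keys_plus_distrib) (use assms in auto)

lemma poly_mapping_sum_single: "f = (\<Sum>m\<in>Poly_Mapping.keys f. Poly_Mapping.single m (Poly_Mapping.lookup f m))"
  by (rule poly_mapping_eqI) (auto simp: lookup_sum lookup_single when_def in_keys_iff)

lemma poly_mapping_additive_induct [case_names zero single add]:
  fixes f :: "'m \<Rightarrow>\<^sub>0 'k::comm_monoid_add"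
  assumes "P 0" "\<And>m. m \<in> Poly_Mapping.keys f \<Longrightarrow> P (Poly_Mapping.single m (Poly_Mapping.lookup f m))"
    and "\<And>g h. P g \<Longrightarrow> P h \<Longrightarrow> P (g + h)"
  shows "P f"
proof -
  have "P (\<Sum>m\<in>S. Poly_Mapping.single m (Poly_Mapping.lookup f m))" if "S \<subseteq> Poly_Mapping.keys f" for S
    using finite_subset[OF that finite_keys] that
    by (induction S rule: finite_induct) (auto intro: assms)
  from this[OF subset_refl] show ?thesis by (simp flip: poly_mapping_sum_single)
qed

abbreviation const :: "'k::field \<Rightarrow> 'k pair_poly" where
  "const c \<equiv> Poly_Mapping.single 0 c"

definition mon :: "(nat \<times> nat \<Rightarrow> 'k::field pair_poly) \<Rightarrow> (nat \<times> nat \<Rightarrow>\<^sub>0 nat) \<Rightarrow> 'k pair_poly" where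
  "mon g m = (\<Prod>v\<in>Poly_Mapping.keys m. g v ^ Poly_Mapping.lookup m v)"

definition subst :: "(nat \<times> nat \<Rightarrow> 'k::field pair_poly) \<Rightarrow> 'k pair_poly \<Rightarrow> 'k pair_poly" where
  "subst g = lin_ext (\<lambda>m c. const c * mon g m)"

lemma mon_superset:
  assumes "finite S" "Poly_Mapping.keys m \<subseteq> S"
  shows "mon g m = (\<Prod>v\<in>S. g v ^ Poly_Mapping.lookup m v)"
  unfolding mon_def using assms by (intro prod.mono_neutral_left) (auto simp: in_keys_iff)

lemma mon_zero [simp]: "mon g 0 = 1"
  by (simp add: mon_def)

lemma mon_add: "mon g (m + n) = mon g m * mon g n"
proof -
  let ?S = "Poly_Mapping.keys m \<union> Poly_Mapping.keys n"
  have "mon g (m + n) = (\<Prod>v\<in>?S. g v ^ Poly_Mapping.lookup (m + n) v)"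
    by (rule mon_superset) (use Poly_Mapping.keys_add[of m n] in auto)
  also have "\<dots> = (\<Prod>v\<in>?S. g v ^ Poly_Mapping.lookup m v) * (\<Prod>v\<in>?S. g v ^ Poly_Mapping.lookup n v)"
    by (simp add: lookup_add power_add prod.distrib)
  also have "\<dots> = mon g m * mon g n" by (subst (1 2) mon_superset[of ?S]) auto
  finally show ?thesis .
qed

lemma subst_zero [simp]: "subst g 0 = 0"
  by (simp add: subst_def)

lemma subst_single: "subst g (Poly_Mapping.single m c) = const c * mon g m"
  unfolding subst_def by (rule lin_ext_single) simp

lemma subst_add: "subst g (f + h) = subst g f + subst g h"
  unfolding subst_def by (rule lin_ext_add) (auto simp: single_add distrib_right)

lemma subst_one [simp]: "subst g 1 = 1"
  using subst_single[of g 0 1] by simp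

lemma subst_mult: "subst g (f * h) = subst g f * subst g h"
proof (induction f rule: poly_mapping_additive_induct)
  case (single m)
  show ?case
  proof (induction h rule: poly_mapping_additive_induct)
    case (single n)
    show ?case
      by (simp add: mult_single subst_single mon_add mult_ac flip: mult_single[of 0 _ 0 _, simplified])
  qed (auto simp: subst_add distrib_left)
qed (auto simp: subst_add distrib_right)

lemma subst_minus: "subst g (- f) = - subst g f"
  using subst_add[of g f "- f"] by (simp add: minus_unique)

lemma subst_diff: "subst g (f - h) = subst g f - subst g h"
  using subst_add[of g f "- h"] by (simp add: subst_minus)

lemma subst_sum: "subst g (\<Sum>i\<in>S. f i) = (\<Sum>i\<in>S. subst g (f i))"
  by (induction S rule: infinite_finite_induct) (auto simp: subst_add)

lemma subst_power: "subst g (f ^ n) = subst g f ^ n"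
  by (induction n) (auto simp: subst_mult)

lemma subst_prod: "subst g (\<Prod>i\<in>S. f i) = (\<Prod>i\<in>S. subst g (f i))"
  by (induction S rule: infinite_finite_induct) (auto simp: subst_mult)

lemma subst_const [simp]: "subst g (const c) = const c"
  by (simp add: subst_single)

lemma subst_indet [simp]: "subst g (indet i j) = g (i, j)"
  by (simp add: indet_def subst_single mon_def)

lemma subst_pf: "subst g (pf a L) = pf (\<lambda>x y. subst g (a x y)) L"
  by (rule pf_hom) (auto simp: subst_add subst_mult)

lemma subst_subst: "subst h (subst g f) = subst (\<lambda>v. subst h (g v)) f"
  by (induction f rule: poly_mapping_additive_induct)
    (auto simp: subst_single subst_add subst_mult mon_def subst_prod subst_power)

lemma single_power: "Poly_Mapping.single (m :: 'm::comm_monoid_add) (c :: 'k::comm_semiring_1) ^ n =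
    Poly_Mapping.single (\<Sum>_<n. m) (c ^ n)" for n :: nat
  by (induction n) (auto simp: mult_single add.commute)

lemma mon_indet: "(\<And>v. v \<in> Poly_Mapping.keys m \<Longrightarrow> g v = indet (fst v) (snd v)) \<Longrightarrow> mon g m = Poly_Mapping.single m 1"
proof -
  assume g: "\<And>v. v \<in> Poly_Mapping.keys m \<Longrightarrow> g v = indet (fst v) (snd v)"
  have s: "(\<Sum>_<n. Poly_Mapping.single v (1 :: nat)) = Poly_Mapping.single v n" for v :: "nat \<times> nat" and n :: nat
    by (induction n) (auto simp flip: single_add)
  have "(\<Prod>v\<in>S. g v ^ Poly_Mapping.lookup m v) =
      Poly_Mapping.single (\<Sum>v\<in>S. Poly_Mapping.single v (Poly_Mapping.lookup m v)) 1"
    if "S \<subseteq> Poly_Mapping.keys m" for S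
    using finite_subset[OF that finite_keys] that
    by (induction S rule: finite_induct) (auto simp: g indet_def single_power s[unfolded One_nat_def] mult_single)
  from this[OF subset_refl] show "mon g m = Poly_Mapping.single m 1"
    by (simp add: mon_def flip: poly_mapping_sum_single)
qed

section \<open>The ring K[Z] inside the ambient polynomial ring\<close>

abbreviation vars :: "nat \<Rightarrow> (nat \<times> nat) set" where
  "vars r \<equiv> {(i, j). i < j \<and> j < r}"

lemma skew_poly_ringD: "f \<in> skew_poly_ring r \<Longrightarrow> m \<in> Poly_Mapping.keys f \<Longrightarrow> Poly_Mapping.keys m \<subseteq> vars r"
  by (simp add: skew_poly_ring_def)

lemma skew_poly_ring_zero [simp]: "0 \<in> skew_poly_ring r"
  by (simp add: skew_poly_ring_def)

lemma skew_poly_ring_const [simp]: "const c \<in> skew_poly_ring r"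
  by (simp add: skew_poly_ring_def)

lemma skew_poly_ring_one [simp]: "1 \<in> skew_poly_ring r"
  using skew_poly_ring_const[of 1 r] by simp

lemma skew_poly_ring_minus: "f \<in> skew_poly_ring r \<Longrightarrow> - f \<in> skew_poly_ring r"
  by (simp add: skew_poly_ring_def)

lemma skew_poly_ring_add: "f \<in> skew_poly_ring r \<Longrightarrow> g \<in> skew_poly_ring r \<Longrightarrow> f + g \<in> skew_poly_ring r"
  using Poly_Mapping.keys_add[of f g] by (fastforce simp: skew_poly_ring_def)

lemma skew_poly_ring_diff: "f \<in> skew_poly_ring r \<Longrightarrow> g \<in> skew_poly_ring r \<Longrightarrow> f - g \<in> skew_poly_ring r"
  using skew_poly_ring_add[of f r "- g"] by (simp add: skew_poly_ring_minus)

lemma skew_poly_ring_mult: "f \<in> skew_poly_ring r \<Longrightarrow> g \<in> skew_poly_ring r \<Longrightarrow> f * g \<in> skew_poly_ring r"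
  using monoid.m_closed[OF comm_monoid.axioms(1)[OF cring.axioms(2)[OF skew_poly_ring_cring]], of f r g]
  by (simp add: subring_of_def ring_of_type_algebra_def)

lemma skew_poly_ring_sum: "(\<And>i. i \<in> S \<Longrightarrow> f i \<in> skew_poly_ring r) \<Longrightarrow> sum f S \<in> skew_poly_ring r"
  by (induction S rule: infinite_finite_induct) (auto simp: skew_poly_ring_add)

lemma skew_poly_ring_prod: "(\<And>i. i \<in> S \<Longrightarrow> f i \<in> skew_poly_ring r) \<Longrightarrow> prod f S \<in> skew_poly_ring r"
  by (induction S rule: infinite_finite_induct) (auto simp: skew_poly_ring_mult)

lemma skew_poly_ring_power: "f \<in> skew_poly_ring r \<Longrightarrow> f ^ n \<in> skew_poly_ring r"
  by (induction n) (auto simp: skew_poly_ring_mult)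

lemma skew_poly_ring_indet: "i < j \<Longrightarrow> j < r \<Longrightarrow> indet i j \<in> skew_poly_ring r"
  by (simp add: skew_poly_ring_def indet_def)

lemma subst_mem_skew_poly_ring:
  assumes "\<And>v. g v \<in> skew_poly_ring r"
  shows "subst g f \<in> skew_poly_ring r"
  by (induction f rule: poly_mapping_additive_induct)
    (auto simp: subst_add skew_poly_ring_add subst_single mon_def
      intro!: skew_poly_ring_mult skew_poly_ring_prod skew_poly_ring_power assms)

lemma subst_eq_self:
  assumes "f \<in> skew_poly_ring r" "\<And>i j. i < j \<Longrightarrow> j < r \<Longrightarrow> g (i, j) = indet i j"
  shows "subst g f = f"
proof (induction f rule: poly_mapping_additive_induct)
  case (single m)
  have "mon g m = Poly_Mapping.single m 1"
    by (rule mon_indet) (use skew_poly_ringD[OF assms(1) single] assms(2) in auto)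
  then show ?case by (simp add: subst_single mult_single)
qed (auto simp: subst_add)

text \<open>The retraction of the ambient polynomial ring to \<open>K[Z]\<close>; it reduces ideal membership
  in \<open>K[Z]\<close> to ideal membership in the ambient ring.\<close>

definition retract :: "nat \<Rightarrow> 'k::field pair_poly \<Rightarrow> 'k pair_poly" where
  "retract r = subst (\<lambda>(i, j). if i < j \<and> j < r then indet i j else 0)"

lemma retract_mem: "retract r f \<in> skew_poly_ring r"
  unfolding retract_def by (rule subst_mem_skew_poly_ring) (auto simp: skew_poly_ring_indet)

lemma retract_self: "f \<in> skew_poly_ring r \<Longrightarrow> retract r f = f"
  unfolding retract_def by (rule subst_eq_self) auto

lemma retract_add: "retract r (f + g) = retract r f + retract r g"
  and retract_mult: "retract r (f * g) = retract r f * retract r g"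
  and retract_zero: "retract r 0 = 0"
  and retract_one: "retract r 1 = 1"
  by (simp_all add: retract_def subst_add subst_mult)

lemma (in prime_set) diff_mult:
  assumes "x - y \<in> Q" "x' - y' \<in> Q"
  shows "x * x' - y * y' \<in> Q"
proof -
  have "x' * (x - y) + y * (x' - y') \<in> Q" using assms by (intro add mult_left)
  then show ?thesis by (simp add: algebra_simps)
qed

lemma (in prime_set) diff_power: "x - y \<in> Q \<Longrightarrow> x ^ n - y ^ n \<in> Q"
  by (induction n) (auto simp: zero intro: diff_mult)

lemma (in prime_set) diff_prod: "(\<And>i. i \<in> S \<Longrightarrow> f i - g i \<in> Q) \<Longrightarrow> prod f S - prod g S \<in> Q"
  by (induction S rule: infinite_finite_induct) (auto simp: zero intro: diff_mult)

lemma subst_diff_mem: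
  fixes Q :: "'k::field pair_poly set"
  assumes "prime_set Q" "f \<in> skew_poly_ring r" "\<And>i j. i < j \<Longrightarrow> j < r \<Longrightarrow> g (i, j) - h (i, j) \<in> Q"
  shows "subst g f - subst h f \<in> Q"
proof -
  interpret prime_set Q by fact
  show ?thesis
  proof (induction f rule: poly_mapping_additive_induct)
    case (single m)
    have "mon g m - mon h m \<in> Q"
      unfolding mon_def
      by (intro diff_prod diff_power) (use skew_poly_ringD[OF assms(2) single] assms(3) in auto)
    then have "const (Poly_Mapping.lookup f m) * (mon g m - mon h m) \<in> Q" by (rule mult_left)
    then show ?case by (simp add: subst_single right_diff_distrib)
  next
    case (add f1 f2)
    then have "(subst g f1 - subst h f1) + (subst g f2 - subst h f2) \<in> Q" by (rule prime_set.add[OF assms(1)])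
    then show ?case by (simp add: subst_add algebra_simps)
  qed (simp add: zero)
qed

section \<open>Weights and homogeneous components\<close>

definition wt :: "(nat \<times> nat \<Rightarrow> int) \<Rightarrow> (nat \<times> nat \<Rightarrow>\<^sub>0 nat) \<Rightarrow> int" where
  "wt w m = (\<Sum>v\<in>Poly_Mapping.keys m. w v * int (Poly_Mapping.lookup m v))"

lemma wt_zero [simp]: "wt w 0 = 0"
  by (simp add: wt_def)

lemma wt_single [simp]: "wt w (Poly_Mapping.single v n) = w v * int n"
  by (simp add: wt_def)

lemma wt_add: "wt w (m + n) = wt w m + wt w n"
  unfolding wt_def by (rule setsum_keys_plus_distrib) (auto simp: distrib_left)

lemma wt_sum: "wt w (\<Sum>i\<in>S. m i) = (\<Sum>i\<in>S. wt w (m i))"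
  by (induction S rule: infinite_finite_induct) (auto simp: wt_add)

definition homogeneous :: "int \<Rightarrow> 'k::field pair_poly \<Rightarrow> bool" where
  "homogeneous d f \<longleftrightarrow> (\<forall>m\<in>Poly_Mapping.keys f. wt (\<lambda>_. 1) m = d)"

lemma homogeneous_mult: "homogeneous d f \<Longrightarrow> homogeneous e g \<Longrightarrow> homogeneous (d + e) (f * g)"
  using keys_mult[of f g] by (fastforce simp: homogeneous_def wt_add)

lemma homogeneous_diff: "homogeneous d f \<Longrightarrow> homogeneous d g \<Longrightarrow> homogeneous d (f - g)"
  using keys_diff[of f g] by (fastforce simp: homogeneous_def)

lemma homogeneous_sum: "(\<And>i. i \<in> S \<Longrightarrow> homogeneous d (f i)) \<Longrightarrow> homogeneous d (sum f S)"
  using keys_sum[of f S] by (fastforce simp: homogeneous_def)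

lemma homogeneous_const [simp]: "homogeneous 0 (const c)"
  by (simp add: homogeneous_def)

lemma homogeneous_one [simp]: "homogeneous 0 1"
  using homogeneous_const[of 1] by simp

lemma homogeneous_indet [simp]: "homogeneous 1 (indet i j)"
  by (simp add: homogeneous_def indet_def)

lemma homogeneous_power: "homogeneous d f \<Longrightarrow> homogeneous (d * int n) (f ^ n)"
  by (induction n) (auto simp: distrib_left dest: homogeneous_mult)

lemma homogeneous_mon:
  assumes "\<And>v. homogeneous e (g v)"
  shows "homogeneous (e * wt (\<lambda>_. 1) m) (mon g m)"
proof -
  have "homogeneous (e * (\<Sum>v\<in>S. int (Poly_Mapping.lookup m v))) (\<Prod>v\<in>S. g v ^ Poly_Mapping.lookup m v)"
    if "finite S" for S
    using that
  proof (induction S rule: finite_induct)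
    case (insert v S)
    with homogeneous_mult[OF homogeneous_power[OF assms[of v]] insert.IH] show ?case
      by (simp add: distrib_left)
  qed simp
  from this[OF finite_keys] show ?thesis by (simp add: wt_def mon_def)
qed

definition hom_part :: "int \<Rightarrow> 'k::field pair_poly \<Rightarrow> 'k pair_poly" where
  "hom_part d = lin_ext (\<lambda>m c. if wt (\<lambda>_. 1) m = d then Poly_Mapping.single m c else 0)"

lemma hom_part_zero [simp]: "hom_part d 0 = 0"
  by (simp add: hom_part_def)

lemma hom_part_add: "hom_part d (f + g) = hom_part d f + hom_part d g"
  unfolding hom_part_def by (rule lin_ext_add) (auto simp: single_add)

lemma hom_part_single:
  "hom_part d (Poly_Mapping.single m c) = (if wt (\<lambda>_. 1) m = d then Poly_Mapping.single m c else 0)"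
  unfolding hom_part_def by (subst lin_ext_single) auto

lemma hom_part_homogeneous:
  assumes "homogeneous e f"
  shows "hom_part d f = (if d = e then f else 0)"
proof (induction f rule: poly_mapping_additive_induct)
  case (single m)
  with assms show ?case by (simp add: hom_part_single homogeneous_def)
qed (auto simp: hom_part_add)

lemma sum_hom_part:
  fixes f :: "'k::field pair_poly"
  shows "f = (\<Sum>d\<in>wt (\<lambda>_. 1) ` Poly_Mapping.keys f. hom_part d f)"
proof -
  let ?D = "wt (\<lambda>_. 1) ` Poly_Mapping.keys f"
  have "(\<Sum>d\<in>?D. hom_part d f) = f"
  proof (induction f rule: poly_mapping_additive_induct[where P = "\<lambda>g. (\<Sum>d\<in>?D. hom_part d g) = g"])
    case (single m)
    then have "wt (\<lambda>_. 1) m \<in> ?D" by blast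
    then show ?case by (simp add: hom_part_single)
  qed (simp_all add: hom_part_add sum.distrib)
  then show ?thesis by (rule sym)
qed

text \<open>Degrees are multiplied by \<open>e\<close>; positivity keeps distinct degrees distinct,
  so components cannot merge.\<close>

lemma hom_part_subst:
  assumes "\<And>v. homogeneous e (g v)" "e > 0"
  shows "hom_part (e * d) (subst g f) = subst g (hom_part d f)"
proof (induction f rule: poly_mapping_additive_induct)
  case (single m)
  have "homogeneous (0 + e * wt (\<lambda>_. 1) m) (const (Poly_Mapping.lookup f m) * mon g m)"
    by (intro homogeneous_mult homogeneous_mon assms homogeneous_const)
  then show ?case using assms(2)
    by (auto simp: subst_single hom_part_homogeneous hom_part_single)
qed (auto simp: hom_part_add subst_add)

lemma hom_part_mem: "f \<in> skew_poly_ring r \<Longrightarrow> hom_part d f \<in> skew_poly_ring r"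
  unfolding hom_part_def lin_ext_def
  by (intro skew_poly_ring_sum) (simp add: skew_poly_ring_def)

text \<open>For negative \<open>d\<close> the component is zero, so \<open>nat d\<close> loses
  nothing.\<close>

lemma subst_scale_hom_part:
  "subst (\<lambda>(i, j). c * indet i j) (hom_part d f) = c ^ nat d * hom_part d f"
proof (induction f rule: poly_mapping_additive_induct)
  case (single m)
  have "mon (\<lambda>(i, j). c * indet i j) m = (\<Prod>v\<in>Poly_Mapping.keys m. c ^ Poly_Mapping.lookup m v) * mon (\<lambda>(i, j). indet i j) m"
    by (simp add: mon_def case_prod_unfold power_mult_distrib prod.distrib)
  also have "(\<Prod>v\<in>Poly_Mapping.keys m. c ^ Poly_Mapping.lookup m v) = c ^ nat (wt (\<lambda>_. 1) m)"
    by (simp add: wt_def power_sum flip: of_nat_sum)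
  also have "mon (\<lambda>(i, j). indet i j) m = Poly_Mapping.single m 1"
    by (rule mon_indet) auto
  finally show ?case by (simp add: hom_part_single subst_single mult_single mult.left_commute)
qed (auto simp: hom_part_add subst_add distrib_left)

section \<open>The generic alternating matrix of rank \<open>2 s\<close>\<close>

definition rank_form :: "nat \<Rightarrow> (nat \<Rightarrow> nat \<Rightarrow> 'a) \<Rightarrow> (nat \<Rightarrow> nat \<Rightarrow> 'a) \<Rightarrow> nat \<times> nat \<Rightarrow> 'a::comm_ring_1" where
  "rank_form s u v = (\<lambda>(i, j). \<Sum>l<s. u l i * v l j - v l i * u l j)"

text \<open>With \<open>X\<close> the generic matrix of the variables \<open>indet a i\<close>,
  \<open>a < 2 * s\<close>, and \<open>J\<close> the standard symplectic matrix, this substitutes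
  the entries of \<open>X^T J X\<close> for those of Z. The type has a variable for every pair of
  indices, so the same type can host \<open>X\<close>.\<close>

definition generic_rank :: "nat \<Rightarrow> 'k::field pair_poly \<Rightarrow> 'k pair_poly" where
  "generic_rank s = subst (rank_form s (\<lambda>l i. indet (2 * l) i) (\<lambda>l i. indet (2 * l + 1) i))"

lemma subst_generic_rank:
  "\<exists>\<tau>. \<forall>f. subst \<tau> (generic_rank s f) = subst (rank_form s u v) f"
proof -
  define \<tau> where "\<tau> = (\<lambda>(a, i). if even a then u (a div 2) i else v (a div 2) i)"
  have "subst \<tau> (generic_rank s f) = subst (rank_form s u v) f" for f
    unfolding generic_rank_def subst_subst
    by (intro arg_cong[where f = "\<lambda>g. subst g f"])
      (auto simp: rank_form_def subst_sum subst_diff subst_mult \<tau>_def)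
  then show ?thesis by blast
qed

text \<open>Modulo \<open>Q\<close>, \<open>c\<close> times the generic matrix is a specialisation
  of the generic matrix of rank \<open>2 s\<close>. As \<open>c\<close> need not be a unit, this
  says nothing directly about an inhomogeneous \<open>f\<close>. But the kernel is homogeneous, all
  substituted entries having degree 2, and in a component of degree \<open>d\<close> the scaling by
  \<open>c\<close> comes out as a power of \<open>c\<close>, which the prime \<open>Q\<close>
  cancels.\<close>

lemma generic_rank_kernel_subset:
  fixes Q :: "'k::field pair_poly set"
  assumes Q: "prime_set Q" and f: "f \<in> skew_poly_ring r" "generic_rank s f = 0"
    and c: "c \<notin> Q" "\<And>i j. i < j \<Longrightarrow> j < r \<Longrightarrow> c * indet i j - rank_form s u v (i, j) \<in> Q"
  shows "f \<in> Q"
proof -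
  interpret prime_set Q by fact
  obtain \<tau> where \<tau>: "\<And>f. subst \<tau> (generic_rank s f) = subst (rank_form s u v) f"
    using subst_generic_rank by blast
  have h: "homogeneous (1 + 1) (rank_form s (\<lambda>l i. indet (2 * l) i) (\<lambda>l i. indet (2 * l + 1) i) x)" for x
    unfolding rank_form_def case_prod_unfold
    by (intro homogeneous_sum homogeneous_diff homogeneous_mult homogeneous_indet)
  have "hom_part d f \<in> Q" for d
  proof -
    have "hom_part ((1 + 1) * d) (generic_rank s f) = generic_rank s (hom_part d f)"
      unfolding generic_rank_def by (rule hom_part_subst) (rule h, simp)
    then have "generic_rank s (hom_part d f) = 0" using f(2) by simp
    then have "subst (rank_form s u v) (hom_part d f) = 0"
      using \<tau>[of "hom_part d f"] by simp
    moreover have "subst (\<lambda>(i, j). c * indet i j) (hom_part d f) - subst (rank_form s u v) (hom_part d f) \<in> Q"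
      by (rule subst_diff_mem[OF Q hom_part_mem[OF f(1)]]) (use c(2) in auto)
    ultimately have "c ^ nat d * hom_part d f \<in> Q" by (simp add: subst_scale_hom_part)
    with c(1) prime power show ?thesis by blast
  qed
  then show ?thesis by (subst sum_hom_part) (rule sum)
qed

definition skew_mat :: "nat \<Rightarrow> nat \<Rightarrow> 'k::field pair_poly" where
  "skew_mat i j = (if i < j then indet i j else if j < i then - indet j i else 0)"

lemma alternating_skew_mat: "alternating skew_mat"
  by unfold_locales (auto simp: skew_mat_def)

lemma pf_standard_symplectic:
  assumes "\<And>x y. a x y = (if even x \<and> y = Suc x then 1 else if even y \<and> x = Suc y then - 1 else (0 :: 'a::comm_ring_1))"
  shows "pf a [2 * i..<2 * (i + n)] = 1"
proof (induction n arbitrary: i)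
  case (Suc n)
  interpret alternating a by unfold_locales (auto simp: assms)
  have "[2 * i..<2 * (i + Suc n)] = 2 * i # Suc (2 * i) # [2 * Suc i..<2 * (Suc i + n)]"
    by (simp add: upt_conv_Cons)
  moreover have "pf a (2 * i # Suc (2 * i) # [2 * Suc i..<2 * (Suc i + n)]) =
      a (2 * i) (Suc (2 * i)) * pf a [2 * Suc i..<2 * (Suc i + n)]"
    by (rule pf_orthogonal) (auto simp: assms)
  moreover have "a (2 * i) (Suc (2 * i)) = 1" by (simp add: assms)
  ultimately show ?case by (simp only: Suc mult_1)
qed simp

text \<open>Specialising the generic vectors to unit vectors turns the leading block into the
  standard symplectic matrix, whose Pfaffian is 1.\<close>

lemma generic_rank_pf: "generic_rank s (pf skew_mat [0..<2 * s]) \<noteq> (0 :: 'k::field pair_poly)"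
proof
  assume z: "generic_rank s (pf skew_mat [0..<2 * s]) = (0 :: 'k pair_poly)"
  define u v :: "nat \<Rightarrow> nat \<Rightarrow> 'k pair_poly"
    where "u = (\<lambda>l i. if i = 2 * l then 1 else 0)" and "v = (\<lambda>l i. if i = Suc (2 * l) then 1 else 0)"
  obtain \<tau> where \<tau>: "\<And>f. subst \<tau> (generic_rank s f) = subst (rank_form s u v) f"
    using subst_generic_rank by blast
  define a :: "nat \<Rightarrow> nat \<Rightarrow> 'k pair_poly" where
    "a x y = (if even x \<and> y = Suc x then 1 else if even y \<and> x = Suc y then - 1 else 0)" for x y
  have form: "rank_form s u v (x, y) = a x y" if "x < y" "y < 2 * s" for x y
  proof -
    have "rank_form s u v (x, y) = (\<Sum>l<s. if l = x div 2 then a x y else 0)"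
      unfolding rank_form_def prod.case
      by (intro sum.cong refl) (use that in \<open>auto simp: u_def v_def a_def elim!: oddE evenE\<close>)
    also have "\<dots> = a x y" using that by simp
    finally show ?thesis .
  qed
  have "subst (rank_form s u v) (pf skew_mat [0..<2 * s]) = pf a [0..<2 * s]"
    unfolding subst_pf
  proof (rule pf_cong)
    fix x y assume "x \<in> set [0..<2 * s]" "y \<in> set [0..<2 * s]"
    then show "subst (rank_form s u v) (skew_mat x y) = a x y"
      using form[of x y] form[of y x] by (auto simp: skew_mat_def subst_minus a_def)
  qed
  also have "\<dots> = 1" using pf_standard_symplectic[of a 0 s] by (simp add: a_def)
  finally show False using \<tau>[of "pf skew_mat [0..<2 * s]"] z by simp
qed

section \<open>Leading terms\<close>

text \<open>Weights stand in for a monomial order: the other monomials only have to be strictly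
  lighter, and ties among them are harmless.\<close>

definition has_top :: "(nat \<times> nat \<Rightarrow> int) \<Rightarrow> 'k::field pair_poly \<Rightarrow> (nat \<times> nat \<Rightarrow>\<^sub>0 nat) \<Rightarrow> bool" where
  "has_top w f m \<longleftrightarrow> (\<exists>g. f = Poly_Mapping.single m 1 + g \<and> (\<forall>n\<in>Poly_Mapping.keys g. wt w n < wt w m))"

lemma has_top_one [simp]: "has_top w 1 0"
  unfolding has_top_def by (intro exI[of _ 0]) simp

lemma has_top_mult:
  assumes "has_top w f m" "has_top w g n"
  shows "has_top w (f * g) (m + n)"
proof -
  from assms obtain f' g' where f: "f = Poly_Mapping.single m 1 + f'" "\<And>k. k \<in> Poly_Mapping.keys f' \<Longrightarrow> wt w k < wt w m"
    and g: "g = Poly_Mapping.single n 1 + g'" "\<And>k. k \<in> Poly_Mapping.keys g' \<Longrightarrow> wt w k < wt w n"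
    unfolding has_top_def by blast
  have gk: "wt w k \<le> wt w n" if "k \<in> Poly_Mapping.keys g" for k
  proof -
    from that have "k \<in> Poly_Mapping.keys (Poly_Mapping.single n 1 + g')" by (simp only: g(1))
    from subsetD[OF Poly_Mapping.keys_add this] show ?thesis
      using g(2)[of k] by (elim UnE) simp_all
  qed
  have "wt w k < wt w (m + n)" if k: "k \<in> Poly_Mapping.keys (Poly_Mapping.single m 1 * g' + f' * g)" for k
  proof -
    from subsetD[OF Poly_Mapping.keys_add k]
    consider a b where "k = a + b" "a \<in> Poly_Mapping.keys (Poly_Mapping.single m (1 :: 'a))" "b \<in> Poly_Mapping.keys g'"
      | a b where "k = a + b" "a \<in> Poly_Mapping.keys f'" "b \<in> Poly_Mapping.keys g"
      using keys_mult[of "Poly_Mapping.single m (1 :: 'a)" g'] keys_mult[of f' g] by blast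
    then show ?thesis
    proof cases
      case 1
      then show ?thesis using g(2)[of b] by (simp add: wt_add)
    next
      case 2
      then show ?thesis using f(2)[of a] gk[of b] by (simp add: wt_add)
    qed
  qed
  moreover have "f * g = Poly_Mapping.single (m + n) 1 + (Poly_Mapping.single m 1 * g' + f' * g)"
  proof -
    have "f * g = Poly_Mapping.single m 1 * (Poly_Mapping.single n 1 + g') + f' * g"
      unfolding f(1) g(1)[symmetric] by (rule distrib_right)
    then show ?thesis by (simp add: distrib_left mult_single add.assoc)
  qed
  ultimately show ?thesis unfolding has_top_def by blast
qed

lemma has_top_power: "has_top w f m \<Longrightarrow> has_top w (f ^ n) (\<Sum>_<n. m)" for n :: nat
  by (induction n) (auto simp: add.commute[of _ m] intro: has_top_mult)

lemma has_top_prod: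
  "finite S \<Longrightarrow> (\<And>i. i \<in> S \<Longrightarrow> has_top w (f i) (m i)) \<Longrightarrow> has_top w (prod f S) (sum m S)"
  by (induction S rule: finite_induct) (auto intro: has_top_mult)

section \<open>Monomials of Pfaffians as perfect matchings\<close>

definition edge :: "nat \<Rightarrow> nat \<Rightarrow> (nat \<times> nat \<Rightarrow>\<^sub>0 nat)" where
  "edge a b = Poly_Mapping.single (min a b, max a b) 1"

lemma edge_commute: "edge a b = edge b a"
  by (simp add: edge_def min.commute max.commute)

inductive matching :: "nat set \<Rightarrow> (nat \<times> nat \<Rightarrow>\<^sub>0 nat) \<Rightarrow> bool" where
  empty: "matching {} 0"
| insert: "matching S m \<Longrightarrow> a \<notin> S \<Longrightarrow> b \<notin> S \<Longrightarrow> a \<noteq> b \<Longrightarrow> matching (insert a (insert b S)) (edge a b + m)"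

lemma keys_skew_mat: "Poly_Mapping.keys (skew_mat x y :: 'k::field pair_poly) \<subseteq> {edge x y}"
  by (auto simp: skew_mat_def indet_def edge_def split: if_splits)

lemma keys_pf_skew_mat:
  assumes "distinct L" "m \<in> Poly_Mapping.keys (pf skew_mat L :: 'k::field pair_poly)"
  shows "matching (set L) m"
  using assms
proof (induction "length L" arbitrary: L m rule: less_induct)
  case less
  show ?case
  proof (cases L)
    case Nil
    with less.prems show ?thesis by (simp add: matching.empty)
  next
    case (Cons x K)
    let ?H = "{f :: 'k pair_poly. \<forall>m\<in>Poly_Mapping.keys f. matching (set L) m}"
    have "pf skew_mat L \<in> ?H"
      unfolding Cons pf_Cons
    proof (rule contract_closed)
      fix f g :: "'k pair_poly"
      assume "f \<in> {f. \<forall>m\<in>Poly_Mapping.keys f. matching (set (x # K)) m}"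
        "g \<in> {f. \<forall>m\<in>Poly_Mapping.keys f. matching (set (x # K)) m}"
      then show "f - g \<in> {f. \<forall>m\<in>Poly_Mapping.keys f. matching (set (x # K)) m}"
        using keys_diff[of f g] by blast
    next
      fix L1 z L2 assume K: "K = L1 @ z # L2"
      have "matching (set (x # K)) n"
        if n: "n \<in> Poly_Mapping.keys (skew_mat x z * pf skew_mat (L1 @ L2) :: 'k pair_poly)" for n
      proof -
        obtain m' where "n = edge x z + m'" "m' \<in> Poly_Mapping.keys (pf skew_mat (L1 @ L2) :: 'k pair_poly)"
          using n keys_mult[of "skew_mat x z :: 'k pair_poly" "pf skew_mat (L1 @ L2)"] keys_skew_mat[of x z] by blast
        moreover have "matching (set (L1 @ L2)) m'"
          by (rule less.hyps) (use less.prems calculation in \<open>auto simp: Cons K\<close>)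
        moreover have "set (x # K) = insert x (insert z (set (L1 @ L2)))" by (auto simp: K)
        ultimately show ?thesis
          using less.prems by (auto simp: Cons K intro!: matching.insert)
      qed
      then show "skew_mat x z * pf skew_mat (L1 @ L2) \<in> {f :: 'k pair_poly. \<forall>m\<in>Poly_Mapping.keys f. matching (set (x # K)) m}"
        by blast
    qed simp
    with less.prems show ?thesis by blast
  qed
qed

lemma pf_skew_mat_mem: "set L \<subseteq> {..<r} \<Longrightarrow> (pf skew_mat L :: 'k::field pair_poly) \<in> skew_poly_ring r"
proof (induction "length L" arbitrary: L rule: less_induct)
  case less
  show ?case
  proof (cases L)
    case (Cons x K)
    show ?thesis unfolding Cons pf_Cons
    proof (rule contract_closed)
      fix L1 z L2 assume K: "K = L1 @ z # L2"
      have "(pf skew_mat (L1 @ L2) :: 'k pair_poly) \<in> skew_poly_ring r"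
        by (rule less.hyps) (use less.prems in \<open>auto simp: Cons K\<close>)
      moreover have "(skew_mat x z :: 'k pair_poly) \<in> skew_poly_ring r"
        using less.prems by (auto simp: Cons K skew_mat_def skew_poly_ring_indet skew_poly_ring_minus)
      ultimately show "skew_mat x z * pf skew_mat (L1 @ L2) \<in> (skew_poly_ring r :: 'k pair_poly set)"
        by (rule skew_poly_ring_mult[rotated])
    qed (auto intro: skew_poly_ring_diff)
  qed simp
qed

text \<open>The inductive definition adds edges in some order; since they commute, any vertex can be
  assumed to belong to the edge added last.\<close>

lemma matching_pull:
  assumes "matching S m" "x \<in> S"
  shows "\<exists>z m'. z \<in> S \<and> z \<noteq> x \<and> m = edge x z + m' \<and> matching (S - {x, z}) m'"
  using assms
proof induction
  case (insert S m a b)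
  consider "x = a" | "x = b" | "x \<in> S" "x \<noteq> a" "x \<noteq> b" using insert by blast
  then show ?case
  proof cases
    case 1
    moreover from this have "insert a (insert b S) - {x, b} = S" using insert by auto
    ultimately show ?thesis using insert by (intro exI[of _ b] exI[of _ m]) auto
  next
    case 2
    moreover from this have "insert a (insert b S) - {x, a} = S" using insert by auto
    ultimately show ?thesis using insert
      by (intro exI[of _ a] exI[of _ m]) (auto simp: edge_commute)
  next
    case 3
    with insert.IH obtain z m' where z: "z \<in> S" "z \<noteq> x" "m = edge x z + m'" "matching (S - {x, z}) m'" by blast
    have "insert a (insert b S) - {x, z} = insert a (insert b (S - {x, z}))"
      using 3 z insert by auto
    moreover have "matching (insert a (insert b (S - {x, z}))) (edge a b + m')"
      using z insert by (intro matching.insert) auto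
    ultimately show ?thesis using z
      by (intro exI[of _ z] exI[of _ "edge a b + m'"]) (auto simp: add_ac)
  qed
qed simp

text \<open>The order alternates between the two ends, so expansion along the first entry meets the
  outermost pair first.\<close>

fun anti :: "nat \<Rightarrow> nat \<Rightarrow> nat \<Rightarrow> nat list" where
  "anti c i 0 = []"
| "anti c i (Suc n) = i # (c - i) # anti c (Suc i) n"

lemma length_anti [simp]: "length (anti c i n) = 2 * n"
  by (induction n arbitrary: i) auto

lemma set_anti: "2 * (i + n) \<le> Suc c \<Longrightarrow> set (anti c i n) \<subseteq> {i..c - i}"
proof (induction n arbitrary: i)
  case (Suc n)
  then have "set (anti c (Suc i) n) \<subseteq> {Suc i..c - Suc i}" "i \<le> c - i" by simp_all
  moreover have "{Suc i..c - Suc i} \<subseteq> {i..c - i}" by auto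
  ultimately show ?case by auto
qed simp

lemma set_anti_Suc:
  assumes "2 * (i + Suc n) \<le> Suc c"
  shows "set (anti c (Suc i) n) \<subseteq> {i<..<c - i}"
proof -
  have "set (anti c (Suc i) n) \<subseteq> {Suc i..c - Suc i}" by (rule set_anti) (use assms in simp)
  also have "\<dots> \<subseteq> {i<..<c - i}" using assms by auto
  finally show ?thesis .
qed

lemma distinct_anti: "2 * (i + n) \<le> Suc c \<Longrightarrow> distinct (anti c i n)"
proof (induction n arbitrary: i)
  case (Suc n)
  then have "distinct (anti c (Suc i) n)" "i < c - i" by simp_all
  with set_anti_Suc[OF Suc.prems] show ?case by auto
qed simp

text \<open>For this weight nested matchings are the heaviest ones.\<close>

definition sqdist :: "nat \<times> nat \<Rightarrow> int" where
  "sqdist v = (int (fst v) - int (snd v))\<^sup>2"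

lemma wt_edge [simp]: "wt sqdist (edge a b) = (int a - int b)\<^sup>2"
  by (simp add: edge_def sqdist_def power2_commute min_def max_def)

definition anti_mon :: "nat \<Rightarrow> nat \<Rightarrow> nat \<Rightarrow> (nat \<times> nat \<Rightarrow>\<^sub>0 nat)" where
  "anti_mon c i n = (\<Sum>l<n. Poly_Mapping.single (i + l, c - (i + l)) 1)"

lemma anti_mon_Suc:
  assumes "2 * (i + Suc n) \<le> Suc c"
  shows "anti_mon c i (Suc n) = edge i (c - i) + anti_mon c (Suc i) n"
proof -
  have "edge i (c - i) = Poly_Mapping.single (i, c - i) 1" using assms by (simp add: edge_def)
  then show ?thesis unfolding anti_mon_def sum.lessThan_Suc_shift by simp
qed

text \<open>An exchange argument: if \<open>x\<close> and \<open>y\<close> are matched with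
  \<open>z\<close> and \<open>z'\<close>, rematching \<open>x\<close> with \<open>y\<close> and
  \<open>z\<close> with \<open>z'\<close> gains \<open>2 * (z' - x) * (y - z)\<close>, which is
  positive because \<open>S\<close> lies strictly between \<open>x\<close> and
  \<open>y\<close>.\<close>

lemma not_nested_lighter:
  assumes S: "\<And>m. matching S m \<Longrightarrow> wt sqdist m \<le> W" "S \<subseteq> {x<..<y}"
    and z: "z \<in> S" and m: "matching (insert y (S - {z})) m"
  shows "wt sqdist (edge x z + m) < wt sqdist (edge x y) + W"
proof -
  obtain z' m' where z': "z' \<in> insert y (S - {z})" "z' \<noteq> y" "m = edge y z' + m'"
    "matching (insert y (S - {z}) - {y, z'}) m'" using matching_pull[OF m, of y] by blast
  have yS: "y \<notin> S" using S(2) by auto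
  have "insert z (insert z' (S - {z, z'})) = S" using z z' by auto
  moreover have "insert y (S - {z}) - {y, z'} = S - {z, z'}" using yS by auto
  ultimately have "matching S (edge z z' + m')"
    using matching.insert[of "S - {z, z'}" m' z z'] z' by auto
  then have "(int z - int z')\<^sup>2 + wt sqdist m' \<le> W" using S(1) by (fastforce simp: wt_add)
  moreover have "0 < (int z' - int x) * (int y - int z)" using z z' S(2) by (intro mult_pos_pos) auto
  then have "(int x - int z)\<^sup>2 + (int y - int z')\<^sup>2 < (int x - int y)\<^sup>2 + (int z - int z')\<^sup>2"
    by (simp add: power2_eq_square algebra_simps)
  ultimately show ?thesis by (simp add: z' wt_add)
qed

lemma matching_anti_le:
  assumes "2 * (i + n) \<le> Suc c" "matching (set (anti c i n)) m"
  shows "wt sqdist m \<le> wt sqdist (anti_mon c i n)"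
  using assms
proof (induction n arbitrary: i m)
  case 0
  then show ?case by (auto simp: anti_mon_def elim: matching.cases)
next
  case (Suc n)
  let ?S = "set (anti c (Suc i) n)"
  have sub: "?S \<subseteq> {i<..<c - i}" by (rule set_anti_Suc) (rule Suc.prems)
  have ne: "i \<noteq> c - i" using Suc.prems by auto
  have IH: "matching ?S m' \<Longrightarrow> wt sqdist m' \<le> wt sqdist (anti_mon c (Suc i) n)" for m'
    by (rule Suc.IH) (use Suc.prems in auto)
  obtain z m' where z: "z \<in> set (anti c i (Suc n))" "z \<noteq> i" "m = edge i z + m'"
    "matching (set (anti c i (Suc n)) - {i, z}) m'" using matching_pull[OF Suc.prems(2), of i] by auto
  show ?case
  proof (cases "z = c - i")
    case True
    have "set (anti c i (Suc n)) - {i, z} = ?S" using sub True by auto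
    with z IH True show ?thesis by (simp add: anti_mon_Suc[OF Suc.prems(1)] wt_add)
  next
    case False
    with z have zS: "z \<in> ?S" by auto
    have "set (anti c i (Suc n)) - {i, z} = insert (c - i) (?S - {z})" using sub False ne by auto
    with not_nested_lighter[OF IH sub zS, of m'] z show ?thesis
      by (simp add: anti_mon_Suc[OF Suc.prems(1)] wt_add)
  qed
qed

theorem has_top_pf_anti:
  "2 * (i + n) \<le> Suc c \<Longrightarrow> has_top sqdist (pf skew_mat (anti c i n) :: 'k::field pair_poly) (anti_mon c i n)"
proof (induction n arbitrary: i)
  case 0
  then show ?case by (simp add: anti_mon_def)
next
  case (Suc n)
  let ?L = "anti c (Suc i) n"
  let ?m = "anti_mon c i (Suc n)"
  have sub: "set ?L \<subseteq> {i<..<c - i}" by (rule set_anti_Suc) (rule Suc.prems)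
  have n': "2 * (Suc i + n) \<le> Suc c" using Suc.prems by simp
  have "i < c - i" using Suc.prems by simp
  then have "skew_mat i (c - i) = (Poly_Mapping.single (edge i (c - i)) 1 :: 'k pair_poly)"
    by (simp add: skew_mat_def indet_def edge_def)
  then have "has_top sqdist (skew_mat i (c - i) :: 'k pair_poly) (edge i (c - i))"
    unfolding has_top_def by (intro exI[of _ 0]) simp
  from has_top_mult[OF this Suc.IH[OF n']]
  obtain g :: "'k pair_poly" where g: "skew_mat i (c - i) * pf skew_mat ?L = Poly_Mapping.single ?m 1 + g"
    "\<forall>k\<in>Poly_Mapping.keys g. wt sqdist k < wt sqdist ?m"
    unfolding has_top_def anti_mon_Suc[OF Suc.prems] by blast
  \<comment> \<open>The terms that match \<open>i\<close> with an inner vertex instead of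
    \<open>c - i\<close>; by the exchange argument all their monomials are lighter.\<close>
  let ?h = "contract skew_mat i (\<lambda>M. pf skew_mat ((c - i) # M)) ?L :: 'k pair_poly"
  have "?h \<in> {f :: 'k pair_poly. \<forall>k\<in>Poly_Mapping.keys f. wt sqdist k < wt sqdist ?m}" (is "_ \<in> ?H")
  proof (rule contract_closed)
    fix f g :: "'k pair_poly" assume "f \<in> ?H" "g \<in> ?H"
    then show "f - g \<in> ?H" using keys_diff[of f g] by blast
  next
    fix L1 z L2 assume L: "?L = L1 @ z # L2"
    have d: "distinct ?L" by (rule distinct_anti[OF n'])
    have "c - i \<notin> set ?L" using sub by auto
    then have d': "distinct ((c - i) # L1 @ L2)" using d by (auto simp: L)
    have s: "set ((c - i) # L1 @ L2) = insert (c - i) (set ?L - {z})" using d by (auto simp: L)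
    have "wt sqdist k < wt sqdist ?m"
      if k: "k \<in> Poly_Mapping.keys (skew_mat i z * pf skew_mat ((c - i) # L1 @ L2) :: 'k pair_poly)" for k
    proof -
      obtain m' where m': "k = edge i z + m'" "m' \<in> Poly_Mapping.keys (pf skew_mat ((c - i) # L1 @ L2) :: 'k pair_poly)"
        using k keys_mult[of "skew_mat i z :: 'k pair_poly"] keys_skew_mat[of i z] by blast
      from keys_pf_skew_mat[OF d' m'(2)] have "matching (insert (c - i) (set ?L - {z})) m'" unfolding s .
      from not_nested_lighter[OF matching_anti_le[OF n'] sub _ this] show ?thesis
        by (simp add: m' anti_mon_Suc[OF Suc.prems] wt_add L)
    qed
    then show "skew_mat i z * pf skew_mat ((c - i) # L1 @ L2) \<in> ?H" by blast
  qed simp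
  then have "\<forall>k\<in>Poly_Mapping.keys (g - ?h). wt sqdist k < wt sqdist ?m"
    using g(2) keys_diff[of g ?h] by blast
  moreover have "pf skew_mat (anti c i (Suc n)) = Poly_Mapping.single ?m 1 + (g - ?h)"
    using g(1) by (simp add: pf_Cons[of _ i] contract_Cons add_diff_eq)
  ultimately show ?case unfolding has_top_def by blast
qed

section \<open>The trace map\<close>

text \<open>With scalars acting through \<open>a ^ p\<close> the field is a vector space over
  itself. The element 1 is part of a basis, so a linear functional can be prescribed to be 1 on
  it.\<close>

lemma exists_frobenius_splitting:
  assumes "CHAR('k::field) = p" "p > 0"
  shows "\<exists>l :: 'k \<Rightarrow> 'k. (\<forall>x y. l (x + y) = l x + l y) \<and> (\<forall>a x. l (a ^ p * x) = a * l x) \<and> l 1 = 1"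
proof -
  have p: "prime CHAR('k)" using assms prime_CHAR_semidom[where ?'a = 'k] by simp
  interpret V: Vector_Spaces.vector_space "\<lambda>a x :: 'k. a ^ p * x"
    by unfold_locales (auto simp: algebra_simps power_mult_distrib freshmans_dream[OF p] assms(1)[symmetric])
  interpret W: Vector_Spaces.vector_space "(*) :: 'k \<Rightarrow> 'k \<Rightarrow> 'k"
    by unfold_locales (auto simp: algebra_simps)
  interpret VW: vector_space_pair "\<lambda>a x :: 'k. a ^ p * x" "(*) :: 'k \<Rightarrow> 'k \<Rightarrow> 'k" ..
  have ind: "V.independent {1 :: 'k}" by (simp add: V.dependent_single)
  let ?l = "VW.construct {1} (\<lambda>_. 1)"
  have "Vector_Spaces.linear (\<lambda>a x :: 'k. a ^ p * x) (*) ?l" by (rule VW.linear_construct[OF ind])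
  then interpret L: Vector_Spaces.linear "\<lambda>a x :: 'k. a ^ p * x" "(*)" ?l .
  show ?thesis
    using L.add L.scale VW.construct_basis[OF ind, of 1 "\<lambda>_. 1"] by (intro exI[of _ ?l]) auto
qed

definition all_vars :: "nat \<Rightarrow> (nat \<times> nat \<Rightarrow>\<^sub>0 nat)" where
  "all_vars r = (\<Sum>v\<in>vars r. Poly_Mapping.single v 1)"

lemma finite_vars [simp]: "finite (vars r)"
  by (rule finite_subset[of _ "{..<r} \<times> {..<r}"]) auto

lemma lookup_all_vars: "Poly_Mapping.lookup (all_vars r) v = (if v \<in> vars r then 1 else 0)"
  by (simp add: all_vars_def lookup_sum lookup_single when_def)

text \<open>\<open>pth_exp p r n k\<close> says that \<open>z\<^sup>n\<close> is the \<open>p\<close>-th power of \<open>z\<^sup>k\<close> times the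
  \<open>(p - 1)\<close>-st power of the product of all variables.\<close>

definition pth_exp :: "nat \<Rightarrow> nat \<Rightarrow> (nat \<times> nat \<Rightarrow>\<^sub>0 nat) \<Rightarrow> (nat \<times> nat \<Rightarrow>\<^sub>0 nat) \<Rightarrow> bool" where
  "pth_exp p r n k \<longleftrightarrow> n = (\<Sum>_<p. k) + (\<Sum>_<p - 1. all_vars r)"

lemma lookup_multiple: "Poly_Mapping.lookup (\<Sum>_<n. m) v = n * Poly_Mapping.lookup m v"
  for m :: "'v \<Rightarrow>\<^sub>0 nat"
  by (simp add: lookup_sum)

lemma pth_exp_unique: "p > 0 \<Longrightarrow> pth_exp p r n k \<Longrightarrow> pth_exp p r n k' \<Longrightarrow> k = k'"
proof (rule poly_mapping_eqI)
  fix v assume "p > 0" "pth_exp p r n k" "pth_exp p r n k'"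
  then have "(\<Sum>_<p. k) = (\<Sum>_<p. k')" by (simp add: pth_exp_def)
  from arg_cong[OF this, of "\<lambda>m. Poly_Mapping.lookup m v"] \<open>p > 0\<close>
  show "Poly_Mapping.lookup k v = Poly_Mapping.lookup k' v" by (simp only: lookup_multiple) simp
qed

lemma pth_exp_shift: "pth_exp p r n k \<Longrightarrow> pth_exp p r ((\<Sum>_<p. m) + n) (m + k)"
  by (simp add: pth_exp_def sum.distrib add_ac)

text \<open>In each variable \<open>p * m \<le> p * k' + (p - 1)\<close> forces
  \<open>m \<le> k'\<close>, so \<open>m\<close> can be subtracted from \<open>k'\<close>.\<close>

lemma pth_exp_unshift:
  assumes "p > 0" "pth_exp p r ((\<Sum>_<p. m) + n) k'"
  shows "\<exists>k. pth_exp p r n k"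
proof -
  have le: "Poly_Mapping.lookup m v \<le> Poly_Mapping.lookup k' v" for v
  proof -
    have "p * Poly_Mapping.lookup m v + Poly_Mapping.lookup n v =
        p * Poly_Mapping.lookup k' v + (p - 1) * Poly_Mapping.lookup (all_vars r) v"
      using arg_cong[OF assms(2)[unfolded pth_exp_def], of "\<lambda>m. Poly_Mapping.lookup m v"]
      by (simp only: lookup_add lookup_multiple)
    also have "\<dots> \<le> p * Poly_Mapping.lookup k' v + (p - 1)" by (simp add: lookup_all_vars)
    finally have "p * Poly_Mapping.lookup m v < p * Suc (Poly_Mapping.lookup k' v)" using assms(1) by simp
    then show ?thesis by (metis less_Suc_eq_le mult_less_cancel1)
  qed
  have "k' = m + (k' - m)"
    by (rule poly_mapping_eqI) (use le in \<open>simp add: lookup_add lookup_minus\<close>)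
  then have "(\<Sum>_<p. m) + n = (\<Sum>_<p. m + (k' - m)) + (\<Sum>_<p - 1. all_vars r)"
    using assms(2) by (simp add: pth_exp_def)
  then show ?thesis by (intro exI[of _ "k' - m"]) (simp add: pth_exp_def sum.distrib add.assoc)
qed

context
  fixes p r :: nat and \<Lambda> :: "'k::field \<Rightarrow> 'k"
  assumes char: "CHAR('k) = p" and p_pos: "p > 0"
    and \<Lambda>_add: "\<Lambda> (x + y) = \<Lambda> x + \<Lambda> y" and \<Lambda>_mult: "\<Lambda> (a ^ p * x) = a * \<Lambda> x" and \<Lambda>_one: "\<Lambda> 1 = 1"
begin

lemma prime_char: "prime p"
  using prime_CHAR_semidom[where ?'a = 'k] char p_pos by simp

lemma CHAR_pair_poly: "CHAR('k pair_poly) = p"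
proof (rule CHAR_eqI)
  show "of_nat p = (0 :: 'k pair_poly)"
    using of_nat_CHAR[where ?'a = 'k] by (simp add: char flip: single_of_nat)
  show "p dvd n" if "of_nat n = (0 :: 'k pair_poly)" for n
    using that of_nat_eq_0_iff_char_dvd[where ?'a = 'k, of n] unfolding char
    by (metis lookup_single_eq lookup_zero single_of_nat)
qed

lemma \<Lambda>_zero: "\<Lambda> 0 = 0"
  using \<Lambda>_mult[of 0 0] by simp

text \<open>Over the polynomials in the \<open>p\<close>-th powers of the variables, K[Z] is free on
  the monomials with exponents below \<open>p\<close>. This is the coordinate at the largest of
  them, with the variables replaced by their roots and \<open>\<Lambda>\<close> applied to the
  coefficients.\<close>

definition trace_map :: "'k pair_poly \<Rightarrow> 'k pair_poly" where
  "trace_map = lin_ext (\<lambda>n c. if \<exists>k. pth_exp p r n k then Poly_Mapping.single (THE k. pth_exp p r n k) (\<Lambda> c) else 0)"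

lemma trace_map_zero [simp]: "trace_map 0 = 0"
  by (simp add: trace_map_def)

lemma trace_map_add: "trace_map (f + g) = trace_map f + trace_map g"
  unfolding trace_map_def by (rule lin_ext_add) (auto simp: \<Lambda>_add \<Lambda>_zero single_add)

lemma trace_map_single:
  "pth_exp p r n k \<Longrightarrow> trace_map (Poly_Mapping.single n c) = Poly_Mapping.single k (\<Lambda> c)"
  "\<nexists>k. pth_exp p r n k \<Longrightarrow> trace_map (Poly_Mapping.single n c) = 0"
proof -
  have *: "trace_map (Poly_Mapping.single n c) =
      (if \<exists>k. pth_exp p r n k then Poly_Mapping.single (THE k. pth_exp p r n k) (\<Lambda> c) else 0)"
    unfolding trace_map_def by (rule lin_ext_single) (simp add: \<Lambda>_zero)
  show "trace_map (Poly_Mapping.single n c) = Poly_Mapping.single k (\<Lambda> c)" if "pth_exp p r n k"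
  proof -
    have "(THE k. pth_exp p r n k) = k" using that pth_exp_unique[OF p_pos] by blast
    then show ?thesis unfolding * using that by auto
  qed
  show "trace_map (Poly_Mapping.single n c) = 0" if "\<nexists>k. pth_exp p r n k"
    by (simp only: * that if_False)
qed

lemma trace_map_single_mult:
  "trace_map (Poly_Mapping.single m c ^ p * Poly_Mapping.single n d) =
    Poly_Mapping.single m c * trace_map (Poly_Mapping.single n d)"
proof (cases "\<exists>k. pth_exp p r n k")
  case True
  then obtain k where k: "pth_exp p r n k" by blast
  show ?thesis
    by (simp only: single_power mult_single trace_map_single(1)[OF k] trace_map_single(1)[OF pth_exp_shift[OF k]] \<Lambda>_mult)
next
  case False
  then have "\<nexists>k. pth_exp p r ((\<Sum>_<p. m) + n) k" using pth_exp_unshift[OF p_pos] by blast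
  then have "trace_map (Poly_Mapping.single ((\<Sum>_<p. m) + n) (c ^ p * d)) = 0"
    by (rule trace_map_single(2))
  moreover have "trace_map (Poly_Mapping.single n d) = 0" using False by (rule trace_map_single(2))
  ultimately show ?thesis by (simp only: single_power mult_single mult_zero_right)
qed

lemma pair_poly_add_power: "(f + g) ^ p = f ^ p + (g :: 'k pair_poly) ^ p"
  by (rule freshmans_dream) (simp_all only: CHAR_pair_poly prime_char)

lemma trace_map_mult: "trace_map (q ^ p * f) = q * trace_map f"
proof (induction q rule: poly_mapping_additive_induct)
  case zero
  then show ?case using p_pos by (simp add: power_0_left)
next
  case (single m)
  show ?case
  proof (induction f rule: poly_mapping_additive_induct)
    case (single n)
    show ?case by (rule trace_map_single_mult)
  qed (auto simp: trace_map_add distrib_left)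
next
  case (add g h)
  then show ?case by (simp add: pair_poly_add_power distrib_right trace_map_add)
qed

lemma trace_map_mem:
  assumes "f \<in> skew_poly_ring r"
  shows "trace_map f \<in> skew_poly_ring r"
proof -
  have "trace_map (Poly_Mapping.single n c) \<in> skew_poly_ring r" if "Poly_Mapping.keys n \<subseteq> vars r" for n c
  proof (cases "\<exists>k. pth_exp p r n k")
    case True
    then obtain k where k: "pth_exp p r n k" by blast
    have "Poly_Mapping.lookup n v = p * Poly_Mapping.lookup k v + (p - 1) * Poly_Mapping.lookup (all_vars r) v" for v
      using k by (simp only: pth_exp_def lookup_add lookup_multiple)
    then have "Poly_Mapping.keys k \<subseteq> Poly_Mapping.keys n" using p_pos by (auto simp: in_keys_iff)
    with that show ?thesis by (auto simp: trace_map_single(1)[OF k] skew_poly_ring_def)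
  qed (simp add: trace_map_single(2))
  note * = this
  show ?thesis
  proof (induction f rule: poly_mapping_additive_induct)
    case (single m)
    show ?case by (rule *) (rule skew_poly_ringD[OF assms single])
  qed (auto simp: trace_map_add skew_poly_ring_add)
qed

lemma wt_nonneg: "(\<And>v. 0 \<le> w v) \<Longrightarrow> 0 \<le> wt w m"
  by (simp add: wt_def sum_nonneg)

text \<open>An exponent seen by the trace is a multiple of \<open>p\<close> plus the leading
  exponent of \<open>f ^ (p - 1)\<close>; as weights are nonnegative, it is at least as heavy as the
  latter. So all lighter terms are killed.\<close>

lemma trace_map_top:
  assumes "has_top w f (all_vars r)" "\<And>v. 0 \<le> w v"
  shows "trace_map (f ^ (p - 1)) = 1"
proof -
  let ?M = "\<Sum>_<p - 1. all_vars r"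
  obtain g where g: "f ^ (p - 1) = Poly_Mapping.single ?M 1 + g"
    "\<And>k. k \<in> Poly_Mapping.keys g \<Longrightarrow> wt w k < wt w ?M"
    using has_top_power[OF assms(1), of "p - 1"] unfolding has_top_def by blast
  have "trace_map g = 0"
  proof (induction g rule: poly_mapping_additive_induct)
    case (single n)
    have "\<not> pth_exp p r n k" for k
    proof
      assume "pth_exp p r n k"
      then have "wt w n = (\<Sum>_<p. wt w k) + wt w ?M" by (simp only: pth_exp_def wt_add wt_sum)
      moreover have "0 \<le> (\<Sum>_<p. wt w k)" by (intro sum_nonneg wt_nonneg assms(2))
      ultimately show False using g(2)[OF single] by simp
    qed
    then show ?case by (simp add: trace_map_single(2))
  qed (auto simp: trace_map_add)
  moreover have "pth_exp p r ?M 0" by (simp add: pth_exp_def)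
  then have "trace_map (Poly_Mapping.single ?M 1) = 1" by (simp only: trace_map_single(1) \<Lambda>_one single_one)
  ultimately show ?thesis unfolding g(1) trace_map_add by simp
qed

end

lemma prod_list_extract_power:
  fixes Y :: "'a::comm_monoid_mult set"
  assumes "finite Y" "set l \<subseteq> Y" "card Y * (p - 1) < length l"
  shows "\<exists>y\<in>Y. \<exists>k. set k \<subseteq> Y \<and> length k + p = length l \<and> prod_list l = y ^ p * prod_list k"
proof -
  have "\<exists>y\<in>Y. p \<le> count_list l y"
  proof (rule ccontr)
    assume "\<not> ?thesis"
    then have "count_list l y \<le> p - 1" if "y \<in> Y" for y using that by fastforce
    then have "(\<Sum>y\<in>Y. count_list l y) \<le> (\<Sum>y\<in>Y. p - 1)" by (rule sum_mono)
    with sum_count_set[OF assms(2,1)] assms(3) show False by simp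
  qed
  then obtain y where y: "y \<in> Y" "p \<le> count_list l y" by blast
  let ?f = "filter (\<lambda>x. x \<noteq> y) l"
  have "prod_list l = y ^ count_list l y * prod_list ?f \<and> count_list l y + length ?f = length l"
    by (induction l) (auto simp: mult_ac)
  then have "prod_list l = y ^ p * prod_list (replicate (count_list l y - p) y @ ?f)"
    "length (replicate (count_list l y - p) y @ ?f) + p = length l"
    using y(2) by (auto simp: prod_list_replicate mult.assoc[symmetric] simp flip: power_add)
  moreover have "set (replicate (count_list l y - p) y @ ?f) \<subseteq> Y" using y(1) assms(2) by auto
  ultimately show ?thesis using y(1) by blast
qed

text \<open>Each extraction shortens the list by \<open>p\<close>, and the last of the
  \<open>n + 1\<close> extractions still needs more than \<open>card Y * (p - 1)\<close> factors;
  hence the bound.\<close>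

lemma prod_list_pth_powers:
  fixes Y :: "'a::comm_monoid_mult set"
  assumes "finite Y" "set l \<subseteq> Y" "card Y * (p - 1) + n * p < length l"
  shows "\<exists>c k. length k = Suc n \<and> set k \<subseteq> Y \<and> prod_list l = c * prod_list k ^ p"
  using assms(2,3)
proof (induction n arbitrary: l)
  case 0
  then have "card Y * (p - 1) < length l" by simp
  from prod_list_extract_power[OF assms(1) 0(1) this] obtain y k
    where y: "y \<in> Y" "prod_list l = y ^ p * prod_list k" by blast
  show ?case unfolding y(2)
    by (intro exI[of _ "prod_list k"] exI[of _ "[y]"]) (simp add: y(1) mult.commute)
next
  case (Suc n)
  then have "card Y * (p - 1) < length l" by simp
  from prod_list_extract_power[OF assms(1) Suc.prems(1) this] obtain y k
    where y: "y \<in> Y" "set k \<subseteq> Y" "length k + p = length l" "prod_list l = y ^ p * prod_list k" by blast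
  with Suc.prems have "card Y * (p - 1) + n * p < length k" by simp
  from Suc.IH[OF y(2) this] obtain c k' where
    k': "length k' = Suc n" "set k' \<subseteq> Y" "prod_list k = c * prod_list k' ^ p" by blast
  show ?case unfolding y(4) k'(3)
    by (intro exI[of _ c] exI[of _ "y # k'"])
      (simp add: y(1) k'(1,2) power_mult_distrib mult.left_commute)
qed

section \<open>Symbolic powers of Pfaffian ideals\<close>

lemma (in cring) idealI_module:
  assumes "I \<subseteq> carrier R" "\<zero> \<in> I" "\<And>x y. x \<in> I \<Longrightarrow> y \<in> I \<Longrightarrow> x \<oplus> y \<in> I"
    and "\<And>c x. c \<in> carrier R \<Longrightarrow> x \<in> I \<Longrightarrow> c \<otimes> x \<in> I"
  shows "ideal I R"
proof (rule idealI)
  show "ring R" by (rule ring_axioms)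
  show "subgroup I (add_monoid R)"
  proof (rule add.subgroupI)
    fix x assume x: "x \<in> I"
    then have "\<ominus> x = (\<ominus> \<one>) \<otimes> x" using assms(1) l_minus[of \<one> x] by auto
    with x assms(4)[of "\<ominus> \<one>" x] show "\<ominus> x \<in> I" by simp
  qed (use assms in auto)
  show "c \<otimes> x \<in> I" if "x \<in> I" "c \<in> carrier R" for x c using that assms(4) by blast
  show "x \<otimes> c \<in> I" if "x \<in> I" "c \<in> carrier R" for x c
    using that assms(4)[of c x] assms(1) m_comm[of x c] by auto
qed

lemma (in cring) ideal_pow:
  assumes "ideal I R"
  shows "ideal (I [^]\<^bsub>ideals_set R\<^esub> (n :: nat)) R"
proof (induction n)
  case 0
  then show ?case by (simp add: nat_pow_def ideals_set_def oneideal)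
next
  case (Suc n)
  have "I [^]\<^bsub>ideals_set R\<^esub> Suc n = ideal_prod R (I [^]\<^bsub>ideals_set R\<^esub> n) I"
    by (simp add: nat_pow_def ideals_set_def)
  then show ?case using ideal_prod_is_ideal[OF Suc assms] by simp
qed

text \<open>Fractions with numerator in \<open>J\<close> already form an ideal of the localisation,
  so the extended ideal contains nothing else.\<close>

lemma (in cring) localization_ideal_iff:
  assumes S: "S \<subseteq> carrier R" "\<one> \<in> S" "\<And>s t. s \<in> S \<Longrightarrow> t \<in> S \<Longrightarrow> s \<otimes> t \<in> S"
    and J: "ideal J R" and f: "f \<in> carrier R"
  shows "loc_frac R S f \<one> \<in> Idl\<^bsub>localization R S\<^esub> ((\<lambda>a. loc_frac R S a \<one>) ` J) \<longleftrightarrow> (\<exists>s\<in>S. s \<otimes> f \<in> J)"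
proof -
  interpret J: ideal J R by fact
  interpret L: cring "localization R S" by (rule localization_cring) (use S in blast)+
  have carrier: "carrier (localization R S) = {loc_frac R S a s |a s. a \<in> carrier R \<and> s \<in> S}"
    by (rule loc_carrier) (use S in blast)+
  have zero: "\<zero>\<^bsub>localization R S\<^esub> = loc_frac R S \<zero> \<one>"
    by (rule loc_zero) (use S in blast)+
  have frac_eq: "loc_frac R S a s = loc_frac R S b t \<longleftrightarrow> (\<exists>u\<in>S. u \<otimes> (a \<otimes> t) = u \<otimes> (b \<otimes> s))"
    if "a \<in> carrier R" "b \<in> carrier R" "s \<in> S" "t \<in> S" for a b s t
    by (rule loc_frac_eq_iff) (use S that in blast)+
  have mult: "loc_frac R S a s \<otimes>\<^bsub>localization R S\<^esub> loc_frac R S b t = loc_frac R S (a \<otimes> b) (s \<otimes> t)"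
    if "a \<in> carrier R" "b \<in> carrier R" "s \<in> S" "t \<in> S" for a b s t
    by (rule loc_mult) (use S that in blast)+
  have add: "loc_frac R S a s \<oplus>\<^bsub>localization R S\<^esub> loc_frac R S b t =
      loc_frac R S (a \<otimes> t \<oplus> b \<otimes> s) (s \<otimes> t)"
    if "a \<in> carrier R" "b \<in> carrier R" "s \<in> S" "t \<in> S" for a b s t
    by (rule loc_add) (use S that in blast)+
  have mem: "loc_frac R S a s \<in> carrier (localization R S)" if "a \<in> carrier R" "s \<in> S" for a s
    unfolding carrier using that by blast
  have sub: "(\<lambda>a. loc_frac R S a \<one>) ` J \<subseteq> carrier (localization R S)"
    by (rule image_subsetI) (rule mem[OF J.Icarr S(2)])
  let ?T = "{loc_frac R S a s |a s. a \<in> J \<and> s \<in> S}"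
  have Sc: "s \<in> carrier R" if "s \<in> S" for s using S(1) that by auto
  have "ideal ?T (localization R S)"
  proof (rule L.idealI_module)
    show "?T \<subseteq> carrier (localization R S)" using mem[OF J.Icarr] by blast
    show "\<zero>\<^bsub>localization R S\<^esub> \<in> ?T"
      unfolding zero using S(2) J.zero_closed by blast
  next
    fix x y assume "x \<in> ?T" "y \<in> ?T"
    then obtain a s b t where *: "x = loc_frac R S a s" "y = loc_frac R S b t" "a \<in> J" "b \<in> J" "s \<in> S" "t \<in> S"
      by blast
    have "a \<otimes> t \<oplus> b \<otimes> s \<in> J"
      using * Sc by (intro J.a_closed J.I_r_closed) auto
    moreover have "s \<otimes> t \<in> S" using * S(3) by blast
    ultimately show "x \<oplus>\<^bsub>localization R S\<^esub> y \<in> ?T"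
      unfolding *(1,2) add[OF J.Icarr[OF *(3)] J.Icarr[OF *(4)] *(5,6)] by blast
  next
    fix c x assume "c \<in> carrier (localization R S)" "x \<in> ?T"
    then obtain a s b t where *: "c = loc_frac R S a s" "x = loc_frac R S b t" "a \<in> carrier R" "b \<in> J" "s \<in> S" "t \<in> S"
      unfolding carrier by blast
    have "a \<otimes> b \<in> J" using * by (intro J.I_l_closed) auto
    moreover have "s \<otimes> t \<in> S" using * S(3) by blast
    ultimately show "c \<otimes>\<^bsub>localization R S\<^esub> x \<in> ?T"
      unfolding *(1,2) mult[OF *(3) J.Icarr[OF *(4)] *(5,6)] by blast
  qed
  moreover have "(\<lambda>a. loc_frac R S a \<one>) ` J \<subseteq> ?T" using S(2) by blast
  ultimately have min: "Idl\<^bsub>localization R S\<^esub> ((\<lambda>a. loc_frac R S a \<one>) ` J) \<subseteq> ?T"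
    by (rule L.genideal_minimal)
  show ?thesis
  proof
    assume "loc_frac R S f \<one> \<in> Idl\<^bsub>localization R S\<^esub> ((\<lambda>a. loc_frac R S a \<one>) ` J)"
    with min obtain a s where a: "loc_frac R S f \<one> = loc_frac R S a s" "a \<in> J" "s \<in> S" by blast
    then obtain u where u: "u \<in> S" "u \<otimes> (f \<otimes> s) = u \<otimes> (a \<otimes> \<one>)"
      using frac_eq[OF f J.Icarr[OF a(2)] S(2) a(3)] by blast
    have "(u \<otimes> s) \<otimes> f = u \<otimes> (f \<otimes> s)" using Sc u a f by (simp add: m_ac)
    also have "\<dots> = u \<otimes> a" using u a J.Icarr by simp
    also have "\<dots> \<in> J" using u a Sc by (intro J.I_l_closed) auto
    finally show "\<exists>s\<in>S. s \<otimes> f \<in> J" using u a S(3) by blast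
  next
    assume "\<exists>s\<in>S. s \<otimes> f \<in> J"
    then obtain s where s: "s \<in> S" "s \<otimes> f \<in> J" by blast
    interpret I: ideal "Idl\<^bsub>localization R S\<^esub> ((\<lambda>a. loc_frac R S a \<one>) ` J)" "localization R S"
      by (rule L.genideal_ideal[OF sub])
    have "loc_frac R S (s \<otimes> f) \<one> \<in> Idl\<^bsub>localization R S\<^esub> ((\<lambda>a. loc_frac R S a \<one>) ` J)"
      using L.genideal_self[OF sub] s by blast
    moreover have "loc_frac R S \<one> s \<in> carrier (localization R S)" using s(1) by (intro mem) auto
    ultimately have "loc_frac R S \<one> s \<otimes>\<^bsub>localization R S\<^esub> loc_frac R S (s \<otimes> f) \<one>
        \<in> Idl\<^bsub>localization R S\<^esub> ((\<lambda>a. loc_frac R S a \<one>) ` J)" by (rule I.I_l_closed)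
    also have "loc_frac R S \<one> s \<otimes>\<^bsub>localization R S\<^esub> loc_frac R S (s \<otimes> f) \<one> = loc_frac R S (\<one> \<otimes> (s \<otimes> f)) (s \<otimes> \<one>)"
      using s Sc f S(2) by (intro mult) auto
    also have "\<dots> = loc_frac R S f \<one>"
      using s Sc f S by (subst frac_eq) (auto simp: m_comm intro!: bexI[of _ "\<one>"])
    finally show "loc_frac R S f \<one> \<in> Idl\<^bsub>localization R S\<^esub> ((\<lambda>a. loc_frac R S a \<one>) ` J)" .
  qed
qed

lemma (in cring) symbolic_power_iff:
  assumes "ideal I R"
  shows "f \<in> symbolic_power R I n \<longleftrightarrow> f \<in> carrier R \<and>
    (\<exists>s\<in>carrier R - \<Union>(minimal_primes R I). s \<otimes> f \<in> I [^]\<^bsub>ideals_set R\<^esub> n)"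
proof -
  let ?S = "carrier R - \<Union>(minimal_primes R I)"
  have one: "\<one> \<notin> Q" if "Q \<in> minimal_primes R I" for Q
    using that ideal.one_imp_carrier[of Q R] primeideal.I_notcarr[of Q R] primeideal.axioms(1)[of Q R]
    by (auto simp: minimal_primes_def)
  have mult: "s \<in> Q \<or> t \<in> Q" if "Q \<in> minimal_primes R I" "s \<in> carrier R" "t \<in> carrier R" "s \<otimes> t \<in> Q" for Q s t
    using that primeideal.I_prime[of Q R s t] by (auto simp: minimal_primes_def)
  have S: "?S \<subseteq> carrier R" "\<one> \<in> ?S" "\<And>s t. s \<in> ?S \<Longrightarrow> t \<in> ?S \<Longrightarrow> s \<otimes> t \<in> ?S"
  proof -
    show "?S \<subseteq> carrier R" by blast
    show "\<one> \<in> ?S" using one by blast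
    show "s \<otimes> t \<in> ?S" if "s \<in> ?S" "t \<in> ?S" for s t
      using that mult[of _ s t] by blast
  qed
  show ?thesis
    unfolding symbolic_power_def Let_def
    using localization_ideal_iff[OF _ _ _ ideal_pow[OF assms], of ?S f n] S by blast
qed

section \<open>Ideals of K[Z] and of the ambient ring\<close>

lemma subring_of_simps [simp]:
  "carrier (subring_of A) = A" "x \<otimes>\<^bsub>subring_of A\<^esub> y = x * y" "x \<oplus>\<^bsub>subring_of A\<^esub> y = x + y"
  "\<one>\<^bsub>subring_of A\<^esub> = 1" "\<zero>\<^bsub>subring_of A\<^esub> = 0"
  by (simp_all add: subring_of_def ring_of_type_algebra_def)

abbreviation skew_ring :: "nat \<Rightarrow> 'k::field pair_poly ring" where
  "skew_ring r \<equiv> subring_of (skew_poly_ring r)"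

lemma ideal_skew_ringI:
  fixes I :: "'k::field pair_poly set"
  assumes "I \<subseteq> skew_poly_ring r" "0 \<in> I" "\<And>x y. x \<in> I \<Longrightarrow> y \<in> I \<Longrightarrow> x + y \<in> I"
    and "\<And>c x. c \<in> skew_poly_ring r \<Longrightarrow> x \<in> I \<Longrightarrow> c * x \<in> I"
  shows "ideal I (skew_ring r)"
  using cring.idealI_module[OF skew_poly_ring_cring, of I r] assms by simp

lemma ideal_skew_ringD:
  fixes I :: "'k::field pair_poly set"
  assumes "ideal I (skew_ring r)"
  shows "I \<subseteq> skew_poly_ring r" "0 \<in> I" "\<And>x y. x \<in> I \<Longrightarrow> y \<in> I \<Longrightarrow> x + y \<in> I"
    and "\<And>c x. c \<in> skew_poly_ring r \<Longrightarrow> x \<in> I \<Longrightarrow> c * x \<in> I"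
proof -
  interpret ideal I "skew_ring r" by fact
  show "I \<subseteq> skew_poly_ring r" using a_subset by simp
  show "0 \<in> I" using additive_subgroup.zero_closed[OF additive_subgroup_axioms] by simp
  show "x + y \<in> I" if "x \<in> I" "y \<in> I" for x y using additive_subgroup.a_closed[OF additive_subgroup_axioms that] by simp
  show "c * x \<in> I" if "c \<in> skew_poly_ring r" "x \<in> I" for c x using I_l_closed[OF that(2), of c] that(1) by simp
qed

lemma prime_set_retract:
  fixes Q :: "'k::field pair_poly set"
  assumes "primeideal Q (skew_ring r)"
  shows "prime_set {f. retract r f \<in> Q}"
proof -
  interpret primeideal Q "skew_ring r" by fact
  note Q = ideal_skew_ringD[OF ideal_axioms]
  show ?thesis
  proof
    fix x y c :: "'k pair_poly"
    show "0 \<in> {f. retract r f \<in> Q}" using Q(2) by (simp add: retract_zero)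
    show "x + y \<in> {f. retract r f \<in> Q}" if "x \<in> {f. retract r f \<in> Q}" "y \<in> {f. retract r f \<in> Q}"
      using that Q(3) by (simp add: retract_add)
    show "c * x \<in> {f. retract r f \<in> Q}" if "x \<in> {f. retract r f \<in> Q}"
      using that Q(4) by (simp add: retract_mult retract_mem)
    show "1 \<notin> {f. retract r f \<in> Q}"
      using one_imp_carrier I_notcarr by (auto simp: retract_one)
    show "x \<in> {f. retract r f \<in> Q} \<or> y \<in> {f. retract r f \<in> Q}" if "x * y \<in> {f. retract r f \<in> Q}"
      using that I_prime[of "retract r x" "retract r y"] by (simp add: retract_mult retract_mem)
  qed
qed

section \<open>Generators of the Pfaffian ideal\<close>

lemma gram_pick:
  assumes "J \<subseteq> {0..<r}"
  shows "submatrix (generic_skew r) J J = gram skew_mat (map (pick J) [0..<card J])"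
proof -
  have rows: "{i. i < dim_row (generic_skew r) \<and> i \<in> J} = J"
    and cols: "{i. i < dim_col (generic_skew r) \<and> i \<in> J} = J"
    using assms by (auto simp: generic_skew_def)
  have pick: "pick J i < r" if "i < card J" for i using pick_in_set_le[OF that] assms by auto
  show ?thesis
  proof (rule eq_matI)
    fix i j assume "i < dim_row (gram skew_mat (map (pick J) [0..<card J]))"
      "j < dim_col (gram skew_mat (map (pick J) [0..<card J]))"
    then have ij: "i < card J" "j < card J" by (simp_all add: gram_def)
    have "submatrix (generic_skew r) J J $$ (i, j) = generic_skew r $$ (pick J i, pick J j)"
      by (rule submatrix_index) (simp_all only: rows cols ij)
    also have "\<dots> = skew_mat (pick J i) (pick J j)"
      using pick[OF ij(1)] pick[OF ij(2)] by (simp add: generic_skew_def skew_mat_def)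
    finally show "submatrix (generic_skew r) J J $$ (i, j) = gram skew_mat (map (pick J) [0..<card J]) $$ (i, j)"
      using ij by (simp add: gram_def)
  qed (simp_all only: dim_submatrix rows cols gram_def dim_row_mat dim_col_mat length_map length_upt diff_zero)
qed

lemma distinct_pick: "distinct (map (pick J) [0..<card J])"
proof -
  have "inj_on (pick J) {0..<card J}"
  proof (rule inj_onI)
    fix m n assume mn: "m \<in> {0..<card J}" "n \<in> {0..<card J}" and eq: "pick J m = pick J n"
    have "m = card {a \<in> J. a < pick J m}" by (rule card_pick_le[symmetric]) (use mn in simp)
    also have "\<dots> = n" unfolding eq by (rule card_pick_le) (use mn in simp)
    finally show "m = n" .
  qed
  then show ?thesis unfolding distinct_map set_upt by simp
qed

lemma set_pick: "finite J \<Longrightarrow> set (map (pick J) [0..<card J]) = J"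
  using distinct_card[OF distinct_pick, of J] pick_in_set_le by (intro card_subset_eq) auto

lemma pfaffians_eq_pf:
  assumes "f \<in> pfaffians r k"
  shows "\<exists>L. set L \<subseteq> {..<r} \<and> length L = k \<and> (f = pf skew_mat L \<or> f = - pf skew_mat L)"
proof -
  obtain J where J: "J \<subseteq> {0..<r}" "card J = k" "f\<^sup>2 = det (submatrix (generic_skew r) J J)"
    using assms by (auto simp: pfaffians_def)
  let ?L = "map (pick J) [0..<card J]"
  have "finite J" using J(1) finite_subset by blast
  then have L: "set ?L \<subseteq> {..<r}" using set_pick[of J] J(1) by auto
  have "f\<^sup>2 = (pf skew_mat ?L)\<^sup>2"
    unfolding J(3) gram_pick[OF J(1)] by (rule pf_square[OF alternating_skew_mat L, symmetric])
  with L J(2) show ?thesis by (intro exI[of _ ?L]) (auto simp: power2_eq_iff)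
qed

lemma pf_mem_pfaffians:
  assumes "distinct L" "set L \<subseteq> {..<r}"
  shows "pf skew_mat L \<in> pfaffians r (length L)"
proof -
  interpret alternating "skew_mat :: nat \<Rightarrow> nat \<Rightarrow> 'a pair_poly" by (rule alternating_skew_mat)
  let ?J = "set L" and ?L = "map (pick (set L)) [0..<card (set L)]"
  have J: "?J \<subseteq> {0..<r}" using assms(2) by auto
  have "mset L = mset ?L"
    using assms(1) distinct_pick set_pick[of ?J] by (intro set_eq_iff_mset_eq_distinct[THEN iffD1]) auto
  from pf_perm[OF this, of "[]"] have "(pf skew_mat L :: 'a pair_poly)\<^sup>2 = (pf skew_mat ?L)\<^sup>2" by auto
  also have "\<dots> = det (submatrix (generic_skew r) ?J ?J)"
    unfolding gram_pick[OF J] by (rule pf_square[OF alternating_skew_mat]) (use set_pick[of ?J] assms(2) in auto)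
  finally show ?thesis
    using J pf_skew_mat_mem[OF assms(2)] distinct_card[OF assms(1)] by (auto simp: pfaffians_def)
qed

lemma pfaffians_subset: "pfaffians r k \<subseteq> skew_poly_ring r"
  by (auto simp: pfaffians_def)

lemma ideal_pfaffian_ideal: "ideal (pfaffian_ideal r k :: 'k::field pair_poly set) (skew_ring r)"
  unfolding pfaffian_ideal_def
  by (rule ring.genideal_ideal[OF cring.axioms(1)[OF skew_poly_ring_cring]]) (simp add: pfaffians_subset)

lemma pf_mem_pfaffian_ideal:
  assumes "set L \<subseteq> {..<r}"
  shows "(pf skew_mat L :: 'k::field pair_poly) \<in> pfaffian_ideal r (length L)"
proof (cases "distinct L")
  case True
  from ring.genideal_self[OF cring.axioms(1)[OF skew_poly_ring_cring], of "pfaffians r (length L)" r]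
  show ?thesis using pf_mem_pfaffians[OF True assms] pfaffians_subset unfolding pfaffian_ideal_def by auto
next
  case False
  then show ?thesis
    using alternating.pf_repeat[OF alternating_skew_mat] ideal_skew_ringD(2)[OF ideal_pfaffian_ideal] by metis
qed

lemma pfaffian_ideal_minimal:
  fixes I :: "'k::field pair_poly set"
  assumes "ideal I (skew_ring r)" "pfaffians r k \<subseteq> I"
  shows "pfaffian_ideal r k \<subseteq> I"
  unfolding pfaffian_ideal_def
  by (rule ring.genideal_minimal[OF cring.axioms(1)[OF skew_poly_ring_cring] assms])

text \<open>Expanding all vectors in unit vectors leaves Pfaffians of more than \<open>n\<close>
  unit vectors, which contain a repetition. \<open>U\<close> lists the indices already
  chosen.\<close>

lemma pf_bil_dim:
  fixes M :: "nat \<Rightarrow> nat \<Rightarrow> 'a::comm_ring_1"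
  assumes "alternating M" "n < length L"
  shows "pf (bil M n) L = 0"
proof -
  interpret B: alternating "bil M n" by (rule alternating_bil[OF assms(1)])
  have "pf (bil M n) (map unit_fun U @ K) = 0" if "set U \<subseteq> {..<n}" "n < length U + length K" for U K
    using that
  proof (induction K arbitrary: U)
    case Nil
    then have "\<not> distinct U"
      using card_mono[of "{..<n}" "set U"] distinct_card[of U] by auto
    then show ?case by (intro B.pf_repeat) (auto simp: distinct_map)
  next
    case (Cons x K)
    have "pf (bil M n) (map unit_fun U @ x # K) = (\<Sum>i<n. x i * pf (bil M n) (map unit_fun U @ unit_fun i # K))"
    proof (rule B.pf_linear)
      fix z
      have "bil M n (\<lambda>k. \<Sum>i<n. x i * unit_fun i k) z = (\<Sum>i<n. x i * bil M n (unit_fun i) z)"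
        by (rule bil_sum_left)
      moreover have "bil M n (\<lambda>k. \<Sum>i<n. x i * unit_fun i k) z = bil M n x z"
      proof -
        have "(\<Sum>i<n. x i * unit_fun i k) = (\<Sum>i<n. if i = k then x k else 0)" for k
          by (intro sum.cong refl) (auto simp: unit_fun_def)
        then show ?thesis unfolding bil_def by (intro sum.cong refl) simp
      qed
      ultimately show "bil M n x z = (\<Sum>i<n. x i * bil M n (unit_fun i) z)" by simp
    qed
    also have "\<dots> = 0"
      using Cons.IH[of "U @ [_]"] Cons.prems by (intro sum.neutral) auto
    finally show ?case .
  qed
  from this[of "[]" L] assms(2) show ?thesis by simp
qed

lemma sum_lessThan_double: "(\<Sum>i<2 * n. f i) = (\<Sum>l<n. f (2 * l) + f (Suc (2 * l)))"
  for f :: "nat \<Rightarrow> 'a::comm_monoid_add"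
  by (induction n) (simp_all add: add.assoc)

text \<open>The substituted matrix is a Gram matrix in a symplectic space of dimension
  \<open>2 * s\<close>: the column \<open>e x\<close> of the generic matrix is the vector belonging
  to the index \<open>x\<close>, and \<open>J\<close> is the form.\<close>

lemma generic_rank_pf_eq_0:
  assumes "2 * s < length L"
  shows "generic_rank s (pf skew_mat L) = (0 :: 'k::field pair_poly)"
proof -
  define J :: "nat \<Rightarrow> nat \<Rightarrow> 'k pair_poly" where
    "J x y = (if even x \<and> y = Suc x then 1 else if even y \<and> x = Suc y then - 1 else 0)" for x y
  have altJ: "alternating J" by unfold_locales (auto simp: J_def)
  define e :: "nat \<Rightarrow> nat \<Rightarrow> 'k pair_poly" where "e x a = indet a x" for x a
  have inner: "(\<Sum>j<2 * s. w j * J i j) = (if even i then w (Suc i) else - w (i - 1))" if "i < 2 * s" for i and w :: "nat \<Rightarrow> 'k pair_poly"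
  proof -
    have "(\<Sum>j<2 * s. w j * J i j) = (\<Sum>j<2 * s. if j = (if even i then Suc i else i - 1) then (if even i then w (Suc i) else - w (i - 1)) else 0)"
      by (intro sum.cong refl) (auto simp: J_def elim!: oddE)
    also have "\<dots> = (if even i then w (Suc i) else - w (i - 1))" using that by (auto elim!: evenE)
    finally show ?thesis .
  qed
  have bil: "bil J (2 * s) v w = (\<Sum>l<s. v (2 * l) * w (2 * l + 1) - v (2 * l + 1) * w (2 * l))" for v w
  proof -
    have "bil J (2 * s) v w = (\<Sum>i<2 * s. v i * (if even i then w (Suc i) else - w (i - 1)))"
      unfolding bil_def by (intro sum.cong refl) (simp add: mult.assoc inner flip: sum_distrib_left)
    also have "\<dots> = (\<Sum>l<s. v (2 * l) * w (2 * l + 1) - v (2 * l + 1) * w (2 * l))"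
      unfolding sum_lessThan_double by simp
    finally show ?thesis .
  qed
  interpret B: alternating "bil J (2 * s)" by (rule alternating_bil[OF altJ])
  have form: "generic_rank s (indet x y) = bil J (2 * s) (e x) (e y)" for x y
    by (simp add: generic_rank_def rank_form_def bil e_def)
  have "generic_rank s (skew_mat x y) = bil J (2 * s) (e x) (e y)" for x y
  proof (cases x y rule: linorder_cases)
    case greater
    have "generic_rank s (skew_mat x y) = - bil J (2 * s) (e y) (e x)"
      using greater form[of y x] by (simp add: skew_mat_def generic_rank_def subst_minus)
    then show ?thesis by (simp add: B.skew[of "e x"])
  qed (simp_all add: skew_mat_def form B.self, simp add: generic_rank_def)
  then have "generic_rank s (pf skew_mat L) = pf (bil J (2 * s)) (map e L)"
    unfolding pf_map by (simp add: generic_rank_def subst_pf)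
  also have "\<dots> = 0" using assms by (intro pf_bil_dim[OF altJ]) simp
  finally show ?thesis .
qed

lemma primeideal_generic_rank_kernel:
  "primeideal {f \<in> skew_poly_ring r. generic_rank s f = (0 :: 'k::field pair_poly)} (skew_ring r)"
proof (rule primeidealI)
  show "ideal {f \<in> skew_poly_ring r. generic_rank s f = (0 :: 'k pair_poly)} (skew_ring r)"
    by (rule ideal_skew_ringI)
      (auto simp: generic_rank_def subst_add subst_mult skew_poly_ring_add skew_poly_ring_mult)
  show "cring (skew_ring r)" by (rule skew_poly_ring_cring)
  have "(1 :: 'k pair_poly) \<notin> {f \<in> skew_poly_ring r. generic_rank s f = 0}" by (simp add: generic_rank_def)
  then show "carrier (skew_ring r) \<noteq> {f \<in> skew_poly_ring r. generic_rank s f = (0 :: 'k pair_poly)}"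
    using skew_poly_ring_one unfolding subring_of_simps by blast
next
  fix f g :: "'k pair_poly"
  assume "f \<in> carrier (skew_ring r)" "g \<in> carrier (skew_ring r)"
    "f \<otimes>\<^bsub>skew_ring r\<^esub> g \<in> {f \<in> skew_poly_ring r. generic_rank s f = 0}"
  then show "f \<in> {f \<in> skew_poly_ring r. generic_rank s f = 0} \<or> g \<in> {f \<in> skew_poly_ring r. generic_rank s f = 0}"
    by (simp add: generic_rank_def subst_mult)
qed

text \<open>All minimal primes of the Pfaffian ideal equal the kernel of \<open>generic_rank s\<close>.\<close>

lemma pf_notin_minimal_prime:
  fixes Q :: "'k::field pair_poly set"
  assumes Q: "Q \<in> minimal_primes (skew_ring r) (pfaffian_ideal r (2 * Suc s))"
  shows "pf skew_mat [0..<2 * s] \<notin> Q"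
proof -
  let ?P = "{f \<in> skew_poly_ring r. generic_rank s f = (0 :: 'k pair_poly)}"
  have prime: "primeideal Q (skew_ring r)" and IQ: "pfaffian_ideal r (2 * Suc s) \<subseteq> Q"
    using Q by (auto simp: minimal_primes_def)
  have "pfaffian_ideal r (2 * Suc s) \<subseteq> ?P"
  proof (rule pfaffian_ideal_minimal[OF primeideal.axioms(1)[OF primeideal_generic_rank_kernel]], rule subsetI)
    fix f :: "'k pair_poly" assume f: "f \<in> pfaffians r (2 * Suc s)"
    from pfaffians_eq_pf[OF f] obtain L where L: "length L = 2 * Suc s" "f = pf skew_mat L \<or> f = - pf skew_mat L" by blast
    then have "generic_rank s f = 0"
      using generic_rank_pf_eq_0[of s L] by (auto simp: generic_rank_def subst_minus)
    then show "f \<in> ?P" using f pfaffians_subset by auto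
  qed
  moreover have "?P \<subseteq> Q"
  proof
    fix f assume f: "f \<in> ?P"
    \<comment> \<open>The normal form needs a prime ideal of the whole type, hence the preimage of
      \<open>Q\<close> under the retraction.\<close>
    interpret prime_set "{f. retract r f \<in> Q}" by (rule prime_set_retract[OF prime])
    have "pf skew_mat L \<in> {f. retract r f \<in> Q}" if "set L \<subseteq> {..<r}" "length L = 2 * Suc s" for L
    proof -
      have "pf skew_mat L \<in> Q"
        using subsetD[OF IQ] pf_mem_pfaffian_ideal[OF that(1)] unfolding that(2) by blast
      then show ?thesis by (simp add: retract_self[OF pf_skew_mat_mem[OF that(1)]])
    qed
    from alternating_normal_form[OF alternating_skew_mat this]
    obtain c u v where c: "c \<notin> {f. retract r f \<in> Q}"
      and uv: "\<And>x y. x < r \<Longrightarrow> y < r \<Longrightarrow> c * skew_mat x y - (\<Sum>l<s. u l x * v l y - v l x * u l y) \<in> {f. retract r f \<in> Q}"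
      by blast
    have "f \<in> {f. retract r f \<in> Q}"
    proof (rule generic_rank_kernel_subset[OF prime_set_axioms _ _ c])
      show "c * indet i j - rank_form s u v (i, j) \<in> {f. retract r f \<in> Q}" if "i < j" "j < r" for i j
        using uv[of i j] that by (simp add: skew_mat_def rank_form_def)
    qed (use f in auto)
    then show "f \<in> Q" using f by (simp add: retract_self)
  qed
  ultimately have "?P = Q"
    using Q primeideal_generic_rank_kernel unfolding minimal_primes_def by blast
  then show ?thesis using generic_rank_pf by blast
qed

lemma ideal_pow_subset_gen_power:
  fixes I :: "'k::field pair_poly set"
  assumes "I \<subseteq> gen_power G 1"
  shows "I [^]\<^bsub>ideals_set (skew_ring r)\<^esub> n \<subseteq> gen_power G n"
proof (induction n)
  case 0
  then show ?case using gen_power_0 by blast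
next
  case (Suc n)
  have "I [^]\<^bsub>ideals_set (skew_ring r)\<^esub> Suc n = ideal_prod (skew_ring r) (I [^]\<^bsub>ideals_set (skew_ring r)\<^esub> n) I"
    by (simp add: nat_pow_def ideals_set_def)
  moreover have "x \<in> gen_power G (Suc n)" if "x \<in> ideal_prod (skew_ring r) (I [^]\<^bsub>ideals_set (skew_ring r)\<^esub> n) I" for x
    using that
  proof induction
    case (prod i j)
    then have "i * j \<in> gen_power G (n + 1)" using Suc assms by (intro gen_power_mult) auto
    then show ?case by simp
  qed (simp add: gen_power_add)
  ultimately show ?case by blast
qed

text \<open>Coefficients in \<open>gen_power\<close> may involve variables outside K[Z]. The
  retraction moves them into K[Z] while fixing \<open>x\<close> and all products of elements of
  \<open>Y\<close>.\<close>

lemma gen_power_subset_ideal_pow: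
  fixes I :: "'k::field pair_poly set"
  assumes I: "ideal I (skew_ring r)" and "Y \<subseteq> I" "x \<in> gen_power Y n" "x \<in> skew_poly_ring r"
  shows "x \<in> I [^]\<^bsub>ideals_set (skew_ring r)\<^esub> n"
proof -
  have Yr: "Y \<subseteq> skew_poly_ring r" using assms(2) ideal_skew_ringD(1)[OF I] by blast
  have base: "prod_list l \<in> I [^]\<^bsub>ideals_set (skew_ring r)\<^esub> length l \<and> retract r (prod_list l) = prod_list l"
    if "set l \<subseteq> Y" for l
    using that
  proof (induction l rule: rev_induct)
    case Nil
    then show ?case by (simp add: nat_pow_def ideals_set_def retract_one)
  next
    case (snoc y l)
    have "I [^]\<^bsub>ideals_set (skew_ring r)\<^esub> Suc (length l) = ideal_prod (skew_ring r) (I [^]\<^bsub>ideals_set (skew_ring r)\<^esub> length l) I"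
      by (simp add: nat_pow_def ideals_set_def)
    moreover have "prod_list l \<otimes>\<^bsub>skew_ring r\<^esub> y \<in> ideal_prod (skew_ring r) (I [^]\<^bsub>ideals_set (skew_ring r)\<^esub> length l) I"
      using snoc assms(2) by (intro ideal_prod.prod) auto
    ultimately show ?case using snoc Yr by (auto simp: retract_mult retract_self)
  qed
  note J = ideal_skew_ringD[OF cring.ideal_pow[OF skew_poly_ring_cring I, of n]]
  have "retract r x \<in> I [^]\<^bsub>ideals_set (skew_ring r)\<^esub> n"
    using assms(3)
  proof (induction rule: gen_power_induct)
    case zero
    then show ?case using J(2) by (simp add: retract_zero)
  next
    case (step c l y)
    have "retract r c * prod_list l \<in> I [^]\<^bsub>ideals_set (skew_ring r)\<^esub> n"
      using base[OF step(2)] J(4)[OF retract_mem] step(1) by blast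
    with J(3) step(3) base[OF step(2)] show ?case by (simp add: retract_add retract_mult)
  qed
  then show ?thesis using assms(4) by (simp add: retract_self)
qed

section \<open>The splitting\<close>

text \<open>The entries above the diagonal on the antidiagonal \<open>i + j = c\<close> have the row numbers
  \<open>anti_start r c + l\<close> for \<open>l < anti_length r c\<close>; both subtractions are truncated on purpose.\<close>

definition anti_start :: "nat \<Rightarrow> nat \<Rightarrow> nat" where
  "anti_start r c = Suc c - r"

definition anti_length :: "nat \<Rightarrow> nat \<Rightarrow> nat" where
  "anti_length r c = Suc c div 2 - anti_start r c"

definition anti_pf :: "nat \<Rightarrow> nat \<Rightarrow> 'k::field pair_poly" where
  "anti_pf r c = pf skew_mat (anti c (anti_start r c) (anti_length r c))"

lemma anti_bound: "anti_length r c > 0 \<Longrightarrow> 2 * (anti_start r c + anti_length r c) \<le> Suc c"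
  by (simp add: anti_length_def)

lemma set_anti_subset:
  assumes "r > 0"
  shows "set (anti c (anti_start r c) (anti_length r c)) \<subseteq> {..<r}"
proof (cases "anti_length r c > 0")
  case True
  have "set (anti c (anti_start r c) (anti_length r c)) \<subseteq> {anti_start r c..c - anti_start r c}"
    by (rule set_anti[OF anti_bound[OF True]])
  also have "\<dots> \<subseteq> {..<r}" using assms by (auto simp: anti_start_def)
  finally show ?thesis .
qed simp

lemma has_top_anti_pf:
  "has_top sqdist (anti_pf r c :: 'k::field pair_poly) (anti_mon c (anti_start r c) (anti_length r c))"
proof (cases "anti_length r c > 0")
  case True
  show ?thesis unfolding anti_pf_def by (rule has_top_pf_anti[OF anti_bound[OF True]])
qed (simp add: anti_pf_def anti_mon_def)

lemma anti_mon_eq: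
  "anti_mon c (anti_start r c) (anti_length r c) =
    (\<Sum>v\<in>{v \<in> vars r. fst v + snd v = c}. Poly_Mapping.single v 1)"
  unfolding anti_mon_def
proof (rule sum.reindex_bij_witness[where i = "\<lambda>v. fst v - anti_start r c"
      and j = "\<lambda>l. (anti_start r c + l, c - (anti_start r c + l))"])
  fix l assume "l \<in> {..<anti_length r c}"
  then show "(anti_start r c + l, c - (anti_start r c + l)) \<in> {v \<in> vars r. fst v + snd v = c}"
    by (auto simp: anti_length_def anti_start_def)
next
  fix v assume "v \<in> {v \<in> vars r. fst v + snd v = c}"
  then show "fst v - anti_start r c \<in> {..<anti_length r c}"
    "(anti_start r c + (fst v - anti_start r c), c - (anti_start r c + (fst v - anti_start r c))) = v"
    by (auto simp: anti_length_def anti_start_def)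
qed auto

lemma has_top_prod_anti_pf: "has_top sqdist (\<Prod>c<2 * r. anti_pf r c :: 'k::field pair_poly) (all_vars r)"
proof -
  have "(\<Sum>c<2 * r. anti_mon c (anti_start r c) (anti_length r c)) = all_vars r"
    unfolding anti_mon_eq all_vars_def by (rule sum.group) auto
  moreover have "has_top sqdist (\<Prod>c<2 * r. anti_pf r c :: 'k pair_poly)
      (\<Sum>c<2 * r. anti_mon c (anti_start r c) (anti_length r c))"
    by (rule has_top_prod) (simp_all add: has_top_anti_pf)
  ultimately show ?thesis by (simp only:)
qed

text \<open>Moving \<open>(z, x)\<close> up by \<open>2 * s\<close> rows puts it on the antidiagonal
  \<open>c = z - 2 * s + x\<close>, in a row that avoids the \<open>s\<close> innermost ones because
  \<open>x\<close> exceeds the new row number by more than \<open>2 * s\<close>. This count lets the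
  exponent of \<open>F\<close> reach the number of generators.\<close>

lemma card_pairs_le:
  "card {(z, x). 2 * s \<le> z \<and> z < x \<and> x < r} \<le> (\<Sum>c<2 * r. anti_length r c - s)"
proof -
  let ?A = "{(z, x). 2 * s \<le> z \<and> z < x \<and> x < r}"
  let ?B = "SIGMA c:{..<2 * r}. {anti_start r c..<Suc c div 2 - s}"
  have "card ?A \<le> card ?B"
  proof (rule card_inj_on_le[where f = "\<lambda>(z, x). (z - 2 * s + x, z - 2 * s)"])
    show "inj_on (\<lambda>(z, x). (z - 2 * s + x, z - 2 * s)) ?A" by (auto simp: inj_on_def)
    show "(\<lambda>(z, x). (z - 2 * s + x, z - 2 * s)) ` ?A \<subseteq> ?B" by (auto simp: anti_start_def)
  qed auto
  also have "card ?B = (\<Sum>c<2 * r. anti_length r c - s)"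
    by (simp add: anti_length_def add.commute)
  finally show ?thesis .
qed

definition pivot_gens :: "nat \<Rightarrow> nat \<Rightarrow> 'k::field pair_poly set" where
  "pivot_gens r s = (\<lambda>(z, x). pf skew_mat (z # x # [0..<2 * s])) ` {(z, x). 2 * s \<le> z \<and> z < x \<and> x < r}"

lemma finite_pairs: "finite {(z, x). 2 * s \<le> z \<and> z < x \<and> x < (r :: nat)}"
  by (rule finite_subset[of _ "{..<r} \<times> {..<r}"]) auto

lemma card_pivot_gens_le: "card (pivot_gens r s) \<le> (\<Sum>c<2 * r. anti_length r c - s)"
  unfolding pivot_gens_def using card_image_le[OF finite_pairs] card_pairs_le by (rule order_trans)

lemma finite_pivot_gens: "finite (pivot_gens r s)"
  unfolding pivot_gens_def by (rule finite_imageI[OF finite_pairs])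

lemma pivot_gens_span:
  assumes "z < r" "x < r"
  shows "(pf skew_mat (z # x # [0..<2 * s]) :: 'k::field pair_poly) \<in> gen_power (pivot_gens r s) 1"
proof -
  interpret alternating "skew_mat :: nat \<Rightarrow> nat \<Rightarrow> 'k pair_poly" by (rule alternating_skew_mat)
  have gen: "(pf skew_mat (z # x # [0..<2 * s]) :: 'k pair_poly) \<in> gen_power (pivot_gens r s) 1"
    if "2 * s \<le> z" "z < x" "x < r" for z x
    by (rule gen_power_1) (use that in \<open>auto simp: pivot_gens_def\<close>)
  show ?thesis
  proof (cases "distinct (z # x # [0..<2 * s])")
    case False
    then show ?thesis using pf_repeat[OF False] by (simp only: gen_power_zero)
  next
    case True
    then have zx: "2 * s \<le> z" "2 * s \<le> x" "z \<noteq> x" by auto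
    show ?thesis
    proof (cases "z < x")
      case True
      then show ?thesis using gen zx assms by blast
    next
      case False
      with zx(3) have "x < z" by simp
      have "pf skew_mat (z # x # [0..<2 * s]) = - (pf skew_mat (x # z # [0..<2 * s]) :: 'k pair_poly)"
        using pf_swap[of "[]" z x "[0..<2 * s]"] by (simp only: append_Nil)
      then show ?thesis using gen_power_minus[OF gen[OF zx(2) \<open>x < z\<close> assms(1)]] by (simp only:)
    qed
  qed
qed

lemma pivot_gens_subset:
  assumes "2 * Suc s \<le> r"
  shows "pivot_gens r s \<subseteq> (pfaffian_ideal r (2 * Suc s) :: 'k::field pair_poly set)"
  unfolding pivot_gens_def
proof (rule image_subsetI)
  fix v assume v: "v \<in> {(z, x). 2 * s \<le> z \<and> z < x \<and> x < r}"
  obtain z x where zx: "v = (z, x)" by (cases v)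
  with v have "set (z # x # [0..<2 * s]) \<subseteq> {..<r}" using assms by auto
  from pf_mem_pfaffian_ideal[OF this]
  show "(case v of (z, x) \<Rightarrow> pf skew_mat (z # x # [0..<2 * s])) \<in> (pfaffian_ideal r (2 * Suc s) :: 'k pair_poly set)"
    by (simp add: zx)
qed

text \<open>After inverting the Pfaffian of the upper left block of size \<open>2 s\<close>, the ideal of Pfaffians of
  size \<open>2 s + 2\<close> is generated by as many elements as its height.\<close>

lemma pf_mem_pivot_gens:
  assumes "2 * s \<le> r" "set L \<subseteq> {..<r}" "length L = 2 * k"
  shows "pf skew_mat [0..<2 * s] ^ (2 * k) * pf skew_mat L \<in> (gen_power (pivot_gens r s) (k - s) :: 'k::field pair_poly set)"
  by (rule pf_mem_gen_power[OF alternating_skew_mat]) (use assms pivot_gens_span in auto)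

lemma pfaffians_mem_pivot_gens:
  assumes "2 * s \<le> r" "f \<in> pfaffians r (2 * Suc s)"
  shows "pf skew_mat [0..<2 * s] ^ (2 * Suc s) * f \<in> (gen_power (pivot_gens r s) 1 :: 'k::field pair_poly set)"
proof -
  obtain L where L: "set L \<subseteq> {..<r}" "length L = 2 * Suc s" "f = pf skew_mat L \<or> f = - pf skew_mat L"
    using pfaffians_eq_pf[OF assms(2)] by blast
  have "Suc s - s = 1" by simp
  then have *: "pf skew_mat [0..<2 * s] ^ (2 * Suc s) * pf skew_mat L \<in> (gen_power (pivot_gens r s) 1 :: 'k pair_poly set)"
    using pf_mem_pivot_gens[OF assms(1) L(1,2)] by (simp only:)
  then have "pf skew_mat [0..<2 * s] ^ (2 * Suc s) * - pf skew_mat L \<in> (gen_power (pivot_gens r s) 1 :: 'k pair_poly set)"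
    unfolding mult_minus_right by (rule gen_power_minus)
  with * show ?thesis using L(3) by blast
qed

text \<open>The exponents \<open>anti_length r c - s\<close> of the factors add up to at least the
  number of generators. The size of \<open>N\<close> is immaterial, as the block Pfaffian avoids the
  minimal primes.\<close>

lemma prod_anti_pf_mem_pivot_gens:
  assumes "2 * s \<le> r" "r > 0"
  shows "\<exists>N. pf skew_mat [0..<2 * s] ^ N * (\<Prod>c<2 * r. anti_pf r c) \<in>
    (gen_power (pivot_gens r s) (card (pivot_gens r s :: 'k pair_poly set)) :: 'k::field pair_poly set)"
proof -
  let ?d = "pf skew_mat [0..<2 * s] :: 'k pair_poly"
  have "?d ^ (2 * anti_length r c) * anti_pf r c \<in> gen_power (pivot_gens r s) (anti_length r c - s)" for c
    unfolding anti_pf_def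
    by (rule pf_mem_pivot_gens[OF assms(1) set_anti_subset[OF assms(2)]]) simp
  then have "(\<Prod>c<2 * r. ?d ^ (2 * anti_length r c) * anti_pf r c) \<in>
      gen_power (pivot_gens r s) (\<Sum>c<2 * r. anti_length r c - s)"
    by (intro gen_power_prod) auto
  then have "?d ^ (\<Sum>c<2 * r. 2 * anti_length r c) * (\<Prod>c<2 * r. anti_pf r c) \<in>
      gen_power (pivot_gens r s) (\<Sum>c<2 * r. anti_length r c - s)"
    by (simp only: prod.distrib power_sum)
  from gen_power_antimono[OF this card_pivot_gens_le] show ?thesis by blast
qed

text \<open>Up to \<open>card Y * (p - 1)\<close> factors may be lost to exponents below
  \<open>p\<close>; the other \<open>n * p + 1\<close> force \<open>n + 1\<close> factors that are
  \<open>p\<close>-th powers of generators, each of which leaves the trace as the generator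
  itself.\<close>

lemma trace_map_gen_power:
  fixes \<Lambda> :: "'k::field \<Rightarrow> 'k"
  assumes char: "CHAR('k) = p" "p > 0"
    and \<Lambda>: "\<And>x y. \<Lambda> (x + y) = \<Lambda> x + \<Lambda> y" "\<And>a x. \<Lambda> (a ^ p * x) = a * \<Lambda> x" "\<Lambda> 1 = 1"
    and Y: "finite Y" "f \<in> gen_power Y (card Y * (p - 1) + n * p + 1)"
  shows "trace_map p r \<Lambda> f \<in> gen_power Y (n + 1)"
  using Y(2)
proof (induction rule: gen_power_induct)
  case zero
  then show ?case by (simp add: trace_map_zero[OF char \<Lambda>])
next
  case (step c l y)
  obtain d k where k: "length k = Suc n" "set k \<subseteq> Y" "prod_list l = d * prod_list k ^ p"
    using prod_list_pth_powers[OF Y(1) step(2), of p n] step(1) by auto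
  have "c * prod_list l = prod_list k ^ p * (c * d)" by (simp add: k(3) mult_ac)
  then have "trace_map p r \<Lambda> (c * prod_list l + y) = prod_list k * trace_map p r \<Lambda> (c * d) + trace_map p r \<Lambda> y"
    by (simp only: trace_map_add[OF char \<Lambda>] trace_map_mult[OF char \<Lambda>])
  moreover have "prod_list k \<in> gen_power Y (n + 1)" using gen_power_base[OF k(2)] k(1) by simp
  ultimately show ?case
    using step(3) gen_power_mult_left[of "prod_list k" Y "n + 1" "trace_map p r \<Lambda> (c * d)"]
    by (simp add: gen_power_add mult.commute)
qed

section \<open>The embedding into the algebraic closure\<close>

lemma ac_embed_add: "ac_embed (x + y) = ac_embed x + ac_embed y"
  and ac_embed_mult: "ac_embed (x * y) = ac_embed x * ac_embed y"
  and ac_embed_one: "ac_embed (1 :: 'a) = 1"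
  for x y :: "'a::idom"
proof -
  interpret h: comm_ring_hom "to_fract :: 'a \<Rightarrow> 'a fract" by (rule to_fract_hom)
  show "ac_embed (x + y) = ac_embed x + ac_embed y" "ac_embed (x * y) = ac_embed x * ac_embed y"
    "ac_embed (1 :: 'a) = 1"
    by (simp_all only: ac_embed_def h.hom_add h.hom_mult h.hom_one to_ac_add to_ac_mult to_ac_1)
qed

lemma ac_embed_inj: "ac_embed x = ac_embed y \<Longrightarrow> x = y"
  by (simp add: ac_embed_def to_fract_def eq_fract)

lemma ac_embed_power: "ac_embed (x ^ n) = ac_embed x ^ n"
  by (induction n) (auto simp: ac_embed_one ac_embed_mult)

lemma CHAR_fract: "CHAR('a::idom fract) = CHAR('a)"
proof (rule CHAR_eqI)
  interpret h: comm_ring_hom "to_fract :: 'a \<Rightarrow> 'a fract" by (rule to_fract_hom)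
  have of_nat: "(of_nat n :: 'a fract) = to_fract (of_nat n)" for n
    by (induction n) (simp_all only: of_nat_0 of_nat_Suc h.hom_zero h.hom_one h.hom_add)
  show "of_nat CHAR('a) = (0 :: 'a fract)" unfolding of_nat by (simp add: to_fract_def Zero_fract_def)
  show "CHAR('a) dvd n" if "of_nat n = (0 :: 'a fract)" for n
    using that unfolding of_nat by (simp add: to_fract_def Zero_fract_def eq_fract of_nat_eq_0_iff_char_dvd)
qed

theorem theorem6p23:
  fixes r p t :: nat
  assumes "r > 0"
    and "CHAR('k::field) = p" and "p > 0"
    and "F_finite TYPE('k)"
    and "t \<ge> 1" and "2 * t \<le> r"
  shows "symbolic_F_split p (skew_poly_ring r :: 'k pair_poly set) (pfaffian_ideal r (2 * t))"
proof -
  obtain s where t: "t = Suc s" using \<open>t \<ge> 1\<close> by (cases t) auto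
  have s: "2 * Suc s \<le> r" "2 * s \<le> r" using \<open>2 * t \<le> r\<close> by (auto simp: t)
  obtain \<Lambda> :: "'k \<Rightarrow> 'k" where \<Lambda>: "\<And>x y. \<Lambda> (x + y) = \<Lambda> x + \<Lambda> y"
    "\<And>a x. \<Lambda> (a ^ p * x) = a * \<Lambda> x" "\<Lambda> 1 = 1"
    using exists_frobenius_splitting[OF assms(2,3)] by blast
  note char = assms(2,3)
  let ?A = "skew_poly_ring r :: 'k pair_poly set"
  let ?I = "pfaffian_ideal r (2 * t) :: 'k pair_poly set"
  let ?Y = "pivot_gens r s :: 'k pair_poly set"
  define Tr where "Tr = trace_map p r \<Lambda>"
  define F :: "'k pair_poly" where "F = (\<Prod>c<2 * r. anti_pf r c)"
  define \<delta> :: "'k pair_poly" where "\<delta> = pf skew_mat [0..<2 * s]"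
  have FA: "F \<in> ?A"
    unfolding F_def anti_pf_def
    by (intro skew_poly_ring_prod pf_skew_mat_mem set_anti_subset assms(1))
  have \<delta>A: "\<delta> \<in> ?A" unfolding \<delta>_def by (rule pf_skew_mat_mem) (use s in auto)
  have Tr_one: "Tr (F ^ (p - 1)) = 1"
    unfolding Tr_def F_def
    by (rule trace_map_top[OF char \<Lambda> has_top_prod_anti_pf]) (simp add: sqdist_def)
  note Tr_add = trace_map_add[OF char \<Lambda>, of r, folded Tr_def]
    and Tr_mult = trace_map_mult[OF char \<Lambda>, of r, folded Tr_def]
    and Tr_mem = trace_map_mem[OF char \<Lambda>, of _ r, folded Tr_def]
  \<comment> \<open>Unique on \<open>pth_roots p ?A\<close> because the embedding is injective;
    elsewhere the value is arbitrary.\<close>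
  define root where "root x = (THE b. b \<in> ?A \<and> x ^ p = ac_embed b)" for x
  have root_eq: "root x = b" if "b \<in> ?A" "x ^ p = ac_embed b" for x b
    unfolding root_def using that ac_embed_inj by (intro the_equality) auto
  have root: "root x \<in> ?A" "x ^ p = ac_embed (root x)" if x: "x \<in> pth_roots p ?A" for x
  proof -
    obtain b where "b \<in> ?A" "x ^ p = ac_embed b" using x by (auto simp: pth_roots_def)
    then show "root x \<in> ?A" "x ^ p = ac_embed (root x)" using root_eq by simp_all
  qed
  have "CHAR('k pair_poly fract alg_closure) = p"
    by (simp add: CHAR_fract CHAR_pair_poly[OF char \<Lambda>])
  then have frobenius: "(x + y) ^ p = x ^ p + y ^ p" for x y :: "'k pair_poly fract alg_closure"
    using prime_char[OF char \<Lambda>] by (intro freshmans_dream) simp_all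
  define \<phi> where "\<phi> x = Tr (F ^ (p - 1) * root x)" for x
  have "\<phi> x \<in> ?A" if "x \<in> pth_roots p ?A" for x
    unfolding \<phi>_def by (intro Tr_mem skew_poly_ring_mult skew_poly_ring_power FA root(1) that)
  moreover have "\<phi> (x + y) = \<phi> x + \<phi> y" if "x \<in> pth_roots p ?A" "y \<in> pth_roots p ?A" for x y
  proof -
    have "root (x + y) = root x + root y"
      using root[OF that(1)] root[OF that(2)]
      by (intro root_eq) (simp_all add: skew_poly_ring_add frobenius ac_embed_add)
    then show ?thesis by (simp add: \<phi>_def distrib_left Tr_add)
  qed
  moreover have "\<phi> (ac_embed a * x) = a * \<phi> x" if "a \<in> ?A" "x \<in> pth_roots p ?A" for a x
  proof -
    have "root (ac_embed a * x) = a ^ p * root x"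
      using root[OF that(2)] that(1)
      by (intro root_eq)
        (simp_all add: skew_poly_ring_mult skew_poly_ring_power power_mult_distrib ac_embed_mult ac_embed_power)
    then show ?thesis using Tr_mult[of a "F ^ (p - 1) * root x"] by (simp add: \<phi>_def mult.left_commute)
  qed
  moreover have "\<phi> (ac_embed a) = a" if "a \<in> ?A" for a
  proof -
    have "root (ac_embed a) = a ^ p"
      using that by (intro root_eq) (simp_all add: skew_poly_ring_power ac_embed_power)
    then show ?thesis using Tr_mult[of a "F ^ (p - 1)"] Tr_one by (simp add: \<phi>_def mult.commute)
  qed
  moreover have "\<phi> ` pth_roots p (symbolic_power (skew_ring r) ?I (n * p + 1))
      \<subseteq> symbolic_power (skew_ring r) ?I (n + 1)" for n
  proof (rule image_subsetI)
    fix x assume "x \<in> pth_roots p (symbolic_power (skew_ring r) ?I (n * p + 1))"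
    then obtain g where g: "g \<in> symbolic_power (skew_ring r) ?I (n * p + 1)" "x ^ p = ac_embed g"
      by (auto simp: pth_roots_def)
    note sym = cring.symbolic_power_iff[OF skew_poly_ring_cring ideal_pfaffian_ideal]
    obtain u where gA: "g \<in> ?A" and u: "u \<in> ?A - \<Union>(minimal_primes (skew_ring r) ?I)"
      and ug: "u * g \<in> ?I [^]\<^bsub>ideals_set (skew_ring r)\<^esub> (n * p + 1)"
      using g(1) unfolding sym subring_of_simps by blast
    have \<phi>x: "\<phi> x = Tr (F ^ (p - 1) * g)" by (simp add: \<phi>_def root_eq[OF gA g(2)])
    have "ideal (gen_power (pfaffians r (2 * t)) 1 \<inter> ?A) (skew_ring r)"
      by (rule ideal_skew_ringI)
        (auto simp: gen_power_add gen_power_mult_left skew_poly_ring_add skew_poly_ring_mult)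
    then have "?I \<subseteq> gen_power (pfaffians r (2 * t)) 1 \<inter> ?A"
      by (rule pfaffian_ideal_minimal) (use gen_power_1 pfaffians_subset in blast)
    then have "u * g \<in> gen_power (pfaffians r (2 * t)) (n * p + 1)"
      using ideal_pow_subset_gen_power ug by blast
    moreover have "\<delta> ^ (2 * t) * f \<in> gen_power ?Y 1" if "f \<in> pfaffians r (2 * t)" for f
      using pfaffians_mem_pivot_gens[OF s(2), of f] that unfolding t \<delta>_def by blast
    ultimately have "(\<delta> ^ (2 * t)) ^ (n * p + 1) * (u * g) \<in> gen_power ?Y (1 * (n * p + 1))"
      using gen_power_scale by blast
    then have 1: "(\<delta> ^ (2 * t)) ^ (n * p + 1) * (u * g) \<in> gen_power ?Y (n * p + 1)"
      by (simp only: mult_1)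
    obtain N where "\<delta> ^ N * F \<in> gen_power ?Y (card ?Y)"
      using prod_anti_pf_mem_pivot_gens[OF s(2) assms(1)] unfolding \<delta>_def F_def by blast
    from gen_power_power[OF this, of "p - 1"]
    have 2: "(\<delta> ^ N * F) ^ (p - 1) \<in> gen_power ?Y (card ?Y * (p - 1))" .
    \<comment> \<open>Collects the powers of \<open>\<delta>\<close>: \<open>N\<close> for each of
      the \<open>p - 1\<close> factors \<open>F\<close>, and \<open>2 * t\<close> for each of the
      \<open>n * p + 1\<close> generators in the terms of \<open>u * g\<close>.\<close>
    define E where "E = N * (p - 1) + 2 * t * (n * p + 1)"
    define w where "w = \<delta> ^ E * u"
    have "\<delta> ^ E = (\<delta> ^ N) ^ (p - 1) * (\<delta> ^ (2 * t)) ^ (n * p + 1)"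
      by (simp only: E_def power_add[of \<delta> "N * (p - 1)" "2 * t * (n * p + 1)"] power_mult)
    then have eq: "(\<delta> ^ N * F) ^ (p - 1) * ((\<delta> ^ (2 * t)) ^ (n * p + 1) * (u * g)) = \<delta> ^ E * (u * (F ^ (p - 1) * g))"
      by (simp only: power_mult_distrib mult_ac)
    have 3: "w * (F ^ (p - 1) * g) \<in> gen_power ?Y (card ?Y * (p - 1) + n * p + 1)"
      using gen_power_mult[OF 2 1] unfolding eq by (simp only: w_def mult.assoc add.assoc)
    \<comment> \<open>A single \<open>w\<close> suffices for membership; the further
      \<open>p - 1\<close> factors complete a \<open>p\<close>-th power, so that the trace releases
      \<open>w\<close>.\<close>
    have "w ^ p = w ^ (p - 1) * w" using \<open>p > 0\<close> by (simp flip: power_Suc2)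
    then have "w ^ p * (F ^ (p - 1) * g) = w ^ (p - 1) * (w * (F ^ (p - 1) * g))" by (simp only: mult.assoc)
    then have "w ^ p * (F ^ (p - 1) * g) \<in> gen_power ?Y (card ?Y * (p - 1) + n * p + 1)"
      using gen_power_mult_left[OF 3, of "w ^ (p - 1)"] by (simp only:)
    from trace_map_gen_power[OF char \<Lambda> finite_pivot_gens this, of r, folded Tr_def]
    have "w * \<phi> x \<in> gen_power ?Y (n + 1)" by (simp only: Tr_mult \<phi>x)
    moreover have "\<phi> x \<in> ?A"
      unfolding \<phi>x by (intro Tr_mem skew_poly_ring_mult skew_poly_ring_power FA gA)
    moreover have wA: "w \<in> ?A" using u \<delta>A by (auto simp: w_def intro!: skew_poly_ring_mult skew_poly_ring_power)
    ultimately have "w * \<phi> x \<in> ?I [^]\<^bsub>ideals_set (skew_ring r)\<^esub> (n + 1)"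
      using gen_power_subset_ideal_pow[OF ideal_pfaffian_ideal pivot_gens_subset[OF s(1), folded t]]
        skew_poly_ring_mult by blast
    moreover have "w \<notin> Q" if Q: "Q \<in> minimal_primes (skew_ring r) ?I" for Q
    proof -
      have prime: "primeideal Q (skew_ring r)" using Q by (simp add: minimal_primes_def)
      interpret prime_set "{f. retract r f \<in> Q}" by (rule prime_set_retract[OF prime])
      have "\<delta> \<notin> Q" using pf_notin_minimal_prime[OF Q[unfolded t]] by (simp add: \<delta>_def)
      moreover have "u \<notin> Q" using u Q by blast
      ultimately have "\<delta> \<notin> {f. retract r f \<in> Q}" "u \<notin> {f. retract r f \<in> Q}"
        using \<delta>A u by (simp_all add: retract_self)
      then have "w \<notin> {f. retract r f \<in> Q}"
        unfolding w_def using local.prime local.power by blast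
      then show ?thesis using wA by (simp add: retract_self)
    qed
    ultimately show "\<phi> x \<in> symbolic_power (skew_ring r) ?I (n + 1)"
      using \<open>\<phi> x \<in> ?A\<close> wA unfolding sym subring_of_simps by blast
  qed
  ultimately show ?thesis unfolding symbolic_F_split_def by (intro exI[of _ \<phi>]) blast
qed

end
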